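(* Let $n\ge3$ be an integer, $2^*=2n/(n-2)$ and $d\mu(r)=r^{n-1}dr$ on $\mathbb{R}^+=(0,\infty)$. There exists a positive constant $C$ depending only on $n$ such that, for all $h$ with $h,\nabla h\in L^2(\mathbb{R}^n)$, $$\|\mathcal{M}(h)\|^2_{L^{2^*}(\mathbb{R}^+;d\mu)}\le C\left\{\|\nabla h\|^2_{L^2(\mathbb{R}^n)}-\Big(\frac{n-2}{2}\Big)^2\Big\|\frac{h}{|\cdot|}\Big\|^2_{L^2(\mathbb{R}^n)}\right\}^{1/n}\left\{\Big\|\frac{h}{|\cdot|}\Big\|^2_{L^2(\mathbb{R}^n)}\right\}^{1-1/n}.$$ Hence, for any $\varepsilon>0$ (with a positive constant $C$ depending only on $n$), $$\varepsilon^{1-1/n}\,\|\mathcal{M}(h)\|^2_{L^{2^*}(\mathbb{R}^+;d\mu)}\le C\left\{\|\nabla h\|^2_{L^2(\mathbb{R}^n)}-\Big[\Big(\frac{n-2}{2}\Big)^2-\varepsilon\Big]\Big\|\frac{h}{|\cdot|}\Big\|^2_{L^2(\mathbb{R}^n)}\right\}.$$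
   Context: $\mathcal{M}(h)(r)=\frac{1}{|\mathbb{S}^{n-1}|}\int_{\mathbb{S}^{n-1}}h(r\omega)\,d\omega$ is the integral mean of $h$ over the unit sphere $\mathbb{S}^{n-1}$, and $h/|\cdot|$ denotes the function $\mathbf{x}\mapsto h(\mathbf{x})/|\mathbf{x}|$. The norm is $\|H\|_{L^{2^*}(\mathbb{R}^+;d\mu)}=\big(\int_0^\infty|H(r)|^{2^*}r^{n-1}dr\big)^{1/2^*}$. *)

theory Defs
  imports "HOL-Analysis.Analysis"
begin

section \<open>Lebesgue spaces\<close>

definition in_Lp :: "real \<Rightarrow> 'a measure \<Rightarrow> ('a \<Rightarrow> 'b::{banach, second_countable_topology}) \<Rightarrow> bool" where
  "in_Lp p M f \<longleftrightarrow> f \<in> borel_measurable M \<and> integrable M (\<lambda>x. norm (f x) powr p)"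

text \<open>Meaningful only together with \<^const>\<open>in_Lp\<close>: a Bochner integral that does not exist is 0.\<close>

definition Lp_norm :: "real \<Rightarrow> 'a measure \<Rightarrow> ('a \<Rightarrow> 'b::{banach, second_countable_topology}) \<Rightarrow> real" where
  "Lp_norm p M f = (\<integral>x. norm (f x) powr p \<partial>M) powr (1 / p)"


section \<open>Weak gradients\<close>

definition partial_deriv :: "'n::finite \<Rightarrow> (real^'n \<Rightarrow> real) \<Rightarrow> real^'n \<Rightarrow> real" where
  "partial_deriv i f x = frechet_derivative f (at x) (axis i 1)"

primrec C_diff :: "nat \<Rightarrow> (real^'n::finite \<Rightarrow> real) \<Rightarrow> bool" where
  "C_diff 0 f \<longleftrightarrow> continuous_on UNIV f"
| "C_diff (Suc k) f \<longleftrightarrow> (\<forall>x. f differentiable (at x)) \<and> (\<forall>i. C_diff k (partial_deriv i f))"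

definition test_function :: "(real^'n::finite \<Rightarrow> real) \<Rightarrow> bool" where
  "test_function \<phi> \<longleftrightarrow> (\<forall>k. C_diff k \<phi>) \<and> compact (closure {x. \<phi> x \<noteq> 0})"

definition locally_integrable :: "(real^'n::finite \<Rightarrow> 'b::{banach, second_countable_topology}) \<Rightarrow> bool" where
  "locally_integrable f \<longleftrightarrow> (\<forall>K. compact K \<longrightarrow> set_integrable lebesgue K f)"

text \<open>Real-valued test functions suffice, since the identity is linear in \<open>\<phi>\<close>.\<close>

definition weak_gradient :: "(real^'n::finite \<Rightarrow> complex) \<Rightarrow> (real^'n \<Rightarrow> complex^'n) \<Rightarrow> bool" where
  "weak_gradient h g \<longleftrightarrow> locally_integrable h \<and> locally_integrable g \<and>
    (\<forall>\<phi> i. test_function \<phi> \<longrightarrow>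
      (\<integral>x. h x * of_real (partial_deriv i \<phi> x) \<partial>lebesgue) =
      - (\<integral>x. g x $ i * of_real (\<phi> x) \<partial>lebesgue))"


section \<open>Surface measure and spherical means\<close>

text \<open>
  The surface measure of a Borel set \<open>A\<close> of the unit sphere is \<open>n\<close> times the volume of the solid
  cone \<open>{r *\<^sub>R \<omega> | 0 < r \<le> 1, \<omega> \<in> A}\<close>; see \<open>emeasure_surface_measure\<close> below. It is completed because
  the restriction of a Lebesgue measurable function to a sphere need not be Borel
  measurable: for almost every radius it is measurable for the completion.
\<close>

definition surface_measure :: "(real^'n::finite) measure" where
  "surface_measure = completion (scale_measure (of_nat CARD('n))
     (distr (restrict_space lborel (cball 0 1 - {0})) (restrict_space borel (sphere 0 1))
        (\<lambda>x. x /\<^sub>R norm x)))"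

definition spherical_mean :: "(real^'n::finite \<Rightarrow> complex) \<Rightarrow> real \<Rightarrow> complex" where
  "spherical_mean h r =
     (\<integral>\<omega>. h (r *\<^sub>R \<omega>) \<partial>surface_measure) /\<^sub>R measure (surface_measure :: (real^'n) measure) (sphere 0 1)"

definition radial_measure :: "nat \<Rightarrow> real measure" where
  "radial_measure n = density (lebesgue_on {0<..}) (\<lambda>r. ennreal (r ^ (n - 1)))"

lemma space_surface_measure: "space (surface_measure :: (real^'n::finite) measure) = sphere 0 1"
  by (simp add: surface_measure_def space_scale_measure space_restrict_space)

lemma emeasure_surface_measure:
  fixes A :: "(real^'n::finite) set"
  assumes "A \<in> sets borel" "A \<subseteq> sphere 0 1"
  shows "emeasure surface_measure A =
    of_nat CARD('n) * emeasure lborel {r *\<^sub>R \<omega> | r \<omega>. 0 < r \<and> r \<le> 1 \<and> \<omega> \<in> A}"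
proof -
  let ?B = "cball (0::real^'n) 1 - {0}"
  let ?M = "restrict_space lborel ?B" and ?S = "restrict_space borel (sphere (0::real^'n) 1)"
  let ?f = "\<lambda>x::real^'n. x /\<^sub>R norm x"
  have A: "A \<in> sets ?S"
    using assms by (auto simp: sets_restrict_space)
  have f: "?f \<in> measurable ?M ?S"
    by (rule measurable_restrict_space2) (auto simp: space_restrict_space intro!: measurable_restrict_space1)
  have cone: "?f -` A \<inter> space ?M = {r *\<^sub>R \<omega> | r \<omega>. 0 < r \<and> r \<le> 1 \<and> \<omega> \<in> A}" (is "?L = ?R")
  proof (intro set_eqI iffI)
    fix x assume x: "x \<in> ?L"
    then have "x = norm x *\<^sub>R ?f x" "0 < norm x" "norm x \<le> 1" "?f x \<in> A"
      by (auto simp: space_restrict_space)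
    then show "x \<in> ?R" by blast
  next
    fix x assume "x \<in> ?R"
    then obtain r \<omega> where x: "x = r *\<^sub>R \<omega>" "0 < r" "r \<le> 1" "\<omega> \<in> A" by blast
    moreover have "norm \<omega> = 1" using x assms by auto
    moreover have "\<omega> \<noteq> 0" using \<open>norm \<omega> = 1\<close> by auto
    ultimately show "x \<in> ?L" by (auto simp: space_restrict_space)
  qed
  have "emeasure surface_measure A = of_nat CARD('n) * emeasure ?M (?f -` A \<inter> space ?M)"
    using A f by (simp add: surface_measure_def emeasure_distr)
  also have "emeasure ?M (?f -` A \<inter> space ?M) = emeasure lborel (?f -` A \<inter> space ?M)"
    by (rule emeasure_restrict_space) (auto simp: space_restrict_space)
  finally show ?thesis unfolding cone .
qed

end

theory Submission
  imports Defs
begin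

text \<open>
  Only the radial part of the gradient matters. Write \<open>\<partial>h\<close> for the radial derivative
  \<open>x \<bullet> g x / |x|\<close>, so that \<open>|\<partial>h| \<le> |g|\<close>, put \<open>a = (n - 2) / 2\<close> and \<open>q = \<partial>h + a h / |x|\<close>. On a ray,
  \<open>r\<^sup>a q\<close> is the derivative of \<open>r\<^sup>a h\<close>, and expanding the square gives
  \<open>r^(n-1) |\<partial>h|\<^sup>2 = r^(n-1) |q|\<^sup>2 + a\<^sup>2 r^(n-3) |h|\<^sup>2 - a (r^(n-2) |h|\<^sup>2)'\<close>.
  The last term is a total derivative whose contribution has a favourable sign, so after integration over all rays
  the integral of \<open>|q|\<^sup>2\<close> is at most the Hardy deficit
  \<open>D = \<parallel>g\<parallel>\<^sup>2 - a\<^sup>2 \<parallel>h / |x|\<parallel>\<^sup>2\<close> (\<open>Hardy_half_line\<close>, \<open>Hardy_with_defect\<close>). In particular \<open>D \<ge> 0\<close>.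

  Taking means over spheres commutes with \<open>\<partial>\<close> and with multiplication by radial functions. Hence the mean \<open>F\<close> of
  \<open>h\<close> is locally absolutely continuous on the half line, and \<open>Q = F' + a F / r\<close> is the mean of \<open>q\<close>. By the
  inequality of Jensen the weighted \<open>L\<^sup>2\<close> norms of \<open>Q\<close> and of \<open>F / r\<close> are controlled by
  \<open>D\<close> and by \<open>N = \<parallel>h / |x|\<parallel>\<^sup>2\<close>. The function \<open>W = r^(n-2) |F|\<^sup>2\<close> has derivative
  \<open>2 r^(n-2) Re (cnj F Q)\<close>; since \<open>W\<close> gets arbitrarily small far out, the inequality of Cauchy and Schwarz bounds \<open>W\<close>
  pointwise by a multiple of \<open>sqrt (N D)\<close> (\<open>Agmon_half_line\<close>). The critical exponent \<open>p\<close> is the one for which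
  \<open>|F|^p r^(n-1) = W^(2/(n-2)) |F|\<^sup>2 r^(n-3)\<close>, so the \<open>L\<^sup>p\<close> bound follows by integrating
  (\<open>Gagliardo_Nirenberg_half_line\<close>). The form with \<open>\<epsilon>\<close> follows from
  \<open>D^(1/n) (\<epsilon> N)^(1-1/n) \<le> D + \<epsilon> N\<close>.

  What remains is to pass from the weak gradient to rays and spheres. Testing the weak gradient with
  \<open>y\<^sub>i \<phi> (y / s)\<close>, where \<open>\<phi>\<close> is a product of one-dimensional bumps, and integrating over the
  dilation parameter \<open>s\<close> yields, for each \<open>l \<ge> 1\<close> and almost every \<open>x\<close>, the identity
  \<open>h (l x) - h x = (integral over s in [1, l] of x \<bullet> g (s x))\<close> (\<open>dilation_increment\<close>). In polar
  coordinates (\<open>nn_integral_polar\<close>) this is a statement about increments along almost every ray, and, after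
  integration over the sphere, about increments of the mean; the lemma of du Bois-Reymond
  (\<open>AE_increments_imp_primitive\<close>) turns both into absolute continuity. Everything up to this point is done for Borel
  functions; the last step transfers it to Lebesgue measurable representatives.
\<close>


abbreviation square_integral :: "'a measure \<Rightarrow> ('a \<Rightarrow> 'b::real_normed_vector) \<Rightarrow> ennreal" where
  "square_integral M u \<equiv> \<integral>\<^sup>+x. ennreal ((norm (u x))\<^sup>2) \<partial>M"

abbreviation half_line_integral :: "(real \<Rightarrow> ennreal) \<Rightarrow> ennreal" (binder "\<integral>\<^sub>0" 10) where
  "half_line_integral f \<equiv> \<integral>\<^sup>+r. indicator {0<..} r * f r \<partial>lborel"


section \<open>Indefinite integrals on the positive half line\<close>

text \<open>
Local absolute continuity on the positive half line, with the derivative as an explicit second argument. Stating it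
through increments makes it insensitive to null sets in \<open>f\<close> and lets the product rule be proved by Fubini alone, without
differentiating almost everywhere.
\<close>

definition primitive_on_pos :: "(real \<Rightarrow> 'b::{banach, second_countable_topology}) \<Rightarrow> (real \<Rightarrow> 'b) \<Rightarrow> bool" where
  "primitive_on_pos u f \<longleftrightarrow> (\<forall>a b. 0 < a \<longrightarrow> a \<le> b \<longrightarrow>
     set_integrable lborel {a..b} f \<and> u b - u a = (LBINT x:{a..b}. f x))"

lemma primitive_on_posD:
  assumes "primitive_on_pos u f" "0 < a" "a \<le> b"
  shows "set_integrable lborel {a..b} f" "u b - u a = (LBINT x:{a..b}. f x)"
  using assms by (auto simp: primitive_on_pos_def)

lemma primitive_on_pos_linear:
  assumes "bounded_linear T" "primitive_on_pos u f"
  shows "primitive_on_pos (\<lambda>x. T (u x)) (\<lambda>x. T (f x))"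
proof -
  interpret T: bounded_linear T by fact
  show ?thesis
    unfolding primitive_on_pos_def
  proof (intro allI impI)
    fix a b :: real assume ab: "0 < a" "a \<le> b"
    have i: "set_integrable lborel {a..b} f" and e: "u b - u a = (LBINT x:{a..b}. f x)"
      using primitive_on_posD[OF assms(2) ab] by auto
    have i': "integrable lborel (\<lambda>x. indicator {a..b} x *\<^sub>R f x)" using i by (simp add: set_integrable_def)
    show "set_integrable lborel {a..b} (\<lambda>x. T (f x)) \<and> T (u b) - T (u a) = (LBINT x:{a..b}. T (f x))"
      using integrable_bounded_linear[OF assms(1) i'] integral_bounded_linear[OF assms(1) i']
      by (simp add: set_integrable_def set_lebesgue_integral_def T.scaleR T.diff[symmetric] e)
  qed
qed

lemma primitive_on_pos_C1:
  fixes u :: "real \<Rightarrow> 'b::euclidean_space"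
  assumes "\<And>x. 0 < x \<Longrightarrow> (u has_vector_derivative f x) (at x)" "continuous_on {0<..} f"
  shows "primitive_on_pos u f"
  unfolding primitive_on_pos_def
proof (intro allI impI)
  fix a b :: real assume ab: "0 < a" "a \<le> b"
  have c: "continuous_on {a..b} f"
    by (rule continuous_on_subset[OF assms(2)]) (use ab in auto)
  have "(LBINT x:{a..b}. f x) = u b - u a"
    unfolding set_lebesgue_integral_def
    by (rule integral_FTC_atLeastAtMost) (use ab c assms(1) in \<open>auto intro: has_vector_derivative_at_within\<close>)
  then show "set_integrable lborel {a..b} f \<and> u b - u a = (LBINT x:{a..b}. f x)"
    using borel_integrable_atLeastAtMost'[OF c] by auto
qed

lemma primitive_on_pos_continuous:
  fixes u :: "real \<Rightarrow> 'b::euclidean_space"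
  assumes "primitive_on_pos u f"
  shows "continuous_on {0<..} u"
proof -
  have "continuous_on {a..b} u" if "0 < a" for a b
  proof (cases "a \<le> b")
    case True
    have "f integrable_on {a..b}"
      using set_borel_integral_eq_integral(1)[OF primitive_on_posD(1)[OF assms that True]] .
    then have "continuous_on {a..b} (\<lambda>x. u a + integral {a..x} f)"
      by (intro continuous_intros indefinite_integral_continuous_1)
    moreover have "u a + integral {a..x} f = u x" if "x \<in> {a..b}" for x
      using primitive_on_posD[OF assms \<open>0 < a\<close>, of x] that
        set_borel_integral_eq_integral(2)[of "{a..x}" f] by (auto simp: algebra_simps)
    ultimately show ?thesis
      by (simp cong: continuous_on_cong_simp)
  qed simp
  then have "continuous_on {x/2<..<x+1} u" if "0 < x" for x
    by (rule continuous_on_subset[of "{x/2..x+1}"]) (use that in auto)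
  then have "isCont u x" if "0 < x" for x
    using that by (auto simp: continuous_on_eq_continuous_at)
  then show ?thesis
    by (simp add: continuous_at_imp_continuous_on)
qed

lemma integrable_pair_mult:
  fixes f :: "'a::euclidean_space \<Rightarrow> 'b::{real_normed_field, banach, second_countable_topology}"
    and g :: "'c::euclidean_space \<Rightarrow> 'b"
  assumes "integrable lborel f" "integrable lborel g"
  shows "integrable (lborel \<Otimes>\<^sub>M lborel) (\<lambda>(x, y). f x * g y)"
proof (rule lborel_pair.Fubini_integrable)
  have [measurable]: "f \<in> borel_measurable borel" "g \<in> borel_measurable borel"
    using assms by auto
  show "(\<lambda>(x, y). f x * g y) \<in> borel_measurable (lborel \<Otimes>\<^sub>M lborel)"
    by measurable
  show "integrable lborel (\<lambda>x. \<integral>y. norm (case (x, y) of (x, y) \<Rightarrow> f x * g y) \<partial>lborel)"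
    using assms by (auto simp: norm_mult)
  show "AE x in lborel. integrable lborel (\<lambda>y. case (x, y) of (x, y) \<Rightarrow> f x * g y)"
    using assms by auto
qed

text \<open>
The square \<open>[a, b] \<times> [a, b]\<close> is cut along the diagonal. The product of the increments of \<open>u\<close> and \<open>v\<close> is the integral
of \<open>f x * g y\<close> over the square; integrating first in \<open>y\<close> below the diagonal and first in \<open>x\<close> above it produces the two terms.
\<close>

lemma set_integral_by_parts:
  fixes u v f g :: "real \<Rightarrow> 'b::{real_normed_field, banach, second_countable_topology}"
  assumes ab: "a \<le> b" and f: "set_integrable lborel {a..b} f" and g: "set_integrable lborel {a..b} g"
    and u: "\<And>x. x \<in> {a..b} \<Longrightarrow> u x - u a = (LBINT t:{a..x}. f t)"
    and v: "\<And>x. x \<in> {a..b} \<Longrightarrow> v x - v a = (LBINT t:{a..x}. g t)"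
    and fv: "set_integrable lborel {a..b} (\<lambda>x. f x * v x)"
    and ug: "set_integrable lborel {a..b} (\<lambda>x. u x * g x)"
  shows "u b * v b - u a * v a = (LBINT x:{a..b}. f x * v x + u x * g x)"
proof -
  define F where "F x = indicator {a..b} x *\<^sub>R f x" for x
  define G where "G x = indicator {a..b} x *\<^sub>R g x" for x
  have F: "integrable lborel F" and G: "integrable lborel G"
    using f g by (simp_all add: F_def[abs_def] G_def[abs_def] set_integrable_def)
  have [measurable]: "F \<in> borel_measurable borel" "G \<in> borel_measurable borel"
    using F G by auto
  have FG: "integrable (lborel \<Otimes>\<^sub>M lborel) (\<lambda>(x, y). F x * G y)"
    using integrable_pair_mult[OF F G] .
  have lower: "integrable (lborel \<Otimes>\<^sub>M lborel) (\<lambda>(x, y). indicator {..x} y *\<^sub>R (F x * G y))"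
    by (rule Bochner_Integration.integrable_bound[OF FG]) (auto simp: indicator_def)
  have upper: "integrable (lborel \<Otimes>\<^sub>M lborel) (\<lambda>(x, y). indicator {..<y} x *\<^sub>R (F x * G y))"
    by (rule Bochner_Integration.integrable_bound[OF FG]) (auto simp: indicator_def)
  have int_F: "(LBINT x. F x) = u b - u a"
    using u[of b] ab by (simp add: F_def set_lebesgue_integral_def)
  have int_G: "(LBINT x. G x) = v b - v a"
    using v[of b] ab by (simp add: G_def set_lebesgue_integral_def)
  have l: "(LBINT y. indicator {..x} y *\<^sub>R (F x * G y)) = F x * (v x - v a)" for x
  proof (cases "x \<in> {a..b}")
    case True
    have "(LBINT y. indicator {..x} y *\<^sub>R (F x * G y)) = (LBINT y. F x * (indicator {a..x} y *\<^sub>R g y))"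
      using True by (intro Bochner_Integration.integral_cong) (auto simp: G_def indicator_def)
    also have "\<dots> = F x * (v x - v a)"
      using v[OF True] set_integrable_subset[OF g, of "{a..x}"] True
      by (subst Bochner_Integration.integral_mult_right) (auto simp: set_lebesgue_integral_def set_integrable_def)
    finally show ?thesis .
  qed (simp add: F_def)
  have r: "(LBINT x. indicator {..<y} x *\<^sub>R (F x * G y)) = (u y - u a) * G y" for y
  proof (cases "y \<in> {a..b}")
    case True
    have "(LBINT x. indicator {..<y} x *\<^sub>R (F x * G y)) = (LBINT x. (indicator {a..y} x *\<^sub>R f x) * G y)"
    proof (rule integral_cong_AE)
      have "AE x in lborel. x \<noteq> y"
        by (rule AE_lborel_singleton)
      then show "AE x in lborel. indicator {..<y} x *\<^sub>R (F x * G y) = (indicator {a..y} x *\<^sub>R f x) * G y"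
        by eventually_elim (use True in \<open>auto simp: F_def indicator_def\<close>)
      have "integrable lborel (\<lambda>x. indicator {a..y} x *\<^sub>R f x)"
        using set_integrable_subset[OF f, of "{a..y}"] True by (auto simp: set_integrable_def)
      then show "(\<lambda>x. indicator {a..y} x *\<^sub>R f x * G y) \<in> borel_measurable lborel"
        by (intro borel_measurable_times) (auto dest: borel_measurable_integrable)
    qed measurable
    also have "\<dots> = (u y - u a) * G y"
      using u[OF True] set_integrable_subset[OF f, of "{a..y}"] True
      by (subst Bochner_Integration.integral_mult_left) (auto simp: set_lebesgue_integral_def set_integrable_def)
    finally show ?thesis .
  qed (simp add: G_def)
  have iv: "integrable lborel (\<lambda>x. F x * v x)" and iu: "integrable lborel (\<lambda>x. u x * G x)"
    using fv ug by (simp_all add: F_def G_def set_integrable_def)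
  have "(u b - u a) * (v b - v a) = (LBINT x. F x * (LBINT y. G y))"
    using F by (simp add: int_F int_G)
  also have "\<dots> = (LBINT x. (LBINT y. F x * G y))"
    using G by simp
  also have "\<dots> = (\<integral>(x, y). F x * G y \<partial>(lborel \<Otimes>\<^sub>M lborel))"
    by (rule lborel_pair.integral_fst[OF FG])
  also have "\<dots> = (\<integral>z. (case z of (x, y) \<Rightarrow> indicator {..x} y *\<^sub>R (F x * G y)) + (case z of (x, y) \<Rightarrow> indicator {..<y} x *\<^sub>R (F x * G y)) \<partial>(lborel \<Otimes>\<^sub>M lborel))"
    by (rule Bochner_Integration.integral_cong) (auto simp: indicator_def)
  also have "\<dots> = (\<integral>(x, y). indicator {..x} y *\<^sub>R (F x * G y) \<partial>(lborel \<Otimes>\<^sub>M lborel)) + (\<integral>(x, y). indicator {..<y} x *\<^sub>R (F x * G y) \<partial>(lborel \<Otimes>\<^sub>M lborel))"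
    by (rule Bochner_Integration.integral_add[OF lower upper])
  also have "\<dots> = (LBINT x. F x * (v x - v a)) + (LBINT y. (u y - u a) * G y)"
    unfolding lborel_pair.integral_fst[OF lower, symmetric] lborel_pair.integral_snd[OF upper, symmetric]
    by (simp add: l r)
  also have "\<dots> = (LBINT x. F x * v x) - (u b - u a) * v a + ((LBINT y. u y * G y) - u a * (v b - v a))"
    using iv iu F G by (simp add: right_diff_distrib left_diff_distrib int_F[symmetric] int_G[symmetric])
  finally have "u b * v b - u a * v a = (LBINT x. F x * v x) + (LBINT y. u y * G y)"
    by (simp add: algebra_simps)
  also have "\<dots> = (LBINT x:{a..b}. f x * v x + u x * g x)"
    using iv iu by (simp add: set_lebesgue_integral_def F_def G_def scaleR_add_right)
  finally show ?thesis .
qed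

lemma set_integrable_mult_continuous:
  fixes f v :: "real \<Rightarrow> 'b::{real_normed_field, banach, second_countable_topology}"
  assumes f: "set_integrable lborel {a..b} f" and v: "continuous_on {a..b} v"
  shows "set_integrable lborel {a..b} (\<lambda>x. f x * v x)"
proof -
  have "bounded (v ` {a..b})"
    by (intro compact_imp_bounded compact_continuous_image v) auto
  then obtain K where "0 < K" and K: "\<And>x. x \<in> {a..b} \<Longrightarrow> norm (v x) \<le> K"
    unfolding bounded_pos by (metis imageI)
  have vm: "(\<lambda>x. indicator {a..b} x *\<^sub>R v x) \<in> borel_measurable borel"
    by (rule borel_measurable_continuous_on_indicator) (use v in auto)
  have fm: "(\<lambda>x. indicator {a..b} x *\<^sub>R f x) \<in> borel_measurable borel"
    using f by (auto simp: set_integrable_def)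
  have "integrable lborel (\<lambda>x. (indicator {a..b} x *\<^sub>R f x) * (indicator {a..b} x *\<^sub>R v x))"
  proof (rule Bochner_Integration.integrable_bound)
    show "integrable lborel (\<lambda>x. K *\<^sub>R (indicator {a..b} x *\<^sub>R f x))"
      using f by (intro Bochner_Integration.integrable_scaleR_right) (auto simp: set_integrable_def)
    show "AE x in lborel. norm ((indicator {a..b} x *\<^sub>R f x) * (indicator {a..b} x *\<^sub>R v x)) \<le> norm (K *\<^sub>R (indicator {a..b} x *\<^sub>R f x))"
    proof (rule AE_I2)
      fix x
      show "norm ((indicator {a..b} x *\<^sub>R f x) * (indicator {a..b} x *\<^sub>R v x)) \<le> norm (K *\<^sub>R (indicator {a..b} x *\<^sub>R f x))"
        using K[of x] mult_left_mono[of "norm (v x)" K "norm (f x)"]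
        using \<open>0 < K\<close> by (auto simp: indicator_def norm_mult mult.commute)
    qed
    show "(\<lambda>x. (indicator {a..b} x *\<^sub>R f x) * (indicator {a..b} x *\<^sub>R v x)) \<in> borel_measurable lborel"
      by (rule borel_measurable_times) (use vm fm in simp_all)
  qed
  then show ?thesis
    unfolding set_integrable_def by (rule Bochner_Integration.integrable_cong[THEN iffD1, rotated -1]) (auto simp: indicator_def)
qed

theorem primitive_on_pos_mult:
  fixes u v f g :: "real \<Rightarrow> 'b::{real_normed_field, euclidean_space}"
  assumes u: "primitive_on_pos u f" and v: "primitive_on_pos v g"
  shows "primitive_on_pos (\<lambda>x. u x * v x) (\<lambda>x. f x * v x + u x * g x)"
  unfolding primitive_on_pos_def
proof (intro allI impI)
  fix a b :: real assume ab: "0 < a" "a \<le> b"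
  have cu: "continuous_on {a..b} u" and cv: "continuous_on {a..b} v"
    using primitive_on_pos_continuous[OF u] primitive_on_pos_continuous[OF v] ab
    by (auto elim!: continuous_on_subset)
  have fv: "set_integrable lborel {a..b} (\<lambda>x. f x * v x)"
    by (rule set_integrable_mult_continuous[OF primitive_on_posD(1)[OF u ab] cv])
  have ug: "set_integrable lborel {a..b} (\<lambda>x. u x * g x)"
    using set_integrable_mult_continuous[OF primitive_on_posD(1)[OF v ab] cu] by (simp add: mult.commute)
  have "u b * v b - u a * v a = (LBINT x:{a..b}. f x * v x + u x * g x)"
    by (rule set_integral_by_parts)
      (use ab fv ug primitive_on_posD[OF u] primitive_on_posD[OF v] in auto)
  then show "set_integrable lborel {a..b} (\<lambda>x. f x * v x + u x * g x) \<and>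
      u b * v b - u a * v a = (LBINT x:{a..b}. f x * v x + u x * g x)"
    using set_integral_add(1)[OF fv ug] by auto
qed

text \<open>
A power weight is bounded below on \<open>[a, b]\<close> if \<open>a > 0\<close>, and \<open>x \<le> 1 + x\<^sup>2\<close>.
\<close>

lemma set_integrable_of_weighted_square:
  fixes f :: "real \<Rightarrow> 'b::{banach, second_countable_topology}"
  assumes [measurable]: "f \<in> borel_measurable borel" and a: "0 < a"
    and fin: "(\<integral>\<^sub>0r. ennreal (r ^ m * (norm (f r))\<^sup>2)) < \<infinity>"
  shows "set_integrable lborel {a..b} f"
  unfolding set_integrable_def
proof (rule integrableI_bounded)
  show "(\<lambda>x. indicat_real {a..b} x *\<^sub>R f x) \<in> borel_measurable lborel" by measurable
  have "(\<integral>\<^sup>+x. ennreal (norm (indicat_real {a..b} x *\<^sub>R f x)) \<partial>lborel)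
    \<le> (\<integral>\<^sup>+x. indicator {a..b} x + ennreal (1 / a ^ m) * (indicator {0<..} x * ennreal (x ^ m * (norm (f x))\<^sup>2)) \<partial>lborel)"
  proof (rule nn_integral_mono)
    fix x
    show "ennreal (norm (indicat_real {a..b} x *\<^sub>R f x))
      \<le> indicator {a..b} x + ennreal (1 / a ^ m) * (indicator {0<..} x * ennreal (x ^ m * (norm (f x))\<^sup>2))"
    proof (cases "x \<in> {a..b}")
      case True
      have "norm (f x) \<le> 1 + (norm (f x))\<^sup>2"
        using sum_squares_bound[of "norm (f x)" 1] by (simp add: power2_eq_square)
          (smt (verit) norm_ge_zero mult_nonneg_nonneg)
      also have "(norm (f x))\<^sup>2 \<le> 1 / a ^ m * (x ^ m * (norm (f x))\<^sup>2)"
      proof -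
        have "a ^ m \<le> x ^ m" using True a by (intro power_mono) auto
        then have "1 \<le> x ^ m / a ^ m" using a by simp
        from mult_right_mono[OF this, of "(norm (f x))\<^sup>2"] show ?thesis by simp
      qed
      finally have "ennreal (norm (f x)) \<le> ennreal (1 + 1 / a ^ m * (x ^ m * (norm (f x))\<^sup>2))"
        by (intro ennreal_leI) simp
      also have "\<dots> = 1 + ennreal (1 / a ^ m) * ennreal (x ^ m * (norm (f x))\<^sup>2)"
        using True a by (subst ennreal_plus) (auto simp: ennreal_mult[symmetric])
      finally show ?thesis using True a by simp
    qed simp
  qed
  also have "\<dots> = emeasure lborel {a..b} + ennreal (1 / a ^ m) * (\<integral>\<^sub>0r. ennreal (r ^ m * (norm (f r))\<^sup>2))"
    by (subst nn_integral_add) (auto simp: nn_integral_cmult)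
  also have "\<dots> < \<infinity>"
    using fin by (auto simp: ennreal_mult_less_top emeasure_lborel_Icc_eq)
  finally show "(\<integral>\<^sup>+x. ennreal (norm (indicat_real {a..b} x *\<^sub>R f x)) \<partial>lborel) < \<infinity>" .
qed

lemma primitive_on_pos_exists:
  fixes f :: "real \<Rightarrow> 'b::{banach, second_countable_topology}"
  assumes f: "\<And>a b. 0 < a \<Longrightarrow> set_integrable lborel {a..b} f"
  shows "\<exists>u. primitive_on_pos u f"
proof -
  define u where "u r = (if 1 \<le> r then (LBINT x:{1..r}. f x) else - (LBINT x:{r..1}. f x))" for r
  have split: "(LBINT x:{a..c}. f x) = (LBINT x:{a..b}. f x) + (LBINT x:{b..c}. f x)"
    if "0 < a" "a \<le> b" "b \<le> c" for a b c
  proof -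
    have "{a..c} = {a..b} \<union> {b..c}" using that by auto
    moreover have "AE x in lborel. \<not> (x \<in> {a..b} \<and> x \<in> {b..c})"
      using AE_lborel_singleton[of b] by eventually_elim auto
    ultimately show ?thesis
      using that by (simp only:) (rule set_integral_Un_AE, auto intro!: f)
  qed
  have "primitive_on_pos u f"
    unfolding primitive_on_pos_def
  proof (intro allI impI conjI)
    fix a b :: real assume ab: "0 < a" "a \<le> b"
    show "set_integrable lborel {a..b} f" by (rule f[OF ab(1)])
    \<comment> \<open>The base point of \<open>u\<close> is 1, so an interval may lie on either side of it or contain it.\<close>
    consider "1 \<le> a" | "a < 1" "1 \<le> b" | "b < 1" by linarith
    then show "u b - u a = (LBINT x:{a..b}. f x)"
    proof cases
      case 1
      then show ?thesis using split[of 1 a b] ab by (simp add: u_def)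
    next
      case 2
      then show ?thesis using split[of a 1 b] ab by (simp add: u_def)
    next
      case 3
      then show ?thesis using split[of a b 1] ab by (simp add: u_def)
    qed
  qed
  then show ?thesis by blast
qed

lemma AE_lborel_gt_ex:
  assumes "AE x in lborel. P (x::real)" "a < b"
  shows "\<exists>x. a < x \<and> x < b \<and> P x"
proof (rule ccontr)
  assume "\<nexists>x. a < x \<and> x < b \<and> P x"
  then have "AE x in lborel. x \<notin> {a<..<b}"
    using assms(1) by (auto elim!: eventually_mono)
  then have "emeasure lborel {a<..<b} = 0"
    by (subst (asm) AE_iff_measurable[of "{a<..<b}"]) (auto simp: set_eq_iff)
  then show False using assms(2) by simp
qed

text \<open>
The lemma of du Bois-Reymond. If \<open>K\<close> is a primitive of \<open>k\<close>, then \<open>f - K\<close> takes the same value at almost every pair of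
points. A sequence of good left end points tending to 0 makes the constant the same on the whole half line.
The indicator in the witness provides a globally Borel measurable primitive.
\<close>

theorem AE_increments_imp_primitive:
  fixes f :: "real \<Rightarrow> 'b::euclidean_space"
  assumes int: "\<And>a b. 0 < a \<Longrightarrow> set_integrable lborel {a..b} k"
    and incr: "AE r in lborel. 0 < r \<longrightarrow> (AE s in lborel. r < s \<longrightarrow> f s - f r = (LBINT t:{r..s}. k t))"
  shows "\<exists>u. u \<in> borel_measurable borel \<and> primitive_on_pos u k \<and> (AE r in lborel. 0 < r \<longrightarrow> f r = u r)"
proof -
  obtain K where K: "primitive_on_pos K k"
    using primitive_on_pos_exists[of k] int by blast
  define good where "good r \<longleftrightarrow> (AE s in lborel. r < s \<longrightarrow> f s - K s = f r - K r)" for r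
  have good: "AE r in lborel. 0 < r \<longrightarrow> good r"
    using incr
  proof eventually_elim
    case (elim r)
    show ?case
    proof
      assume r: "0 < r"
      with elim have "AE s in lborel. r < s \<longrightarrow> f s - f r = (LBINT t:{r..s}. k t)" by simp
      then show "good r"
        unfolding good_def
      proof eventually_elim
        case (elim s)
        show ?case
        proof
          assume "r < s"
          with elim primitive_on_posD(2)[OF K r, of s] show "f s - K s = f r - K r"
            by (simp add: algebra_simps)
        qed
      qed
    qed
  qed
  \<comment> \<open>Good left end points accumulate at 0, so every positive number lies to the right of one of them.\<close>
  have "\<exists>r. 0 < r \<and> r < 1 / Suc i \<and> good r" for i
    using AE_lborel_gt_ex[OF good, of 0 "1 / Suc i"] by auto
  then obtain R where R: "\<And>i. 0 < R i" "\<And>i. R i < 1 / Suc i" "\<And>i. good (R i)"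
    by metis
  define c where "c = f (R 0) - K (R 0)"
  have c: "f (R i) - K (R i) = c" for i
  proof -
    have "AE s in lborel. (R i < s \<longrightarrow> f s - K s = f (R i) - K (R i)) \<and> (R 0 < s \<longrightarrow> f s - K s = f (R 0) - K (R 0))"
      using R(3)[of i] R(3)[of 0] unfolding good_def by eventually_elim auto
    from AE_lborel_gt_ex[OF this, of "max (R i) (R 0)" "max (R i) (R 0) + 1"]
    obtain s where "R i < s" "R 0 < s" "f s - K s = f (R i) - K (R i)" "f s - K s = f (R 0) - K (R 0)"
      by auto
    then show ?thesis by (simp add: c_def)
  qed
  have "AE s in lborel. \<forall>i. R i < s \<longrightarrow> f s - K s = c"
    unfolding AE_all_countable using R(3) c by (simp add: good_def)
  then have ae: "AE s in lborel. 0 < s \<longrightarrow> f s = indicator {0<..} s *\<^sub>R (K s + c)"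
  proof eventually_elim
    case (elim s)
    show ?case
    proof
      assume "0 < s"
      then obtain i where "1 / Suc i < s" using nat_approx_posE by blast
      then have "R i < s" using R(2)[of i] by simp
      with elim \<open>0 < s\<close> show "f s = indicator {0<..} s *\<^sub>R (K s + c)" by (auto simp: algebra_simps)
    qed
  qed
  have prim: "primitive_on_pos (\<lambda>s. indicator {0<..} s *\<^sub>R (K s + c)) k"
    using K by (simp add: primitive_on_pos_def)
  have "(\<lambda>s. indicator {0<..} s *\<^sub>R (K s + c)) \<in> borel_measurable borel"
    using primitive_on_pos_continuous[OF K]
    by (intro borel_measurable_continuous_on_indicator) (auto intro!: continuous_intros)
  with prim ae show ?thesis by blast
qed

text \<open>
This discards boundary terms at infinity: a bound \<open>w \<ge> e\<close> near infinity would make the integral exceed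
\<open>e (ln X - ln M)\<close> for every \<open>X\<close>.
\<close>

lemma ex_small_of_nn_integral_inverse_weight:
  fixes w :: "real \<Rightarrow> real"
  assumes fin: "(\<integral>\<^sup>+r. indicator {1..} r * ennreal (w r / r) \<partial>lborel) < \<infinity>" and e: "0 < e"
  shows "\<exists>R>N. w R < e"
proof (rule ccontr)
  assume "\<not> (\<exists>R>N. w R < e)"
  then have w: "e \<le> w R" if "N < R" for R
    using that by (meson not_less)
  \<comment> \<open>From \<open>M\<close> on, both the bound on \<open>w\<close> and the indicator in the hypothesis are available.\<close>
  define M where "M = max N 1 + 1"
  have M: "1 \<le> M" "N < M" by (auto simp: M_def)
  have "ennreal (e * (ln X - ln M)) \<le> (\<integral>\<^sup>+r. indicator {1..} r * ennreal (w r / r) \<partial>lborel)" if "M \<le> X" for X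
  proof -
    have "ennreal (e * (ln X - ln M)) = ennreal (e * ln X - e * ln M)" by (simp add: algebra_simps)
    also have "\<dots> = (\<integral>\<^sup>+r. ennreal (e / r) * indicator {M..X} r \<partial>lborel)"
    proof (rule nn_integral_FTC_Icc[symmetric, where F="\<lambda>r. e * ln r"])
      show "((\<lambda>r. e * ln r) has_real_derivative e / x) (at x)" if "x \<in> {M..X}" for x
        using that M by (auto intro!: derivative_eq_intros)
    qed (use M e that in auto)
    also have "\<dots> \<le> (\<integral>\<^sup>+r. indicator {1..} r * ennreal (w r / r) \<partial>lborel)"
    proof (rule nn_integral_mono)
      fix r
      show "ennreal (e / r) * indicator {M..X} r \<le> indicator {1..} r * ennreal (w r / r)"
        using M w[of r] by (auto simp: indicator_def intro!: ennreal_leI divide_right_mono)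
    qed
    finally show ?thesis .
  qed
  note bound = this
  obtain T where T: "(\<integral>\<^sup>+r. indicator {1..} r * ennreal (w r / r) \<partial>lborel) = ennreal T" "0 \<le> T"
    using fin by (cases "\<integral>\<^sup>+r. indicator {1..} r * ennreal (w r / r) \<partial>lborel" rule: ennreal_cases) auto
  define X where "X = M * exp ((T + 1) / e)"
  have "M * 1 \<le> X"
    unfolding X_def using M e T by (intro mult_left_mono) auto
  then have "ennreal (e * (ln X - ln M)) \<le> ennreal T"
    using bound[of X] T by simp
  then have "e * (ln X - ln M) \<le> T" using T by simp
  moreover have "ln X - ln M = (T + 1) / e" using M by (simp add: X_def ln_mult)
  ultimately show False using e by simp
qed


section \<open>One-dimensional inequalities of Hardy and Gagliardo-Nirenberg type\<close>

lemma primitive_on_pos_power: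
  "primitive_on_pos (\<lambda>r. r ^ m :: real) (\<lambda>r. real m * r ^ (m - 1))"
proof (rule primitive_on_pos_C1)
  show "((\<lambda>r. r ^ m) has_vector_derivative real m * x ^ (m - 1)) (at x)" for x :: real
    unfolding has_real_derivative_iff_has_vector_derivative[symmetric]
    using DERIV_pow[of m x UNIV] by simp
qed (intro continuous_intros)

lemma primitive_on_pos_weighted_square:
  fixes H k :: "real \<Rightarrow> complex"
  assumes "primitive_on_pos H k"
  shows "primitive_on_pos (\<lambda>r. r ^ m * (norm (H r))\<^sup>2)
    (\<lambda>r. real m * r ^ (m - 1) * (norm (H r))\<^sup>2 + r ^ m * (2 * Re (cnj (H r) * k r)))"
proof -
  have "primitive_on_pos (\<lambda>r. Re (H r * cnj (H r))) (\<lambda>r. Re (k r * cnj (H r) + H r * cnj (k r)))"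
    by (intro primitive_on_pos_linear[OF bounded_linear_Re] primitive_on_pos_mult
        primitive_on_pos_linear[OF bounded_linear_cnj] assms)
  then have "primitive_on_pos (\<lambda>r. (norm (H r))\<^sup>2) (\<lambda>r. 2 * Re (cnj (H r) * k r))"
    by (simp add: complex_norm_square[symmetric] algebra_simps del: of_real_power)
  from primitive_on_pos_mult[OF primitive_on_pos_power[of m] this] show ?thesis .
qed

text \<open>
Here \<open>m = n - 3\<close>. With \<open>W = r^(m+1) |H|\<^sup>2\<close>, expanding the square shows that the integrand on the left equals
\<open>r^(m+2) |k|\<^sup>2 + a W'\<close>. Over \<open>[e, R]\<close> the derivative contributes \<open>a (W R - W e)\<close>, where \<open>W e \<ge> 0\<close> has
the good sign and \<open>W R\<close> can be made small by choosing \<open>R\<close>, because \<open>H\<close> has a finite weighted \<open>L\<^sup>2\<close> norm.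
\<close>

theorem Hardy_half_line:
  fixes H k :: "real \<Rightarrow> complex" and m :: nat
  defines "a \<equiv> (real m + 1) / 2"
  assumes prim: "primitive_on_pos H k"
    and [measurable]: "H \<in> borel_measurable borel" "k \<in> borel_measurable borel"
    and H2: "(\<integral>\<^sub>0r. ennreal (r ^ (m + 2) * (norm (H r))\<^sup>2)) < \<infinity>"
  shows "(\<integral>\<^sub>0r. ennreal (r ^ (m + 2) * (norm (k r + of_real (a / r) * H r))\<^sup>2 + a\<^sup>2 * (r ^ m * (norm (H r))\<^sup>2)))
    \<le> (\<integral>\<^sub>0r. ennreal (r ^ (m + 2) * (norm (k r))\<^sup>2))"
    (is "?I \<le> ?A")
proof (cases "?A < \<infinity>")
  case True
  define W where "W r = r ^ (m + 1) * (norm (H r))\<^sup>2" for r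
  define W' where "W' r = real (m + 1) * r ^ m * (norm (H r))\<^sup>2 + r ^ (m + 1) * (2 * Re (cnj (H r) * k r))" for r
  define L where "L r = r ^ (m + 2) * (norm (k r + of_real (a / r) * H r))\<^sup>2 + a\<^sup>2 * (r ^ m * (norm (H r))\<^sup>2)" for r
  define D where "D r = r ^ (m + 2) * (norm (k r))\<^sup>2" for r
  have [measurable]: "L \<in> borel_measurable borel" "D \<in> borel_measurable borel"
    unfolding L_def[abs_def] D_def[abs_def] by measurable
  have W: "primitive_on_pos W W'"
    using primitive_on_pos_weighted_square[OF prim, of "m + 1"] by (simp add: W_def[abs_def] W'_def[abs_def])
  have a: "0 < a" "real m = 2 * a - 1" by (simp_all add: a_def field_simps)
  have LD: "L r = D r + a * W' r" if "0 < r" for r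
  proof -
    have N: "(norm (k r + of_real (a / r) * H r))\<^sup>2 = (norm (k r))\<^sup>2 + (a / r)\<^sup>2 * (norm (H r))\<^sup>2 + 2 * (a / r) * Re (cnj (H r) * k r)"
      by (simp only: cmod_power2) (simp add: power2_eq_square algebra_simps)
    have alg: "x * r\<^sup>2 * (K + (a / r)\<^sup>2 * h + 2 * (a / r) * c) + a\<^sup>2 * (x * h) = x * r\<^sup>2 * K + a * (2 * a * x * h + x * r * (2 * c))"
      for x K h c :: real
      using that by (simp add: field_simps power2_eq_square)
    have "L r = r ^ m * r\<^sup>2 * ((norm (k r))\<^sup>2 + (a / r)\<^sup>2 * (norm (H r))\<^sup>2 + 2 * (a / r) * Re (cnj (H r) * k r)) + a\<^sup>2 * (r ^ m * (norm (H r))\<^sup>2)"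
      by (simp only: L_def N power_add)
    also have "\<dots> = r ^ m * r\<^sup>2 * (norm (k r))\<^sup>2 + a * (2 * a * r ^ m * (norm (H r))\<^sup>2 + r ^ m * r * (2 * Re (cnj (H r) * k r)))"
      by (rule alg)
    also have "\<dots> = D r + a * W' r"
      by (simp add: D_def W'_def a(2) power2_eq_square mult_ac)
    finally show ?thesis .
  qed
  have L0: "0 \<le> L r" if "0 < r" for r using that by (simp add: L_def)
  have bound: "(\<integral>\<^sup>+r. indicator {e..R} r * ennreal (L r) \<partial>lborel) \<le> ?A + ennreal (a * W R)"
    if eR: "0 < e" "e \<le> R" for e R
  proof -
    have "(\<integral>\<^sup>+r. indicator {e..R} r * ennreal (D r) \<partial>lborel) \<le> ?A"
      using eR by (intro nn_integral_mono) (auto simp: D_def indicator_def)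
    moreover have "(\<integral>\<^sup>+r. ennreal (indicator {e..R} r *\<^sub>R D r) \<partial>lborel) = (\<integral>\<^sup>+r. indicator {e..R} r * ennreal (D r) \<partial>lborel)"
      by (intro nn_integral_cong) (auto simp: indicator_def)
    ultimately have D_fin: "(\<integral>\<^sup>+r. ennreal (indicator {e..R} r *\<^sub>R D r) \<partial>lborel) \<le> ?A"
      by simp
    have D0: "0 \<le> indicator {e..R} r *\<^sub>R D r" for r
      using eR by (auto simp: D_def indicator_def)
    have D_int: "integrable lborel (\<lambda>r. indicator {e..R} r *\<^sub>R D r)"
      using D_fin True D0 by (intro integrableI_nonneg) auto
    have W_int: "integrable lborel (\<lambda>r. indicator {e..R} r *\<^sub>R W' r)"
      and W_eq: "W R - W e = (LBINT r. indicator {e..R} r *\<^sub>R W' r)"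
      using primitive_on_posD[OF W eR] by (auto simp: set_integrable_def set_lebesgue_integral_def)
    have eq: "indicator {e..R} r *\<^sub>R L r = indicator {e..R} r *\<^sub>R D r + a * (indicator {e..R} r *\<^sub>R W' r)" for r
      using eR LD[of r] by (auto simp: indicator_def)
    have L_int: "integrable lborel (\<lambda>r. indicator {e..R} r *\<^sub>R L r)"
      unfolding eq using D_int W_int by (intro Bochner_Integration.integrable_add integrable_mult_right) auto
    have "(LBINT r. indicator {e..R} r *\<^sub>R L r) = (LBINT r. indicator {e..R} r *\<^sub>R D r) + a * (W R - W e)"
      unfolding eq W_eq using D_int W_int by (subst Bochner_Integration.integral_add) auto
    also have "\<dots> \<le> (LBINT r. indicator {e..R} r *\<^sub>R D r) + a * W R"
      using a eR by (auto simp: W_def algebra_simps)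
    finally have le: "(LBINT r. indicator {e..R} r *\<^sub>R L r) \<le> (LBINT r. indicator {e..R} r *\<^sub>R D r) + a * W R" .
    have "(\<integral>\<^sup>+r. indicator {e..R} r * ennreal (L r) \<partial>lborel) = (\<integral>\<^sup>+r. ennreal (indicator {e..R} r *\<^sub>R L r) \<partial>lborel)"
      by (intro nn_integral_cong) (auto simp: indicator_def)
    also have "\<dots> = ennreal (LBINT r. indicator {e..R} r *\<^sub>R L r)"
      using L_int L0 eR by (intro nn_integral_eq_integral) (auto simp: indicator_def)
    also have "\<dots> \<le> ennreal ((LBINT r. indicator {e..R} r *\<^sub>R D r) + a * W R)"
      using le by (rule ennreal_leI)
    also have "\<dots> = ennreal (LBINT r. indicator {e..R} r *\<^sub>R D r) + ennreal (a * W R)"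
      using D0 a eR by (intro ennreal_plus Bochner_Integration.integral_nonneg) (auto simp: W_def)
    also have "ennreal (LBINT r. indicator {e..R} r *\<^sub>R D r) \<le> ?A"
      using D_fin D_int D0 by (subst nn_integral_eq_integral[symmetric]) auto
    finally show ?thesis by simp
  qed
  have "(\<integral>\<^sup>+r. indicator {1..} r * ennreal (W r / r) \<partial>lborel) \<le> (\<integral>\<^sub>0r. ennreal (r ^ (m + 2) * (norm (H r))\<^sup>2))"
  proof (rule nn_integral_mono)
    fix r :: real
    have "W r / r \<le> r ^ (m + 2) * (norm (H r))\<^sup>2" if "1 \<le> r"
    proof -
      have "W r / r = r ^ m * (norm (H r))\<^sup>2" using that by (simp add: W_def)
      also have "\<dots> \<le> r ^ (m + 2) * (norm (H r))\<^sup>2"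
        using that by (intro mult_right_mono power_increasing) auto
      finally show ?thesis .
    qed
    then show "indicator {1..} r * ennreal (W r / r) \<le> indicator {0<..} r * ennreal (r ^ (m + 2) * (norm (H r))\<^sup>2)"
      by (auto simp: indicator_def intro!: ennreal_leI)
  qed
  with H2 have W_fin: "(\<integral>\<^sup>+r. indicator {1..} r * ennreal (W r / r) \<partial>lborel) < \<infinity>"
    by (rule le_less_trans[rotated])
  have eps: "?I \<le> ?A + ennreal d" if d: "0 < d" for d
  proof -
    have "\<exists>R>real (Suc i). W R < d / a" for i
      using ex_small_of_nn_integral_inverse_weight[OF W_fin, of "d / a"] d a by simp
    then obtain R where R: "\<And>i. real (Suc i) < R i" "\<And>i. W (R i) < d / a"
      by metis
    \<comment> \<open>Fatou: the intervals from \<open>1 / Suc i\<close> to \<open>R i\<close> exhaust the half line.\<close>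
    have ae: "indicator {0<..} r * ennreal (L r) \<le> liminf (\<lambda>i. indicator {1 / Suc i..R i} r * ennreal (L r))" for r
    proof (cases "0 < r")
      case True
      obtain N1 where N1: "1 / Suc N1 < r" using True nat_approx_posE by blast
      obtain N2 where N2: "r < real N2" using reals_Archimedean2 by blast
      have "eventually (\<lambda>i. indicator {1 / Suc i..R i} r * ennreal (L r) = ennreal (L r)) sequentially"
      proof (rule eventually_sequentiallyI)
        fix i assume i: "max N1 N2 \<le> i"
        have "1 / real (Suc i) \<le> 1 / real (Suc N1)" using i by (intro divide_left_mono) auto
        moreover have "real N2 \<le> real (Suc i)" using i by simp
        ultimately have "r \<in> {1 / Suc i..R i}" using N1 N2 R(1)[of i] by auto
        then show "indicator {1 / Suc i..R i} r * ennreal (L r) = ennreal (L r)" by simp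
      qed
      then have "((\<lambda>i. indicator {1 / Suc i..R i} r * ennreal (L r)) \<longlongrightarrow> ennreal (L r)) sequentially"
        by (rule tendsto_eventually)
      from lim_imp_Liminf[OF _ this] show ?thesis using True by simp
    qed simp
    have "?I = (\<integral>\<^sub>0r. ennreal (L r))"
      by (simp add: L_def)
    also have "\<dots> \<le> (\<integral>\<^sup>+r. liminf (\<lambda>i. indicator {1 / Suc i..R i} r * ennreal (L r)) \<partial>lborel)"
      by (intro nn_integral_mono ae)
    also have "\<dots> \<le> liminf (\<lambda>i. \<integral>\<^sup>+r. indicator {1 / Suc i..R i} r * ennreal (L r) \<partial>lborel)"
      by (rule nn_integral_liminf) measurable
    also have "\<dots> \<le> limsup (\<lambda>i. \<integral>\<^sup>+r. indicator {1 / Suc i..R i} r * ennreal (L r) \<partial>lborel)"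
      by (rule Liminf_le_Limsup) simp
    also have "\<dots> \<le> ?A + ennreal d"
    proof (rule Limsup_bounded, rule always_eventually, rule allI)
      fix i
      have "1 / real (Suc i) \<le> 1" by simp
      moreover have "1 \<le> real (Suc i)" by simp
      ultimately have "1 / Suc i \<le> R i" using R(1)[of i] by linarith
      then have "(\<integral>\<^sup>+r. indicator {1 / Suc i..R i} r * ennreal (L r) \<partial>lborel) \<le> ?A + ennreal (a * W (R i))"
        by (intro bound) auto
      also have "\<dots> \<le> ?A + ennreal d"
        using R(2)[of i] a by (intro add_left_mono ennreal_leI) (simp add: field_simps)
      finally show "(\<integral>\<^sup>+r. indicator {1 / Suc i..R i} r * ennreal (L r) \<partial>lborel) \<le> ?A + ennreal d" .
    qed
    finally show ?thesis .
  qed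
  show ?thesis by (rule ennreal_le_epsilon) (rule eps)
next
  case False
  then have "?A = \<infinity>" by (simp only: infinity_ennreal_def less_top[symmetric] not_not)
  then show ?thesis by (simp only: infinity_ennreal_def top_greatest)
qed

text \<open>
The function \<open>W = r^(m+1) |F|\<^sup>2\<close> satisfies \<open>|W'| \<le> 2 r^(m+1) |F| |Q|\<close> with \<open>Q = F' + a F / r\<close>, since the weight is
exactly the one that absorbs the derivative of \<open>r^(m+1)\<close>. Starting from a far point where \<open>W\<close> is small, the inequality of
Cauchy and Schwarz bounds \<open>W r\<close> by the two integrals on the right.
\<close>

theorem Agmon_half_line:
  fixes F F' :: "real \<Rightarrow> complex" and m :: nat
  defines "a \<equiv> (real m + 1) / 2"
  assumes prim: "primitive_on_pos F F'"
    and [measurable]: "F \<in> borel_measurable borel" "F' \<in> borel_measurable borel"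
    and F2: "(\<integral>\<^sub>0r. ennreal (r ^ m * (norm (F r))\<^sup>2)) < \<infinity>" (is "?A < \<infinity>")
    and r: "0 < r"
  shows "(ennreal (r ^ (m + 1) * (norm (F r))\<^sup>2))\<^sup>2 \<le> 4 * ?A *
    (\<integral>\<^sub>0r. ennreal (r ^ (m + 2) * (norm (F' r + of_real (a / r) * F r))\<^sup>2))"
    (is "_ \<le> 4 * ?A * ?B")
proof -
  define W where "W r = r ^ (m + 1) * (norm (F r))\<^sup>2" for r
  define Q where "Q r = F' r + of_real (a / r) * F r" for r
  define W' where "W' r = real (m + 1) * r ^ m * (norm (F r))\<^sup>2 + r ^ (m + 1) * (2 * Re (cnj (F r) * F' r))" for r
  define J where "J = (\<integral>\<^sup>+r. (indicator {0<..} r * ennreal (sqrt (r ^ m) * norm (F r))) * (indicator {0<..} r * ennreal (sqrt (r ^ m) * (r * norm (Q r)))) \<partial>lborel)"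
  have [measurable]: "Q \<in> borel_measurable borel" unfolding Q_def[abs_def] by measurable
  have a: "real m = 2 * a - 1" by (simp add: a_def field_simps)
  have W: "primitive_on_pos W W'"
    using primitive_on_pos_weighted_square[OF prim, of "m + 1"] by (simp add: W_def[abs_def] W'_def[abs_def])
  have W'_le: "\<bar>W' r\<bar> \<le> 2 * ((sqrt (r ^ m) * norm (F r)) * (sqrt (r ^ m) * (r * norm (Q r))))" if "0 < r" for r
  proof -
    have "W' r = 2 * (r ^ (m + 1) * Re (cnj (F r) * Q r))"
    proof -
      have Q: "Re (cnj (F r) * Q r) = Re (cnj (F r) * F' r) + a / r * (norm (F r))\<^sup>2"
        by (simp only: Q_def cmod_power2) (simp add: power2_eq_square algebra_simps add_divide_distrib)
      have alg: "2 * a * x * h + x * r * (2 * c) = 2 * (x * r * (c + a / r * h))" for x h c :: real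
        using that by (simp add: field_simps)
      have "W' r = 2 * a * r ^ m * (norm (F r))\<^sup>2 + r ^ m * r * (2 * Re (cnj (F r) * F' r))"
        by (simp add: W'_def a mult_ac)
      also have "\<dots> = 2 * (r ^ m * r * (Re (cnj (F r) * F' r) + a / r * (norm (F r))\<^sup>2))"
        by (rule alg)
      finally show ?thesis
        by (simp only: Q power_add power_one_right)
    qed
    also have "\<bar>\<dots>\<bar> \<le> 2 * (r ^ (m + 1) * (norm (F r) * norm (Q r)))"
      using that abs_Re_le_cmod[of "cnj (F r) * Q r"] by (simp add: abs_mult norm_mult)
    also have "r ^ (m + 1) * (norm (F r) * norm (Q r)) = (sqrt (r ^ m) * norm (F r)) * (sqrt (r ^ m) * (r * norm (Q r)))"
    proof -
      have "r ^ m = sqrt (r ^ m) * sqrt (r ^ m)" using that by simp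
      then show ?thesis by (simp add: mult_ac)
    qed
    finally show ?thesis .
  qed
  have "J\<^sup>2 \<le> (\<integral>\<^sup>+r. (indicator {0<..} r * ennreal (sqrt (r ^ m) * norm (F r)))\<^sup>2 \<partial>lborel) * (\<integral>\<^sup>+r. (indicator {0<..} r * ennreal (sqrt (r ^ m) * (r * norm (Q r))))\<^sup>2 \<partial>lborel)"
    unfolding J_def by (rule Cauchy_Schwarz_nn_integral) measurable
  also have "(\<integral>\<^sup>+r. (indicator {0<..} r * ennreal (sqrt (r ^ m) * norm (F r)))\<^sup>2 \<partial>lborel) = ?A"
    by (intro nn_integral_cong) (auto simp: indicator_def ennreal_power power_mult_distrib)
  also have "(\<integral>\<^sup>+r. (indicator {0<..} r * ennreal (sqrt (r ^ m) * (r * norm (Q r))))\<^sup>2 \<partial>lborel) = ?B"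
  proof (rule nn_integral_cong)
    fix r :: real
    show "(indicator {0<..} r * ennreal (sqrt (r ^ m) * (r * norm (Q r))))\<^sup>2
        = indicator {0<..} r * ennreal (r ^ (m + 2) * (norm (F' r + of_real (a / r) * F r))\<^sup>2)"
    proof (cases "0 < r")
      case True
      have "(sqrt (r ^ m) * (r * norm (Q r)))\<^sup>2 = (sqrt (r ^ m))\<^sup>2 * r\<^sup>2 * (norm (Q r))\<^sup>2"
        by (simp only: power_mult_distrib mult.assoc)
      also have "(sqrt (r ^ m))\<^sup>2 * r\<^sup>2 = r ^ (m + 2)"
        using True by (subst real_sqrt_pow2) (simp_all only: power_add zero_le_power less_imp_le)
      finally have "(ennreal (sqrt (r ^ m) * (r * norm (Q r))))\<^sup>2 = ennreal (r ^ (m + 2) * (norm (Q r))\<^sup>2)"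
        using True by (subst ennreal_power) auto
      then show ?thesis using True by (simp only: Q_def) simp
    qed simp
  qed
  finally have J: "J\<^sup>2 \<le> ?A * ?B" .
  have W_fin: "(\<integral>\<^sup>+r. indicator {1..} r * ennreal (W r / r) \<partial>lborel) < \<infinity>"
  proof (rule le_less_trans[OF nn_integral_mono F2])
    fix r :: real
    show "indicator {1..} r * ennreal (W r / r) \<le> indicator {0<..} r * ennreal (r ^ m * (norm (F r))\<^sup>2)"
      by (auto simp: indicator_def W_def)
  qed
  have eps: "ennreal (W r) \<le> 2 * J + ennreal d" if d: "0 < d" for d
  proof -
    obtain R where R: "r < R" "W R < d"
      using ex_small_of_nn_integral_inverse_weight[OF W_fin d, of r] by auto
    have int: "integrable lborel (\<lambda>s. indicator {r..R} s *\<^sub>R W' s)"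
      and eq: "W R - W r = (LBINT s. indicator {r..R} s *\<^sub>R W' s)"
      using primitive_on_posD[OF W r, of R] R by (auto simp: set_integrable_def set_lebesgue_integral_def)
    have "W r = W R - (LBINT s. indicator {r..R} s *\<^sub>R W' s)" using eq by simp
    also have "\<dots> \<le> d + norm (LBINT s. indicator {r..R} s *\<^sub>R W' s)"
      using R by (simp add: abs_if)
    finally have "ennreal (W r) \<le> ennreal d + ennreal (norm (LBINT s. indicator {r..R} s *\<^sub>R W' s))"
      using d by (subst ennreal_plus[symmetric]) (simp, simp, rule ennreal_leI)
    also have "ennreal (norm (LBINT s. indicator {r..R} s *\<^sub>R W' s)) \<le> (\<integral>\<^sup>+s. ennreal (norm (indicator {r..R} s *\<^sub>R W' s)) \<partial>lborel)"
      by (rule integral_norm_bound_ennreal[OF int])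
    also have "\<dots> \<le> (\<integral>\<^sup>+s. 2 * ((indicator {0<..} s * ennreal (sqrt (s ^ m) * norm (F s))) * (indicator {0<..} s * ennreal (sqrt (s ^ m) * (s * norm (Q s))))) \<partial>lborel)"
    proof (rule nn_integral_mono)
      fix s
      show "ennreal (norm (indicator {r..R} s *\<^sub>R W' s)) \<le> 2 * ((indicator {0<..} s * ennreal (sqrt (s ^ m) * norm (F s))) * (indicator {0<..} s * ennreal (sqrt (s ^ m) * (s * norm (Q s)))))"
      proof (cases "s \<in> {r..R}")
        case True
        then have s: "0 < s" using r by auto
        have "ennreal \<bar>W' s\<bar> \<le> ennreal (2 * ((sqrt (s ^ m) * norm (F s)) * (sqrt (s ^ m) * (s * norm (Q s)))))"
          using W'_le[OF s] by (rule ennreal_leI)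
        also have "\<dots> = 2 * (ennreal (sqrt (s ^ m) * norm (F s)) * ennreal (sqrt (s ^ m) * (s * norm (Q s))))"
        proof -
          have E: "ennreal (2 * (x * y)) = 2 * (ennreal x * ennreal y)" if "0 \<le> x" "0 \<le> y" for x y
            using that by (simp add: ennreal_mult)
          show ?thesis by (rule E) (use s in auto)
        qed
        finally show ?thesis using True s by simp
      qed simp
    qed
    also have "\<dots> = 2 * J"
      unfolding J_def by (rule nn_integral_cmult) measurable
    finally show ?thesis by (simp add: add.commute)
  qed
  have "ennreal (W r) \<le> 2 * J" by (rule ennreal_le_epsilon) (rule eps)
  then have "(ennreal (W r))\<^sup>2 \<le> (2 * J)\<^sup>2" by (rule power_mono) simp
  also have "\<dots> = 4 * J\<^sup>2" by (simp add: power_mult_distrib)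
  also have "\<dots> \<le> 4 * (?A * ?B)" by (rule mult_left_mono[OF J]) simp
  finally show ?thesis by (simp only: W_def mult.assoc)
qed

text \<open>
The integrand is \<open>W^(2/(m+1)) r^m |F|\<^sup>2\<close> with the \<open>W\<close> of the preceding theorem; the first factor is bounded pointwise.
\<close>

theorem Gagliardo_Nirenberg_half_line:
  fixes F F' :: "real \<Rightarrow> complex" and m :: nat and \<alpha> \<beta> :: real
  defines "a \<equiv> (real m + 1) / 2" and "p \<equiv> 2 * (real m + 3) / (real m + 1)"
  assumes prim: "primitive_on_pos F F'"
    and [measurable]: "F \<in> borel_measurable borel" "F' \<in> borel_measurable borel"
    and A: "(\<integral>\<^sub>0r. ennreal (r ^ m * (norm (F r))\<^sup>2)) \<le> ennreal \<alpha>" (is "?A \<le> _")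
    and B: "(\<integral>\<^sub>0r. ennreal (r ^ (m + 2) * (norm (F' r + of_real (a / r) * F r))\<^sup>2)) \<le> ennreal \<beta>" (is "?B \<le> _")
    and nonneg: "0 \<le> \<alpha>" "0 \<le> \<beta>"
  shows "(\<integral>\<^sub>0r. ennreal (r ^ (m + 2) * norm (F r) powr p))
    \<le> ennreal ((4 * \<alpha> * \<beta>) powr (1 / (real m + 1)) * \<alpha>)"
proof -
  define S where "S = (4 * \<alpha> * \<beta>) powr (1 / (real m + 1))"
  have fin: "?A < \<infinity>" using A by (rule le_less_trans) simp
  have W: "(r ^ (m + 1) * (norm (F r))\<^sup>2)\<^sup>2 \<le> 4 * \<alpha> * \<beta>" if r: "0 < r" for r
  proof -
    have "ennreal ((r ^ (m + 1) * (norm (F r))\<^sup>2)\<^sup>2) = (ennreal (r ^ (m + 1) * (norm (F r))\<^sup>2))\<^sup>2"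
      using r by (subst ennreal_power) auto
    also have "\<dots> \<le> 4 * ?A * ?B"
      unfolding a_def by (rule Agmon_half_line) (use prim fin r in auto)
    also have "\<dots> \<le> 4 * ennreal \<alpha> * ennreal \<beta>"
      by (intro mult_mono A B order_refl) auto
    also have "\<dots> = ennreal (4 * \<alpha> * \<beta>)"
      using nonneg by (simp add: ennreal_mult)
    finally show ?thesis
      using nonneg by (subst (asm) ennreal_le_iff) auto
  qed
  have pw: "r ^ (m + 2) * norm (F r) powr p \<le> S * (r ^ m * (norm (F r))\<^sup>2)" if r: "0 < r" for r
  proof (cases "F r = 0")
    case False
    define x where "x = norm (F r)"
    have x: "0 < x" using False by (simp add: x_def)
    have m1: "real m + 1 > 0" by simp
    have "((r ^ (m + 1) * x\<^sup>2)\<^sup>2) powr (1 / (real m + 1)) \<le> S"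
      unfolding S_def x_def by (intro powr_mono2 W r) auto
    moreover have "((r ^ (m + 1) * x\<^sup>2)\<^sup>2) powr (1 / (real m + 1)) = r\<^sup>2 * x powr (4 / (real m + 1))"
    proof -
      have "(r ^ (m + 1) * x\<^sup>2)\<^sup>2 = (r\<^sup>2) ^ (m + 1) * x ^ 4"
        by (simp add: power_mult_distrib power_mult[symmetric] mult.commute)
      also have "(r\<^sup>2) ^ (m + 1) = (r\<^sup>2) powr (real m + 1)"
        using r powr_realpow[of "r\<^sup>2" "m + 1"] by (simp add: add.commute)
      also have "x ^ 4 = x powr 4"
        using x by simp
      finally have "(r ^ (m + 1) * x\<^sup>2)\<^sup>2 = (r\<^sup>2) powr (real m + 1) * x powr 4" .
      then have "((r ^ (m + 1) * x\<^sup>2)\<^sup>2) powr (1 / (real m + 1))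
          = ((r\<^sup>2) powr (real m + 1) * x powr 4) powr (1 / (real m + 1))"
        by (simp only:)
      also have "\<dots> = (r\<^sup>2) powr ((real m + 1) * (1 / (real m + 1))) * x powr (4 * (1 / (real m + 1)))"
        by (simp only: powr_mult powr_powr powr_ge_zero)
      finally show ?thesis
        using r m1 by simp
    qed
    moreover have "x powr p = x powr (4 / (real m + 1)) * x\<^sup>2"
    proof -
      have "p = 4 / (real m + 1) + 2"
        by (simp add: p_def field_simps)
      then show ?thesis using x by (simp add: powr_add powr_numeral)
    qed
    ultimately have le: "r\<^sup>2 * x powr (4 / (real m + 1)) \<le> S"
      and eq: "r ^ (m + 2) * x powr p = (r\<^sup>2 * x powr (4 / (real m + 1))) * (r ^ m * x\<^sup>2)"
      by (simp_all add: power_add power2_eq_square)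
    show ?thesis
      unfolding x_def[symmetric] eq by (rule mult_right_mono[OF le]) (use r in auto)
  qed (simp add: S_def)
  have "(\<integral>\<^sub>0r. ennreal (r ^ (m + 2) * norm (F r) powr p))
    \<le> (\<integral>\<^sup>+r. ennreal S * (indicator {0<..} r * ennreal (r ^ m * (norm (F r))\<^sup>2)) \<partial>lborel)"
  proof (rule nn_integral_mono)
    fix r :: real
    show "indicator {0<..} r * ennreal (r ^ (m + 2) * norm (F r) powr p)
      \<le> ennreal S * (indicator {0<..} r * ennreal (r ^ m * (norm (F r))\<^sup>2))"
    proof (cases "0 < r")
      case True
      have "ennreal (r ^ (m + 2) * norm (F r) powr p) \<le> ennreal (S * (r ^ m * (norm (F r))\<^sup>2))"
        by (rule ennreal_leI[OF pw[OF True]])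
      also have "\<dots> = ennreal S * ennreal (r ^ m * (norm (F r))\<^sup>2)"
        by (rule ennreal_mult') (simp add: S_def)
      finally show ?thesis using True by simp
    qed simp
  qed
  also have "\<dots> = ennreal S * ?A"
    by (rule nn_integral_cmult) measurable
  also have "\<dots> \<le> ennreal S * ennreal \<alpha>"
    by (rule mult_left_mono[OF A]) simp
  also have "\<dots> = ennreal (S * \<alpha>)"
    by (rule ennreal_mult'[symmetric]) (simp add: S_def)
  finally show ?thesis by (simp only: S_def)
qed


section \<open>Polar coordinates\<close>

text \<open>
The surface measure on Borel sets: \<^const>\<open>surface_measure\<close> before its completion.
\<close>

definition sphere_measure :: "(real^'n::finite) measure" where
  "sphere_measure = scale_measure (of_nat CARD('n))
     (distr (restrict_space lborel (cball 0 1 - {0})) (restrict_space borel (sphere 0 1))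
        (\<lambda>x. x /\<^sub>R norm x))"

lemma surface_measure_eq_completion: "surface_measure = completion sphere_measure"
  by (simp add: surface_measure_def sphere_measure_def)

lemma sets_sphere_measure [simp]:
  "sets (sphere_measure :: (real^'n::finite) measure) = sets (restrict_space borel (sphere 0 1))"
  by (simp add: sphere_measure_def)

lemma space_sphere_measure [simp]:
  "space (sphere_measure :: (real^'n::finite) measure) = sphere 0 1"
  by (simp add: sphere_measure_def space_restrict_space space_scale_measure)

text \<open>
The domain of \<^const>\<open>sphere_measure\<close> is a subspace, so Borel functions on the whole space have to be restricted to it;
this and the following lemma do so for functions of one and of two variables.
\<close>

lemma measurable_sphere_measure:
  fixes f :: "real^'n::finite \<Rightarrow> 'b"
  assumes "f \<in> measurable borel N"
  shows "f \<in> measurable sphere_measure N"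
  by (subst measurable_cong_sets[OF sets_sphere_measure refl]) (rule measurable_restrict_space1, rule assms)

lemma measurable_pair_sphere_measure:
  fixes f :: "'a \<times> (real^'n::finite) \<Rightarrow> 'b"
  assumes "f \<in> measurable (M \<Otimes>\<^sub>M borel) N"
  shows "f \<in> measurable (M \<Otimes>\<^sub>M sphere_measure) N"
proof -
  have "(\<lambda>z. (fst z, snd z)) \<in> measurable (M \<Otimes>\<^sub>M sphere_measure) (M \<Otimes>\<^sub>M (borel :: (real^'n) measure))"
    by (intro measurable_Pair measurable_fst measurable_compose[OF measurable_snd] measurable_sphere_measure) simp
  from measurable_compose[OF this assms] show ?thesis by simp
qed

lemma nn_integral_sphere_measure:
  fixes f :: "real^'n::finite \<Rightarrow> ennreal"
  assumes "f \<in> borel_measurable sphere_measure"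
  shows "(\<integral>\<^sup>+\<omega>. f \<omega> \<partial>sphere_measure) =
    of_nat CARD('n) * (\<integral>\<^sup>+y. f (y /\<^sub>R norm y) * indicator (cball 0 1 - {0}) y \<partial>lborel)"
proof -
  let ?M = "restrict_space lborel (cball (0::real^'n) 1 - {0})"
  let ?S = "restrict_space borel (sphere (0::real^'n) 1)"
  have f: "f \<in> borel_measurable ?S"
    using assms by (simp cong: measurable_cong_sets)
  have g: "(\<lambda>x::real^'n. x /\<^sub>R norm x) \<in> measurable ?M ?S"
    by (rule measurable_restrict_space2) (auto simp: space_restrict_space intro!: measurable_restrict_space1)
  show ?thesis
    using f g by (simp add: sphere_measure_def nn_integral_scale_measure nn_integral_distr nn_integral_restrict_space)
qed

lemma finite_measure_sphere_measure: "finite_measure (sphere_measure :: (real^'n::finite) measure)"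
proof
  have "emeasure (sphere_measure :: (real^'n) measure) (sphere 0 1) = (\<integral>\<^sup>+\<omega>. 1 \<partial>(sphere_measure :: (real^'n) measure))"
    by simp
  also have "\<dots> = of_nat CARD('n) * (\<integral>\<^sup>+y. indicator (cball 0 1 - {0}) y \<partial>(lborel :: (real^'n) measure))"
    by (subst nn_integral_sphere_measure) auto
  also have "\<dots> \<le> of_nat CARD('n) * emeasure lborel (cball 0 1 :: (real^'n) set)"
    by (intro mult_left_mono) (auto intro!: emeasure_mono)
  also have "\<dots> < \<infinity>"
    using emeasure_lborel_cball_finite[of "0::real^'n" 1] by (simp add: ennreal_mult_less_top of_nat_less_top)
  finally show "emeasure (sphere_measure :: (real^'n) measure) (space sphere_measure) \<noteq> \<infinity>"
    by auto
qed

interpretation sphere_measure: finite_measure "sphere_measure :: (real^'n::finite) measure"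
  by (rule finite_measure_sphere_measure)

lemma measure_sphere_measure_pos: "0 < measure (sphere_measure :: (real^'n::finite) measure) (sphere 0 1)"
proof -
  have "emeasure (sphere_measure :: (real^'n) measure) (sphere 0 1) = (\<integral>\<^sup>+\<omega>. 1 \<partial>(sphere_measure :: (real^'n) measure))"
    by simp
  also have "\<dots> = of_nat CARD('n) * (\<integral>\<^sup>+y. indicator (cball 0 1 - {0}) y \<partial>(lborel :: (real^'n) measure))"
    by (subst nn_integral_sphere_measure) auto
  also have "\<dots> = of_nat CARD('n) * emeasure lborel (cball 0 1 - {0} :: (real^'n) set)"
    by simp
  also have "emeasure lborel (cball 0 1 - {0} :: (real^'n) set) = emeasure lborel (cball 0 1 :: (real^'n) set)"
    by (subst emeasure_Diff) auto
  also have "\<dots> = ennreal (measure lborel (cball 0 1 :: (real^'n) set))"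
    using emeasure_lborel_cball_finite[of "0::real^'n" 1] by (intro emeasure_eq_ennreal_measure) auto
  finally have "emeasure (sphere_measure :: (real^'n) measure) (sphere 0 1) \<noteq> 0"
    using content_cball_pos[of 1 "0::real^'n"] by auto
  then show ?thesis
    by (simp add: sphere_measure.emeasure_eq_measure measure_nonneg less_le)
qed

lemma nn_integral_lborel_scaleR:
  fixes f :: "real^'n::finite \<Rightarrow> ennreal"
  assumes [measurable]: "f \<in> borel_measurable borel" and c: "0 < c"
  shows "(\<integral>\<^sup>+x. f x \<partial>lborel) = ennreal (c ^ CARD('n)) * (\<integral>\<^sup>+x. f (c *\<^sub>R x) \<partial>lborel)"
proof -
  have "(\<integral>\<^sup>+x. f x \<partial>lborel) = (\<integral>\<^sup>+x. f x \<partial>density (distr lborel borel (\<lambda>x. 0 + c *\<^sub>R x)) (\<lambda>_. \<bar>c\<bar> ^ DIM(real^'n)))"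
    using lborel_affine[of c "0::real^'n"] c by simp
  also have "\<dots> = ennreal (c ^ CARD('n)) * (\<integral>\<^sup>+x. f (c *\<^sub>R x) \<partial>lborel)"
    using c by (subst nn_integral_density) (simp_all add: nn_integral_cmult nn_integral_distr)
  finally show ?thesis .
qed

text \<open>
For \<open>a = |x|\<close> this is the weight that remains in the proof of the polar coordinate formula after Tonelli.
\<close>

lemma nn_integral_power_tail:
  fixes a :: real
  assumes a: "0 < a" and n: "0 < n"
  shows "(\<integral>\<^sup>+s. ennreal (1 / s ^ (n + 1)) * indicator {a..} s \<partial>lborel) * of_nat n = ennreal (1 / a ^ n)"
proof -
  have "(\<integral>\<^sup>+s. ennreal (real n * (1 / s ^ (n + 1))) * indicator {a..} s \<partial>lborel) = ennreal (0 - (- 1 / a ^ n))"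
  proof (rule nn_integral_FTC_atLeast)
    show "((\<lambda>s. - 1 / s ^ n) has_real_derivative real n * (1 / s ^ (n + 1))) (at s)" if "a \<le> s" for s
    proof -
      have s: "0 < s" using that a by simp
      obtain m where m: "n = Suc m" using n by (cases n) auto
      show ?thesis
        unfolding m
      proof (rule DERIV_cong)
        show "((\<lambda>s. - 1 / s ^ Suc m) has_real_derivative
            (0 * s ^ Suc m - (- 1) * (real (Suc m) * s ^ m)) / (s ^ Suc m * s ^ Suc m)) (at s)"
          using s DERIV_pow[of "Suc m" s UNIV] by (intro DERIV_divide) auto
        show "(0 * s ^ Suc m - (- 1) * (real (Suc m) * s ^ m)) / (s ^ Suc m * s ^ Suc m) = real (Suc m) * (1 / s ^ (Suc m + 1))"
          using s by (simp add: divide_simps)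
      qed
    qed
    show "((\<lambda>s::real. - 1 / s ^ n) \<longlongrightarrow> 0) at_top"
    proof (rule tendsto_divide_0[OF tendsto_const filterlim_at_top_imp_at_infinity])
      show "filterlim (\<lambda>s::real. s ^ n) at_top at_top"
        by (rule filterlim_pow_at_top[OF n filterlim_ident])
    qed
  qed (use a in auto)
  moreover have "(\<integral>\<^sup>+s. ennreal (real n * (1 / s ^ (n + 1))) * indicator {a..} s \<partial>lborel)
     = (\<integral>\<^sup>+s. of_nat n * (ennreal (1 / s ^ (n + 1)) * indicator {a..} s) \<partial>lborel)"
    using a by (intro nn_integral_cong) (auto simp: ennreal_mult'' ennreal_of_nat_eq_real_of_nat indicator_def ennreal_mult'[symmetric])
  ultimately show ?thesis
    by (simp add: nn_integral_cmult mult.commute)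
qed

text \<open>
The surface measure is an integral over the unit ball, so the right side is a double
integral of \<open>f (r y / |y|)\<close> over \<open>r\<close> and \<open>y\<close>. Substituting \<open>r = s |y|\<close> for fixed \<open>y\<close>, and then
\<open>y = x / s\<close> for fixed \<open>s\<close>, leaves \<open>f x |x|^n\<close> times the integral of \<open>n s^(-n-1)\<close> over \<open>s \<ge> |x|\<close>,
which is \<open>|x|^(-n)\<close>.
\<close>

theorem nn_integral_polar:
  fixes f :: "real^'n::finite \<Rightarrow> ennreal"
  assumes [measurable]: "f \<in> borel_measurable borel"
  shows "(\<integral>\<^sup>+x. f x \<partial>lborel) =
    (\<integral>\<^sub>0r. (ennreal (r ^ (CARD('n) - 1)) * (\<integral>\<^sup>+\<omega>. f (r *\<^sub>R \<omega>) \<partial>sphere_measure)))"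
proof -
  let ?n = "CARD('n)"
  let ?B = "cball 0 1 - {0} :: (real^'n) set"
  let ?F = "\<lambda>r y. of_nat ?n * (indicator {0<..} r * ennreal (r ^ (?n - 1)) * f ((r / norm y) *\<^sub>R y) * indicator ?B y)"
  let ?G = "\<lambda>s y. of_nat ?n * (indicator {0<..} s * ennreal (s ^ (?n - 1) * norm y ^ ?n) * f (s *\<^sub>R y) * indicator ?B y)"
  let ?H = "\<lambda>s x. of_nat ?n * (ennreal (1 / s ^ (?n + 1)) * ennreal (norm x ^ ?n) * f x * (if x \<noteq> 0 \<and> norm x \<le> s then 1 else 0))"
  have n: "0 < ?n" by simp
  have [measurable]: "?B \<in> sets borel" by auto
  have fin: "emeasure lborel {0::real^'n} = 0" by simp
  have "(\<integral>\<^sub>0r. (ennreal (r ^ (?n - 1)) * (\<integral>\<^sup>+\<omega>. f (r *\<^sub>R \<omega>) \<partial>sphere_measure)))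
    = (\<integral>\<^sup>+r. (\<integral>\<^sup>+y. ?F r y \<partial>lborel) \<partial>lborel)"
  proof (rule nn_integral_cong)
    fix r :: real
    have "(\<integral>\<^sup>+y. ?F r y \<partial>lborel)
      = (\<integral>\<^sup>+y. (of_nat ?n * (indicator {0<..} r * ennreal (r ^ (?n - 1)))) * (f ((r / norm y) *\<^sub>R y) * indicator ?B y) \<partial>lborel)"
      by (simp add: mult_ac)
    also have "\<dots> = (of_nat ?n * (indicator {0<..} r * ennreal (r ^ (?n - 1)))) * (\<integral>\<^sup>+y. f ((r / norm y) *\<^sub>R y) * indicator ?B y \<partial>lborel)"
      by (rule nn_integral_cmult) measurable
    also have "\<dots> = indicator {0<..} r * ennreal (r ^ (?n - 1)) * ((\<integral>\<^sup>+y. f ((r / norm y) *\<^sub>R y) * indicator ?B y \<partial>lborel) * of_nat ?n)"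
      by (simp only: mult_ac)
    also have "(\<integral>\<^sup>+y. f ((r / norm y) *\<^sub>R y) * indicator ?B y \<partial>lborel) * of_nat ?n = (\<integral>\<^sup>+\<omega>. f (r *\<^sub>R \<omega>) \<partial>sphere_measure)"
    proof -
      have [measurable]: "(\<lambda>\<omega>. f (r *\<^sub>R \<omega>)) \<in> borel_measurable sphere_measure" by (rule measurable_sphere_measure) measurable
      show ?thesis by (subst nn_integral_sphere_measure) (auto simp: divide_inverse mult_ac)
    qed
    finally show "indicator {0<..} r * (ennreal (r ^ (?n - 1)) * (\<integral>\<^sup>+\<omega>. f (r *\<^sub>R \<omega>) \<partial>sphere_measure))
      = (\<integral>\<^sup>+y. ?F r y \<partial>lborel)"
      by (simp add: mult_ac)
  qed
  also have "\<dots> = (\<integral>\<^sup>+y. (\<integral>\<^sup>+r. ?F r y \<partial>lborel) \<partial>lborel)"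
    by (rule lborel_pair.Fubini') measurable
  also have "\<dots> = (\<integral>\<^sup>+y. (\<integral>\<^sup>+s. ?G s y \<partial>lborel) \<partial>lborel)"
  proof (rule nn_integral_cong)
    \<comment> \<open>The substitution \<open>r = norm y * s\<close>.\<close>
    fix y :: "real^'n"
    show "(\<integral>\<^sup>+r. ?F r y \<partial>lborel)
       = (\<integral>\<^sup>+s. ?G s y \<partial>lborel)"
    proof (cases "y = 0")
      case False
      have pw: "norm y * (s * norm y) ^ (?n - 1) = s ^ (?n - 1) * norm y ^ ?n" for s
        using power_Suc[of "norm y" "?n - 1"] n by (simp add: power_mult_distrib)
      have "(\<integral>\<^sup>+r. ?F r y \<partial>lborel)
        = ennreal \<bar>norm y\<bar> * (\<integral>\<^sup>+s. ?F (0 + norm y * s) y \<partial>lborel)"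
        using False by (intro nn_integral_real_affine) auto
      also have "\<dots> = (\<integral>\<^sup>+s. ennreal \<bar>norm y\<bar> * (?F (0 + norm y * s) y) \<partial>lborel)"
        by (subst nn_integral_cmult) auto
      also have "\<dots> = (\<integral>\<^sup>+s. ?G s y \<partial>lborel)"
      proof (rule nn_integral_cong)
        fix s :: real
        have ind: "indicator {0<..} (0 + norm y * s) = (indicator {0<..} s :: ennreal)"
          using False by (auto simp: indicator_def zero_less_mult_iff)
        show "ennreal \<bar>norm y\<bar> * (?F (0 + norm y * s) y)
          = ?G s y"
        proof (cases "s > 0")
          case True
          have e: "ennreal (s ^ (?n - 1) * norm y ^ ?n) = ennreal \<bar>norm y\<bar> * ennreal ((0 + norm y * s) ^ (?n - 1))"
            using True pw[of s, symmetric] ennreal_mult[of "\<bar>norm y\<bar>" "(0 + norm y * s) ^ (?n - 1)"]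
            by (simp only: abs_norm_cancel mult.commute[of s "norm y"]) simp
          have "(0 + norm y * s) / norm y = s" using False by simp
          then show ?thesis
            unfolding e ind by (simp only: mult_ac)
        qed (simp only: ind, simp)
      qed
      finally show ?thesis .
    qed simp
  qed
  also have "\<dots> = (\<integral>\<^sup>+s. (\<integral>\<^sup>+y. ?G s y \<partial>lborel) \<partial>lborel)"
    by (rule lborel_pair.Fubini') measurable
  also have "\<dots> = (\<integral>\<^sup>+s. (\<integral>\<^sup>+x. ?H s x \<partial>lborel) \<partial>lborel)"
  proof (rule nn_integral_cong)
    \<comment> \<open>The substitution \<open>x = s *\<^sub>R y\<close>; the unit ball becomes the condition \<open>norm x \<le> s\<close>.\<close>
    fix s :: real
    show "(\<integral>\<^sup>+y. ?G s y \<partial>lborel)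
      = (\<integral>\<^sup>+x. ?H s x \<partial>lborel)"
    proof (cases "s > 0")
      case True
      have "(\<integral>\<^sup>+x. ?H s x \<partial>lborel)
        = ennreal (s ^ ?n) * (\<integral>\<^sup>+y. ?H s (s *\<^sub>R y) \<partial>lborel)"
        using True by (intro nn_integral_lborel_scaleR) auto
      also have "\<dots> = (\<integral>\<^sup>+y. ennreal (s ^ ?n) * (?H s (s *\<^sub>R y)) \<partial>lborel)"
        by (subst nn_integral_cmult) auto
      also have "\<dots> = (\<integral>\<^sup>+y. ?G s y \<partial>lborel)"
      proof (rule nn_integral_cong)
        fix y :: "real^'n"
        obtain m where m: "?n = Suc m" using n gr0_implies_Suc by blast
        have pw: "s ^ (?n - 1) * norm y ^ ?n = s ^ ?n * (1 / s ^ (?n + 1) * norm (s *\<^sub>R y) ^ ?n)"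
          using True unfolding m by (simp add: power_mult_distrib field_simps)
        have *: "ennreal (s ^ (?n - 1) * norm y ^ ?n) = ennreal (s ^ ?n) * (ennreal (1 / s ^ (?n + 1)) * ennreal (norm (s *\<^sub>R y) ^ ?n))"
        proof -
          have E: "ennreal (a * (b * c)) = ennreal a * (ennreal b * ennreal c)" if "0 \<le> a" "0 \<le> b" "0 \<le> c" for a b c
            by (simp add: ennreal_mult that)
          show ?thesis unfolding pw by (rule E) (use True in auto)
        qed
        have "(if s *\<^sub>R y \<noteq> 0 \<and> norm (s *\<^sub>R y) \<le> s then 1 else 0) = (indicator ?B y :: ennreal)"
          using True by (auto simp: indicator_def)
        then show "ennreal (s ^ ?n) * (?H s (s *\<^sub>R y))
          = ?G s y"
          unfolding * using True by (simp add: mult_ac)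
      qed
      finally show ?thesis by simp
    next
      case False
      have "(if x \<noteq> 0 \<and> norm x \<le> s then 1 else 0) = (0::ennreal)" for x :: "real^'n"
        using False by (auto simp: indicator_def not_less dest: order_trans[OF _ False[unfolded not_less]])
      then show ?thesis using False by simp
    qed
  qed
  also have "\<dots> = (\<integral>\<^sup>+x. (\<integral>\<^sup>+s. ?H s x \<partial>lborel) \<partial>lborel)"
    by (rule lborel_pair.Fubini') measurable
  also have "\<dots> = (\<integral>\<^sup>+x. f x \<partial>lborel)"
  proof (rule nn_integral_cong_AE)
    have "AE x in lborel. x \<noteq> (0::real^'n)"
      using fin by (intro AE_I[of _ _ "{0}"]) auto
    then show "AE x in lborel. (\<integral>\<^sup>+s. ?H s x \<partial>lborel) = f x"
    proof eventually_elim
      case (elim x)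
      have "(\<integral>\<^sup>+s. ?H s x \<partial>lborel)
        = (\<integral>\<^sup>+s. (ennreal (norm x ^ ?n) * f x * of_nat ?n) * (ennreal (1 / s ^ (?n + 1)) * indicator {norm x..} s) \<partial>lborel)"
        using elim by (intro nn_integral_cong) (simp add: mult_ac indicator_def)
      also have "\<dots> = f x * (ennreal (norm x ^ ?n) * ((\<integral>\<^sup>+s. ennreal (1 / s ^ (?n + 1)) * indicator {norm x..} s \<partial>lborel) * of_nat ?n))"
        by (subst nn_integral_cmult) (auto simp: mult_ac)
      also have "\<dots> = f x"
        using elim by (subst nn_integral_power_tail) (auto simp: ennreal_mult[symmetric])
      finally show ?case .
    qed
  qed
  finally show ?thesis by simp
qed

lemma scaleR_sphere_measurable:
  fixes f :: "real^'n::finite \<Rightarrow> 'b"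
  assumes [measurable]: "f \<in> measurable borel N"
  shows "(\<lambda>(r, \<omega>). f (r *\<^sub>R \<omega>)) \<in> measurable (borel \<Otimes>\<^sub>M sphere_measure) N"
  by (rule measurable_pair_sphere_measure) measurable

lemma scaleR_sphere_measurable':
  fixes f :: "real^'n::finite \<Rightarrow> 'b"
  assumes "f \<in> measurable borel N"
  shows "(\<lambda>(\<omega>, r). f (r *\<^sub>R \<omega>)) \<in> measurable (sphere_measure \<Otimes>\<^sub>M borel) N"
  using measurable_pair_swap[OF scaleR_sphere_measurable[OF assms]] by (simp add: split_beta')

lemma borel_measurable_sphere_nn_integral:
  fixes f :: "real^'n::finite \<Rightarrow> ennreal"
  assumes "f \<in> borel_measurable borel"
  shows "(\<lambda>r. \<integral>\<^sup>+\<omega>. f (r *\<^sub>R \<omega>) \<partial>sphere_measure) \<in> borel_measurable borel"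
  using sphere_measure.borel_measurable_nn_integral_fst[OF scaleR_sphere_measurable[OF assms]] by simp

lemma nn_integral_polar':
  fixes f :: "real^'n::finite \<Rightarrow> ennreal"
  assumes [measurable]: "f \<in> borel_measurable borel"
  shows "(\<integral>\<^sup>+x. f x \<partial>lborel) =
    (\<integral>\<^sup>+\<omega>. (\<integral>\<^sub>0r. (ennreal (r ^ (CARD('n) - 1)) * f (r *\<^sub>R \<omega>))) \<partial>sphere_measure)"
proof -
  interpret P: pair_sigma_finite "lborel :: real measure" "sphere_measure :: (real^'n) measure" ..
  have [measurable]: "(\<lambda>z. f (fst z *\<^sub>R snd z)) \<in> borel_measurable (lborel \<Otimes>\<^sub>M sphere_measure)"
    using scaleR_sphere_measurable[OF assms] by (simp add: split_beta' cong: measurable_cong_sets)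
  have "(\<integral>\<^sup>+x. f x \<partial>lborel) = (\<integral>\<^sup>+r. (\<integral>\<^sup>+\<omega>. indicator {0<..} r * (ennreal (r ^ (CARD('n) - 1)) * f (r *\<^sub>R \<omega>)) \<partial>sphere_measure) \<partial>lborel)"
    unfolding nn_integral_polar[OF assms]
    by (intro nn_integral_cong) (auto simp: nn_integral_cmult measurable_sphere_measure)
  also have "\<dots> = (\<integral>\<^sup>+\<omega>. (\<integral>\<^sub>0r. (ennreal (r ^ (CARD('n) - 1)) * f (r *\<^sub>R \<omega>))) \<partial>sphere_measure)"
    by (rule P.Fubini'[symmetric]) (simp add: split_beta')
  finally show ?thesis .
qed

lemma AE_polar:
  fixes P :: "real^'n::finite \<Rightarrow> bool"
  assumes ae: "AE x in lborel. P x"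
  shows "AE r in lborel. 0 < r \<longrightarrow> (AE \<omega> in sphere_measure. P (r *\<^sub>R \<omega>))"
    and "AE \<omega> in sphere_measure. AE r in lborel. 0 < r \<longrightarrow> P (r *\<^sub>R \<omega>)"
proof -
  interpret P: pair_sigma_finite "lborel :: real measure" "sphere_measure :: (real^'n) measure" ..
  obtain N where N: "{x. \<not> P x} \<subseteq> N" "N \<in> sets borel" "emeasure lborel N = 0"
    using ae by (auto elim: AE_E)
  have [measurable]: "N \<in> sets borel" by fact
  have [measurable]: "(\<lambda>z. indicator N (fst z *\<^sub>R snd z) :: ennreal) \<in> borel_measurable (lborel \<Otimes>\<^sub>M (sphere_measure :: (real^'n) measure))"
    using scaleR_sphere_measurable[of "indicator N :: real^'n \<Rightarrow> ennreal" borel] by (simp add: split_beta' cong: measurable_cong_sets)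
  have [measurable]: "(\<lambda>z. indicator N (snd z *\<^sub>R fst z) :: ennreal) \<in> borel_measurable ((sphere_measure :: (real^'n) measure) \<Otimes>\<^sub>M lborel)"
    using scaleR_sphere_measurable'[of "indicator N :: real^'n \<Rightarrow> ennreal" borel] by (simp add: split_beta' cong: measurable_cong_sets)
  have [measurable]: "(\<lambda>r. \<integral>\<^sup>+\<omega>. indicator N (r *\<^sub>R \<omega>) \<partial>(sphere_measure :: (real^'n) measure)) \<in> borel_measurable borel"
    by (rule borel_measurable_sphere_nn_integral) simp
  have zero: "(\<integral>\<^sup>+x. indicator N x \<partial>lborel) = 0" using N by simp
  from zero have "AE r in lborel. indicator {0<..} r * (ennreal (r ^ (CARD('n) - 1)) * (\<integral>\<^sup>+\<omega>. indicator N (r *\<^sub>R \<omega>) \<partial>(sphere_measure :: (real^'n) measure))) = 0"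
    by (subst (asm) nn_integral_polar) (auto simp: nn_integral_0_iff_AE)
  then show "AE r in lborel. 0 < r \<longrightarrow> (AE \<omega> in sphere_measure. P (r *\<^sub>R \<omega>))"
  proof eventually_elim
    case (elim r)
    show ?case
    proof
      assume r: "0 < r"
      with elim have "(\<integral>\<^sup>+\<omega>. indicator N (r *\<^sub>R \<omega>) \<partial>(sphere_measure :: (real^'n) measure)) = 0" by simp
      then have "AE \<omega> in (sphere_measure :: (real^'n) measure). (indicator N (r *\<^sub>R \<omega>) :: ennreal) = 0"
        by (subst (asm) nn_integral_0_iff_AE) (auto intro!: measurable_sphere_measure)
      then show "AE \<omega> in sphere_measure. P (r *\<^sub>R \<omega>)"
        by eventually_elim (use N in \<open>auto simp: indicator_def split: if_splits\<close>)
    qed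
  qed
  from zero have "AE \<omega> in (sphere_measure :: (real^'n) measure). (\<integral>\<^sub>0r. (ennreal (r ^ (CARD('n) - 1)) * indicator N (r *\<^sub>R \<omega>))) = 0"
    by (subst (asm) nn_integral_polar') (auto simp: nn_integral_0_iff_AE intro!: lborel.borel_measurable_nn_integral)
  then show "AE \<omega> in sphere_measure. AE r in lborel. 0 < r \<longrightarrow> P (r *\<^sub>R \<omega>)"
  proof eventually_elim
    case (elim \<omega>)
    then have "AE r in lborel. indicator {0<..} r * (ennreal (r ^ (CARD('n) - 1)) * indicator N (r *\<^sub>R \<omega>)) = 0"
      by (subst (asm) nn_integral_0_iff_AE) auto
    then show ?case
      by eventually_elim (use N in \<open>auto simp: indicator_def split: if_splits\<close>)
  qed
qed

lemma integral_lborel_scaleR: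
  fixes f :: "real^'n::finite \<Rightarrow> 'b::{banach, second_countable_topology}"
  assumes [measurable]: "f \<in> borel_measurable borel" and c: "0 < c"
  shows "(LBINT x. f x) = (c ^ CARD('n)) *\<^sub>R (LBINT x. f (c *\<^sub>R x))"
proof -
  have "(LBINT x. f x) = (\<integral>x. f x \<partial>density (distr lborel borel (\<lambda>x. 0 + c *\<^sub>R x)) (\<lambda>_. ennreal (\<bar>c\<bar> ^ DIM(real^'n))))"
    using lborel_affine[of c "0::real^'n"] c by simp
  also have "\<dots> = (c ^ CARD('n)) *\<^sub>R (LBINT x. f (c *\<^sub>R x))"
    using c by (subst integral_density) (simp_all add: integral_distr)
  finally show ?thesis .
qed

lemma integrable_lborel_scaleR:
  fixes f :: "real^'n::finite \<Rightarrow> 'b::{banach, second_countable_topology}"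
  assumes f: "integrable lborel f" and c: "0 < c"
  shows "integrable lborel (\<lambda>x. f (c *\<^sub>R x))"
proof (rule integrableI_bounded)
  have [measurable]: "f \<in> borel_measurable borel" using f by auto
  show "(\<lambda>x. f (c *\<^sub>R x)) \<in> borel_measurable lborel" by measurable
  have "(\<integral>\<^sup>+x. ennreal (norm (f x)) \<partial>lborel) = ennreal (c ^ CARD('n)) * (\<integral>\<^sup>+x. ennreal (norm (f (c *\<^sub>R x))) \<partial>lborel)"
    by (rule nn_integral_lborel_scaleR) (use c in auto)
  moreover have "(\<integral>\<^sup>+x. ennreal (norm (f x)) \<partial>lborel) < \<infinity>"
    using f by (simp add: integrable_iff_bounded)
  ultimately show "(\<integral>\<^sup>+x. ennreal (norm (f (c *\<^sub>R x))) \<partial>lborel) < \<infinity>"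
    using c by (auto simp: ennreal_mult_less_top)
qed


section \<open>Spherical means of Borel functions\<close>

text \<open>
The counterpart of \<^const>\<open>spherical_mean\<close> for the measure without completion.
\<close>

definition sphere_mean :: "(real^'n::finite \<Rightarrow> complex) \<Rightarrow> real \<Rightarrow> complex" where
  "sphere_mean u r = (\<integral>\<omega>. u (r *\<^sub>R \<omega>) \<partial>sphere_measure) /\<^sub>R measure (sphere_measure :: (real^'n) measure) (sphere 0 1)"

lemma sphere_mean_measurable:
  fixes u :: "real^'n::finite \<Rightarrow> complex"
  assumes "u \<in> borel_measurable borel"
  shows "sphere_mean u \<in> borel_measurable borel"
proof -
  have "(\<lambda>r. \<integral>\<omega>. u (r *\<^sub>R \<omega>) \<partial>sphere_measure) \<in> borel_measurable borel"
    by (rule sphere_measure.borel_measurable_lebesgue_integral) (rule scaleR_sphere_measurable[OF assms])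
  then show ?thesis unfolding sphere_mean_def[abs_def] by measurable
qed

text \<open>
Cauchy and Schwarz against the constant 1. If the function is not integrable on the sphere, the mean is 0 by convention and
the inequality is trivial.
\<close>

lemma Jensen_sphere_mean:
  fixes u :: "real^'n::finite \<Rightarrow> complex"
  assumes [measurable]: "u \<in> borel_measurable borel"
  shows "ennreal ((norm (sphere_mean u r))\<^sup>2)
    \<le> ennreal (1 / measure (sphere_measure :: (real^'n) measure) (sphere 0 1)) * square_integral sphere_measure (\<lambda>\<omega>. u (r *\<^sub>R \<omega>))"
proof -
  let ?M = "sphere_measure :: (real^'n) measure"
  define S where "S = measure ?M (sphere 0 1)"
  have S: "0 < S" using measure_sphere_measure_pos by (simp add: S_def)
  have [measurable]: "(\<lambda>\<omega>. u (r *\<^sub>R \<omega>)) \<in> borel_measurable ?M"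
    by (rule measurable_sphere_measure) measurable
  have "(ennreal (norm (\<integral>\<omega>. u (r *\<^sub>R \<omega>) \<partial>?M)))\<^sup>2 \<le> (\<integral>\<^sup>+\<omega>. ennreal (norm (u (r *\<^sub>R \<omega>))) * 1 \<partial>?M)\<^sup>2"
  proof (rule power_mono)
    show "ennreal (norm (\<integral>\<omega>. u (r *\<^sub>R \<omega>) \<partial>?M)) \<le> (\<integral>\<^sup>+\<omega>. ennreal (norm (u (r *\<^sub>R \<omega>))) * 1 \<partial>?M)"
      using integral_norm_bound_ennreal[of ?M "\<lambda>\<omega>. u (r *\<^sub>R \<omega>)"]
      by (cases "integrable ?M (\<lambda>\<omega>. u (r *\<^sub>R \<omega>))") (auto simp: not_integrable_integral_eq)
  qed simp
  also have "\<dots> \<le> (\<integral>\<^sup>+\<omega>. (ennreal (norm (u (r *\<^sub>R \<omega>))))\<^sup>2 \<partial>?M) * (\<integral>\<^sup>+\<omega>. 1\<^sup>2 \<partial>?M)"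
    by (rule Cauchy_Schwarz_nn_integral) measurable
  also have "(\<integral>\<^sup>+\<omega>. (ennreal (norm (u (r *\<^sub>R \<omega>))))\<^sup>2 \<partial>?M) = square_integral ?M (\<lambda>\<omega>. u (r *\<^sub>R \<omega>))"
    by (simp add: ennreal_power)
  also have "(\<integral>\<^sup>+\<omega>. 1\<^sup>2 \<partial>?M) = ennreal S"
    by (simp add: S_def sphere_measure.emeasure_eq_measure)
  finally have le: "(ennreal (norm (\<integral>\<omega>. u (r *\<^sub>R \<omega>) \<partial>?M)))\<^sup>2 \<le> square_integral ?M (\<lambda>\<omega>. u (r *\<^sub>R \<omega>)) * ennreal S" .
  have "ennreal ((norm (sphere_mean u r))\<^sup>2) = ennreal (1 / S\<^sup>2) * (ennreal (norm (\<integral>\<omega>. u (r *\<^sub>R \<omega>) \<partial>?M)))\<^sup>2"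
    using S by (simp add: sphere_mean_def S_def[symmetric] ennreal_power ennreal_mult'[symmetric] power_mult_distrib power_inverse divide_inverse)
  also have "\<dots> \<le> ennreal (1 / S\<^sup>2) * ((square_integral ?M (\<lambda>\<omega>. u (r *\<^sub>R \<omega>))) * ennreal S)"
    by (rule mult_left_mono[OF le]) simp
  also have "\<dots> = (ennreal (1 / S\<^sup>2) * ennreal S) * square_integral ?M (\<lambda>\<omega>. u (r *\<^sub>R \<omega>))"
    by (simp only: mult_ac)
  also have "ennreal (1 / S\<^sup>2) * ennreal S = ennreal (1 / S)"
    using S by (simp add: ennreal_mult'[symmetric] power2_eq_square)
  finally show ?thesis by (simp only: S_def)
qed

lemma sphere_mean_L2:
  fixes u :: "real^'n::finite \<Rightarrow> complex"
  assumes [measurable]: "u \<in> borel_measurable borel"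
  shows "(\<integral>\<^sub>0r. ennreal (r ^ (CARD('n) - 1) * (norm (sphere_mean u r))\<^sup>2))
    \<le> ennreal (1 / measure (sphere_measure :: (real^'n) measure) (sphere 0 1)) * square_integral lborel u"
proof -
  let ?c = "ennreal (1 / measure (sphere_measure :: (real^'n) measure) (sphere 0 1))"
  have [measurable]: "(\<lambda>r. square_integral sphere_measure (\<lambda>\<omega>. u (r *\<^sub>R \<omega>))) \<in> borel_measurable borel"
    by (rule borel_measurable_sphere_nn_integral) measurable
  have "(\<integral>\<^sub>0r. ennreal (r ^ (CARD('n) - 1) * (norm (sphere_mean u r))\<^sup>2))
    \<le> (\<integral>\<^sup>+r. ?c * (indicator {0<..} r * (ennreal (r ^ (CARD('n) - 1)) * square_integral sphere_measure (\<lambda>\<omega>. u (r *\<^sub>R \<omega>)))) \<partial>lborel)"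
  proof (rule nn_integral_mono)
    fix r :: real
    show "indicator {0<..} r * ennreal (r ^ (CARD('n) - 1) * (norm (sphere_mean u r))\<^sup>2)
      \<le> ?c * (indicator {0<..} r * (ennreal (r ^ (CARD('n) - 1)) * square_integral sphere_measure (\<lambda>\<omega>. u (r *\<^sub>R \<omega>))))"
    proof (cases "0 < r")
      case True
      have "ennreal (r ^ (CARD('n) - 1) * (norm (sphere_mean u r))\<^sup>2) = ennreal (r ^ (CARD('n) - 1)) * ennreal ((norm (sphere_mean u r))\<^sup>2)"
        by (rule ennreal_mult') (use True in simp)
      also have "\<dots> \<le> ennreal (r ^ (CARD('n) - 1)) * (?c * square_integral sphere_measure (\<lambda>\<omega>. u (r *\<^sub>R \<omega>)))"
        by (intro mult_left_mono Jensen_sphere_mean) auto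
      finally show ?thesis using True by (simp add: mult_ac)
    qed simp
  qed
  also have "\<dots> = ?c * (\<integral>\<^sub>0r. (ennreal (r ^ (CARD('n) - 1)) * square_integral sphere_measure (\<lambda>\<omega>. u (r *\<^sub>R \<omega>))))"
    by (rule nn_integral_cmult) measurable
  also have "\<dots> = ?c * square_integral lborel u"
  proof -
    have "(square_integral lborel u)
      = (\<integral>\<^sub>0r. (ennreal (r ^ (CARD('n) - 1)) * square_integral sphere_measure (\<lambda>\<omega>. u (r *\<^sub>R \<omega>))))"
      by (rule nn_integral_polar) measurable
    then show ?thesis by (simp only:)
  qed
  finally show ?thesis .
qed

lemma AE_sphere_square_integrable:
  fixes u :: "real^'n::finite \<Rightarrow> complex"
  assumes [measurable]: "u \<in> borel_measurable borel"
    and u: "square_integral lborel u < \<infinity>"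
  shows "AE r in lborel. 0 < r \<longrightarrow> square_integral sphere_measure (\<lambda>\<omega>. u (r *\<^sub>R \<omega>)) < \<infinity>"
proof -
  have [measurable]: "(\<lambda>r. square_integral sphere_measure (\<lambda>\<omega>. u (r *\<^sub>R \<omega>))) \<in> borel_measurable borel"
    by (rule borel_measurable_sphere_nn_integral) measurable
  have "(square_integral lborel u)
    = (\<integral>\<^sub>0r. (ennreal (r ^ (CARD('n) - 1)) * square_integral sphere_measure (\<lambda>\<omega>. u (r *\<^sub>R \<omega>))))"
    by (rule nn_integral_polar) measurable
  with u have "AE r in lborel. indicator {0<..} r * (ennreal (r ^ (CARD('n) - 1)) * square_integral sphere_measure (\<lambda>\<omega>. u (r *\<^sub>R \<omega>))) \<noteq> \<infinity>"
    by (intro nn_integral_PInf_AE) auto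
  then show ?thesis
  proof eventually_elim
    case (elim r)
    show ?case
    proof
      assume r: "0 < r"
      then have "ennreal (r ^ (CARD('n) - 1)) \<noteq> 0" by simp
      with elim r show "(square_integral sphere_measure (\<lambda>\<omega>. u (r *\<^sub>R \<omega>))) < \<infinity>"
        by (auto simp: ennreal_mult_eq_top_iff less_top)
    qed
  qed
qed

lemma integrable_sphere_of_square:
  fixes u :: "real^'n::finite \<Rightarrow> complex"
  assumes [measurable]: "u \<in> borel_measurable borel"
    and "(square_integral sphere_measure (\<lambda>\<omega>. u (r *\<^sub>R \<omega>))) < \<infinity>"
  shows "integrable sphere_measure (\<lambda>\<omega>. u (r *\<^sub>R \<omega>))"
proof -
  have [measurable]: "(\<lambda>\<omega>. u (r *\<^sub>R \<omega>)) \<in> borel_measurable sphere_measure"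
    by (rule measurable_sphere_measure) measurable
  show ?thesis
    by (rule sphere_measure.square_integrable_imp_integrable)
      (use assms(2) in \<open>auto intro!: integrableI_bounded simp: norm_power\<close>)
qed


section \<open>Smooth bumps and the fundamental lemma of the calculus of variations\<close>

text \<open>
Differentiability is counted, rather than asking for an infinite sequence of derivatives, so that closure under products is
an induction on the order.
\<close>

primrec times_differentiable :: "nat \<Rightarrow> (real \<Rightarrow> real) \<Rightarrow> bool" where
  "times_differentiable 0 f \<longleftrightarrow> True"
| "times_differentiable (Suc k) f \<longleftrightarrow>
    (\<exists>f'. (\<forall>x. (f has_real_derivative f' x) (at x)) \<and> times_differentiable k f')"

definition smooth :: "(real \<Rightarrow> real) \<Rightarrow> bool" where
  "smooth f \<longleftrightarrow> (\<forall>k. times_differentiable k f)"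

lemma times_differentiable_SucD: "times_differentiable (Suc k) f \<Longrightarrow> times_differentiable k f"
proof (induction k arbitrary: f)
  case (Suc k)
  from Suc.prems obtain f' where f': "\<forall>x. (f has_real_derivative f' x) (at x)" "times_differentiable (Suc k) f'"
    unfolding times_differentiable.simps(2)[of "Suc k"] by blast
  from f' Suc.IH[OF f'(2)] show ?case by auto
qed simp

lemma smooth_deriv:
  assumes "smooth f"
  shows "(f has_real_derivative deriv f x) (at x)" "smooth (deriv f)"
proof -
  have f': "\<exists>f'. (\<forall>x. (f has_real_derivative f' x) (at x)) \<and> times_differentiable k f'" for k
    using assms[unfolded smooth_def, rule_format, of "Suc k"] by simp
  then show "(f has_real_derivative deriv f x) (at x)"
    by (meson DERIV_deriv_iff_real_differentiable real_differentiable_def)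
  show "smooth (deriv f)"
    unfolding smooth_def
  proof
    fix k
    obtain f' where "\<forall>x. (f has_real_derivative f' x) (at x)" "times_differentiable k f'" using f'[of k] by blast
    moreover from this have "deriv f = f'" by (auto simp: DERIV_imp_deriv)
    ultimately show "times_differentiable k (deriv f)" by simp
  qed
qed

lemma smooth_coinduct:
  assumes f: "X f" and X: "\<And>f. X f \<Longrightarrow> \<exists>f'. (\<forall>x. (f has_real_derivative f' x) (at x)) \<and> X f'"
  shows "smooth f"
  unfolding smooth_def
proof
  show "times_differentiable k f" for k
    using f
  proof (induction k arbitrary: f)
    case (Suc k)
    then show ?case using X[of f] by auto
  qed simp
qed

lemma times_differentiable_add:
  "times_differentiable k f \<Longrightarrow> times_differentiable k g \<Longrightarrow> times_differentiable k (\<lambda>x. f x + g x)"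
proof (induction k arbitrary: f g)
  case (Suc k)
  from Suc.prems obtain f' g' where "\<forall>x. (f has_real_derivative f' x) (at x)" "times_differentiable k f'"
    "\<forall>x. (g has_real_derivative g' x) (at x)" "times_differentiable k g'" by auto
  then show ?case
    using Suc.IH[of f' g'] by (auto intro!: exI[of _ "\<lambda>x. f' x + g' x"] derivative_intros)
qed simp

lemma times_differentiable_mult:
  "times_differentiable k f \<Longrightarrow> times_differentiable k g \<Longrightarrow> times_differentiable k (\<lambda>x. f x * g x)"
proof (induction k arbitrary: f g)
  case (Suc k)
  from Suc.prems obtain f' g' where f': "\<forall>x. (f has_real_derivative f' x) (at x)" "times_differentiable k f'"
    and g': "\<forall>x. (g has_real_derivative g' x) (at x)" "times_differentiable k g'" by auto
  have "times_differentiable k (\<lambda>x. f' x * g x + g' x * f x)"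
    using Suc.IH times_differentiable_SucD[OF Suc.prems(1)] times_differentiable_SucD[OF Suc.prems(2)] f'(2) g'(2)
    by (intro times_differentiable_add) auto
  moreover have "((\<lambda>x. f x * g x) has_real_derivative f' x * g x + g' x * f x) (at x)" for x
    using f'(1) g'(1) by (auto intro!: derivative_eq_intros)
  ultimately show ?case
    unfolding times_differentiable.simps by (intro exI[of _ "\<lambda>x. f' x * g x + g' x * f x"]) auto
qed simp

lemma smooth_mult: "smooth f \<Longrightarrow> smooth g \<Longrightarrow> smooth (\<lambda>x. f x * g x)"
  by (simp add: smooth_def times_differentiable_mult)

lemma smooth_ident: "smooth (\<lambda>x. x)"
proof (rule smooth_coinduct[where X="\<lambda>f. (\<exists>c d. f = (\<lambda>x. c * x + d))"])
  show "\<exists>c d. (\<lambda>x. x) = (\<lambda>x::real. c * x + d)" by (rule exI[of _ 1], rule exI[of _ 0]) auto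
  fix f :: "real \<Rightarrow> real" assume "\<exists>c d. f = (\<lambda>x. c * x + d)"
  then obtain c d where f: "f = (\<lambda>x. c * x + d)" by blast
  have "(f has_real_derivative 0 * x + c) (at x)" for x
    unfolding f by (auto intro!: derivative_eq_intros)
  then show "\<exists>f'. (\<forall>x. (f has_real_derivative f' x) (at x)) \<and> (\<exists>c d. f' = (\<lambda>x. c * x + d))"
    by (intro exI[of _ "\<lambda>x. 0 * x + c"] conjI allI) (assumption, blast)
qed

lemma smooth_affine:
  assumes "smooth f"
  shows "smooth (\<lambda>x. f (c * x + d))"
proof (rule smooth_coinduct[where X="\<lambda>h. \<exists>g b. smooth g \<and> h = (\<lambda>x. b * g (c * x + d))"])
  show "\<exists>g b. smooth g \<and> (\<lambda>x. f (c * x + d)) = (\<lambda>x. b * g (c * x + d))"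
    using assms by (intro exI[of _ f] exI[of _ 1]) auto
  fix h assume "\<exists>g b. smooth g \<and> h = (\<lambda>x. b * g (c * x + d))"
  then obtain g b where g: "smooth g" and h: "h = (\<lambda>x. b * g (c * x + d))" by blast
  have "(h has_real_derivative (b * c) * deriv g (c * x + d)) (at x)" for x
  proof -
    have "((\<lambda>x. g (c * x + d)) has_real_derivative deriv g (c * x + d) * c) (at x)"
      by (rule DERIV_chain2[OF smooth_deriv(1)[OF g]]) (auto intro!: derivative_eq_intros)
    from DERIV_cmult[OF this, of b] show ?thesis unfolding h by (simp add: mult_ac)
  qed
  then show "\<exists>h'. (\<forall>x. (h has_real_derivative h' x) (at x)) \<and> (\<exists>g b. smooth g \<and> h' = (\<lambda>x. b * g (c * x + d)))"
    using smooth_deriv(2)[OF g] by (intro exI[of _ "\<lambda>x. (b * c) * deriv g (c * x + d)"]) auto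
qed

text \<open>
The standard smooth function that vanishes on the negative half line. It increases to 1 at infinity, so its dilations
converge to the indicator of the positive half line.
\<close>

definition flat_exp :: "real \<Rightarrow> real" where
  "flat_exp x = (if 0 < x then exp (- 1 / x) else 0)"

lemma poly_exp_tendsto_0: "((\<lambda>y::real. poly p y * exp (- y)) \<longlongrightarrow> 0) at_top"
proof -
  have "((\<lambda>y::real. \<Sum>i\<le>degree p. coeff p i * (y ^ i / exp y)) \<longlongrightarrow> (\<Sum>i\<le>degree p. coeff p i * 0)) at_top"
    by (intro tendsto_sum tendsto_mult tendsto_const tendsto_power_div_exp_0)
  then show ?thesis
    by (simp add: poly_altdef sum_distrib_left exp_minus divide_inverse mult_ac)
qed

text \<open>
The functions \<open>p (1 / x) exp (- 1 / x)\<close>, extended by 0, with a polynomial \<open>p\<close> are closed under differentiation: the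
derivative belongs to the polynomial \<open>X\<^sup>2 (p - p')\<close>. At the origin the difference quotient tends to 0 since the exponential
beats every power.
\<close>

lemma smooth_flat_exp: "smooth flat_exp"
proof (rule smooth_coinduct[where X="\<lambda>f. \<exists>p. f = (\<lambda>x. if 0 < x then poly p (1 / x) * exp (- 1 / x) else 0)"])
  show "\<exists>p. flat_exp = (\<lambda>x. if 0 < x then poly p (1 / x) * exp (- 1 / x) else 0)"
    by (rule exI[of _ 1]) (auto simp: flat_exp_def)
  fix f :: "real \<Rightarrow> real" assume "\<exists>p. f = (\<lambda>x. if 0 < x then poly p (1 / x) * exp (- 1 / x) else 0)"
  then obtain p where f: "f = (\<lambda>x. if 0 < x then poly p (1 / x) * exp (- 1 / x) else 0)" by blast
  define q where "q = [:0, 0, 1:] * (p - pderiv p)"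
  define f' where "f' x = (if 0 < x then poly q (1 / x) * exp (- 1 / x) else 0)" for x :: real
  have "(f has_real_derivative f' x) (at x)" for x
  proof -
    consider "0 < x" | "x < 0" | "x = 0" by linarith
    then show ?thesis
    proof cases
      case 1
      have d: "((\<lambda>x. poly p (1 / x) * exp (- 1 / x)) has_real_derivative f' x) (at x)"
      proof (rule DERIV_cong)
        show "((\<lambda>x. poly p (1 / x) * exp (- 1 / x)) has_real_derivative
          (poly (pderiv p) (1 / x) * (- 1 / x\<^sup>2)) * exp (- 1 / x) + (exp (- 1 / x) * (1 / x\<^sup>2)) * poly p (1 / x)) (at x)"
        proof (rule DERIV_mult)
          show "((\<lambda>x. poly p (1 / x)) has_real_derivative poly (pderiv p) (1 / x) * (- 1 / x\<^sup>2)) (at x)"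
            by (rule DERIV_chain2[OF poly_DERIV]) (use 1 in \<open>auto intro!: derivative_eq_intros simp: power2_eq_square\<close>)
          show "((\<lambda>x. exp (- 1 / x)) has_real_derivative exp (- 1 / x) * (1 / x\<^sup>2)) (at x)"
            by (rule DERIV_chain2[OF DERIV_exp]) (use 1 in \<open>auto intro!: derivative_eq_intros simp: power2_eq_square\<close>)
        qed
        show "(poly (pderiv p) (1 / x) * (- 1 / x\<^sup>2)) * exp (- 1 / x) + (exp (- 1 / x) * (1 / x\<^sup>2)) * poly p (1 / x) = f' x"
          using 1 by (simp add: f'_def q_def power2_eq_square algebra_simps)
      qed
      have ev: "eventually (\<lambda>y. f y = poly p (1 / y) * exp (- 1 / y)) (nhds x)"
        using eventually_nhds_in_open[of "{0<..}" x] 1 by (auto elim!: eventually_mono simp: f)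
      show ?thesis using DERIV_cong_ev[OF refl ev refl] d by simp
    next
      case 2
      have ev: "eventually (\<lambda>y. f y = 0) (nhds x)"
        using eventually_nhds_in_open[of "{..<0}" x] 2 by (auto elim!: eventually_mono simp: f)
      have d: "((\<lambda>y. 0) has_real_derivative f' x) (at x)" using 2 by (simp add: f'_def)
      show ?thesis using DERIV_cong_ev[OF refl ev refl] d by simp
    next
      case 3
      have lim: "((\<lambda>h. f h / h) \<longlongrightarrow> 0) (at 0)"
      proof (rule filterlim_split_at)
        have "((\<lambda>h. 0::real) \<longlongrightarrow> 0) (at_left 0)" by simp
        moreover have "eventually (\<lambda>h. 0 = f h / h) (at_left 0)"
          by (auto simp: eventually_at_filter f)
        ultimately show "((\<lambda>h. f h / h) \<longlongrightarrow> 0) (at_left 0)"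
          by (rule Lim_transform_eventually)
        have "((\<lambda>h. poly (pCons 0 p) (inverse h) * exp (- inverse h)) \<longlongrightarrow> 0) (at_right 0)"
          by (rule filterlim_compose[OF poly_exp_tendsto_0 filterlim_inverse_at_top_right])
        moreover have "eventually (\<lambda>h. poly (pCons 0 p) (inverse h) * exp (- inverse h) = f h / h) (at_right 0)"
          by (auto simp: eventually_at_filter f divide_inverse mult_ac)
        ultimately show "((\<lambda>h. f h / h) \<longlongrightarrow> 0) (at_right 0)"
          by (rule Lim_transform_eventually)
      qed
      have "f 0 = 0" "f' 0 = 0" by (auto simp: f f'_def)
      then show ?thesis using lim 3 by (simp add: DERIV_def)
    qed
  qed
  then show "\<exists>f'. (\<forall>x. (f has_real_derivative f' x) (at x)) \<and> (\<exists>p. f' = (\<lambda>x. if 0 < x then poly p (1 / x) * exp (- 1 / x) else 0))"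
    by (intro exI[of _ f']) (auto simp: f'_def[abs_def])
qed

text \<open>
Products of functions of one variable are closed under partial derivatives, under dilations and under multiplication by a
coordinate, and they suffice to approximate boxes; no other test functions are used.
\<close>

definition tensor :: "('n::finite \<Rightarrow> real \<Rightarrow> real) \<Rightarrow> real^'n \<Rightarrow> real" where
  "tensor f x = (\<Prod>i\<in>UNIV. f i (x $ i))"

lemma tensor_has_derivative:
  assumes "\<And>i. smooth (f i)"
  shows "(tensor f has_derivative (\<lambda>y. \<Sum>i\<in>UNIV. deriv (f i) (x $ i) * y $ i * (\<Prod>j\<in>UNIV - {i}. f j (x $ j)))) (at x)"
  unfolding tensor_def[abs_def]
proof (rule has_derivative_prod)
  fix i
  have "((\<lambda>x. f i (x $ i)) has_derivative (\<lambda>y. deriv (f i) (x $ i) * y $ i)) (at x)"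
    using has_derivative_compose[OF bounded_linear_imp_has_derivative[OF bounded_linear_vec_nth]
        smooth_deriv(1)[OF assms, unfolded has_field_derivative_def]] .
  then show "((\<lambda>x. f i (x $ i)) has_derivative (\<lambda>y. deriv (f i) (x $ i) * y $ i)) (at x)" .
qed

lemma partial_deriv_tensor:
  assumes "\<And>i. smooth (f i)"
  shows "partial_deriv i (tensor f) = tensor (f(i := deriv (f i)))"
proof
  fix x
  have "partial_deriv i (tensor f) x = (\<Sum>k\<in>UNIV. deriv (f k) (x $ k) * axis i 1 $ k * (\<Prod>j\<in>UNIV - {k}. f j (x $ j)))"
    unfolding partial_deriv_def frechet_derivative_at[OF tensor_has_derivative[OF assms], symmetric] ..
  also have "\<dots> = (\<Sum>k\<in>UNIV. if k = i then deriv (f i) (x $ i) * (\<Prod>j\<in>UNIV - {i}. f j (x $ j)) else 0)"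
    by (intro sum.cong) (auto simp: axis_def)
  also have "\<dots> = deriv (f i) (x $ i) * (\<Prod>j\<in>UNIV - {i}. f j (x $ j))"
    by simp
  also have "\<dots> = tensor (f(i := deriv (f i))) x"
    unfolding tensor_def by (subst prod.remove[of UNIV i]) auto
  finally show "partial_deriv i (tensor f) x = tensor (f(i := deriv (f i))) x" .
qed

lemma tensor_continuous:
  assumes "\<And>i. smooth (f i)"
  shows "continuous_on S (tensor f)"
  by (rule continuous_at_imp_continuous_on) (auto intro!: has_derivative_continuous tensor_has_derivative assms)

lemma tensor_C_diff: "(\<And>i. smooth (f i)) \<Longrightarrow> C_diff k (tensor f)"
proof (induction k arbitrary: f)
  case 0
  then show ?case by (simp add: tensor_continuous)
next
  case (Suc k)
  have "C_diff k (tensor (f(i := deriv (f i))))" for i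
    by (rule Suc.IH) (simp add: Suc.prems smooth_deriv(2))
  then show ?case
    using tensor_has_derivative[of f, OF Suc.prems] partial_deriv_tensor[of f, OF Suc.prems]
    by (auto intro: differentiableI)
qed

definition bump_family :: "('n::finite \<Rightarrow> real \<Rightarrow> real) \<Rightarrow> real \<Rightarrow> bool" where
  "bump_family f R \<longleftrightarrow> (\<forall>i. smooth (f i)) \<and> (\<forall>i t. R < \<bar>t\<bar> \<longrightarrow> f i t = 0)"

lemma tensor_support:
  assumes "bump_family f R" "tensor f x \<noteq> 0"
  shows "\<bar>x $ i\<bar> \<le> R"
  using assms by (force simp: bump_family_def tensor_def not_less[symmetric])

lemma norm_le_card_mult:
  fixes x :: "real^'n::finite"
  assumes "\<And>i. \<bar>x $ i\<bar> \<le> R"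
  shows "norm x \<le> real CARD('n) * R"
proof -
  have "norm x \<le> (\<Sum>i\<in>UNIV. \<bar>x $ i\<bar>)" by (rule norm_le_l1_cart)
  also have "\<dots> \<le> real CARD('n) * R" by (rule sum_bounded_above) (use assms in auto)
  finally show ?thesis .
qed

lemma test_function_tensor:
  assumes f: "bump_family f R"
  shows "test_function (tensor (f :: 'n::finite \<Rightarrow> _))"
proof -
  have "{x. tensor f x \<noteq> 0} \<subseteq> cball 0 (real CARD('n) * R)"
    using norm_le_card_mult tensor_support[OF f] by fastforce
  then have "bounded {x. tensor f x \<noteq> 0}" by (rule bounded_subset[OF bounded_cball])
  moreover have "smooth (f i)" for i using f by (simp add: bump_family_def)
  ultimately show ?thesis
    by (auto simp: test_function_def tensor_C_diff compact_closure)
qed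

definition interval_bump :: "nat \<Rightarrow> real \<Rightarrow> real \<Rightarrow> real \<Rightarrow> real" where
  "interval_bump m a b t = flat_exp (real m * t - real m * a) * flat_exp (real m * b - real m * t)"

lemma flat_exp_bounds: "0 \<le> flat_exp x" "flat_exp x \<le> 1"
  by (auto simp: flat_exp_def)

lemma interval_bump_bounds: "0 \<le> interval_bump m a b t" "interval_bump m a b t \<le> 1"
  using flat_exp_bounds by (auto simp: interval_bump_def intro!: mult_nonneg_nonneg mult_le_one)

lemma interval_bump_support: "\<bar>a\<bar> \<le> R \<Longrightarrow> \<bar>b\<bar> \<le> R \<Longrightarrow> R < \<bar>t\<bar> \<Longrightarrow> interval_bump m a b t = 0"
  by (auto simp: interval_bump_def flat_exp_def zero_less_mult_iff right_diff_distrib[symmetric])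

lemma smooth_interval_bump: "smooth (interval_bump m a b)"
proof -
  have "smooth (\<lambda>t. flat_exp (real m * t + (- real m * a)) * flat_exp ((- real m) * t + real m * b))"
    by (intro smooth_mult smooth_affine smooth_flat_exp)
  then show ?thesis by (simp add: interval_bump_def[abs_def])
qed

lemma flat_exp_dilation_tendsto: "(\<lambda>m. flat_exp (real m * x)) \<longlonglongrightarrow> indicator {0<..} x"
proof (cases "0 < x")
  case True
  have "filterlim (\<lambda>m. real m * x) at_top sequentially"
    using True by (intro filterlim_at_top_mult_tendsto_pos[OF tendsto_const] filterlim_real_sequentially)
  then have "filterlim (\<lambda>m. real m * x) at_infinity sequentially"
    by (rule filterlim_at_top_imp_at_infinity)
  then have "(\<lambda>m. - 1 / (real m * x)) \<longlonglongrightarrow> 0"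
    by (rule tendsto_divide_0[OF tendsto_const])
  then have lim: "(\<lambda>m. exp (- 1 / (real m * x))) \<longlonglongrightarrow> exp 0"
    by (rule tendsto_exp)
  have "eventually (\<lambda>m. exp (- 1 / (real m * x)) = flat_exp (real m * x)) sequentially"
    using eventually_gt_at_top[of 0] by eventually_elim (use True in \<open>simp add: flat_exp_def\<close>)
  from Lim_transform_eventually[OF lim this] show ?thesis using True by simp
next
  case False
  then have "flat_exp (real m * x) = 0" for m by (simp add: flat_exp_def zero_less_mult_iff)
  then show ?thesis using False by simp
qed

lemma interval_bump_tendsto: "(\<lambda>m. interval_bump m a b t) \<longlonglongrightarrow> indicator {a<..<b} t"
proof -
  have "(\<lambda>m. flat_exp (real m * (t - a)) * flat_exp (real m * (b - t))) \<longlonglongrightarrow> indicator {0<..} (t - a) * indicator {0<..} (b - t)"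
    by (intro tendsto_mult flat_exp_dilation_tendsto)
  moreover have "indicator {0<..} (t - a) * indicator {0<..} (b - t) = (indicator {a<..<b} t :: real)"
    by (auto simp: indicator_def)
  ultimately show ?thesis by (simp add: interval_bump_def right_diff_distrib)
qed

definition box_bump :: "nat \<Rightarrow> real^'n::finite \<Rightarrow> real^'n \<Rightarrow> 'n \<Rightarrow> real \<Rightarrow> real" where
  "box_bump m a b i = interval_bump m (a $ i) (b $ i)"

lemma bump_family_box_bump: "bump_family (box_bump m a b) (max (norm a) (norm b))"
  unfolding bump_family_def box_bump_def
  using component_le_norm_cart[of a] component_le_norm_cart[of b]
  by (auto simp: smooth_interval_bump intro!: interval_bump_support[where R="max (norm a) (norm b)"] simp: le_max_iff_disj)

lemma tensor_box_bump_bounds: "0 \<le> tensor (box_bump m a b) x" "tensor (box_bump m a b) x \<le> 1"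
  by (auto simp: tensor_def box_bump_def interval_bump_bounds intro!: prod_nonneg prod_le_1)

lemma tensor_box_bump_tendsto:
  fixes a :: "real^'n::finite"
  shows "(\<lambda>m. tensor (box_bump m a b) x) \<longlonglongrightarrow> indicator (box a b) x"
proof -
  have "(\<lambda>m. \<Prod>i\<in>UNIV. interval_bump m (a $ i) (b $ i) (x $ i)) \<longlonglongrightarrow> (\<Prod>i\<in>UNIV. indicator {a $ i<..<b $ i} (x $ i))"
    by (intro tendsto_prod interval_bump_tendsto)
  moreover have "(\<Prod>i\<in>UNIV. indicator {a $ i<..<b $ i} (x $ i)) = (indicator (box a b) x :: real)"
  proof (cases "x \<in> box a b")
    case True
    then show ?thesis by (simp add: mem_box_cart)
  next
    case False
    then obtain i where "\<not> (a $ i < x $ i \<and> x $ i < b $ i)" by (auto simp: mem_box_cart)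
    then have "(\<Prod>i\<in>UNIV. indicator {a $ i<..<b $ i} (x $ i)) = (0 :: real)"
      by (intro prod_zero bexI[of _ i]) auto
    with False show ?thesis by simp
  qed
  ultimately show ?thesis by (simp add: tensor_def box_bump_def)
qed

text \<open>
Boxes are closed under intersection and generate the Borel sets, so by Dynkin the integral vanishes over all Borel
subsets of a fixed box; countably many boxes cover the space.
\<close>

lemma AE_zero_of_integral_box_zero:
  fixes w :: "'a::euclidean_space \<Rightarrow> 'b::{banach, second_countable_topology}"
  assumes int: "\<And>a b. set_integrable lborel (box a b) w"
    and zero: "\<And>a b. (LBINT x:box a b. w x) = 0"
  shows "AE x in lborel. w x = 0"
proof -
  have "AE x in lborel. indicator (box a b) x *\<^sub>R w x = 0" for a b :: 'a
  proof (rule sigma_finite_measure.density_zero[OF lborel.sigma_finite_measure_axioms])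
    let ?w = "\<lambda>x. indicator (box a b) x *\<^sub>R w x"
    show int_w: "integrable lborel ?w"
      using int[of a b] by (simp add: set_integrable_def)
    fix A :: "'a set" assume A: "A \<in> sets lborel"
    have "Int_stable (range (\<lambda>(a, b). box a b :: 'a set))"
      by (auto simp: Int_stable_def box_Int_box)
    moreover have "(range (\<lambda>(a, b). box a b)) \<subseteq> Pow (UNIV :: 'a set)" by auto
    moreover have "A \<in> sigma_sets UNIV (range (\<lambda>(a, b). box a b))"
      using A unfolding sets_lborel borel_eq_box by simp
    ultimately show "(LBINT x:A. ?w x) = 0"
    proof (induction rule: sigma_sets_induct_disjoint)
      case (basic B)
      then obtain c d where "B = box c d" by auto
      then have "(LBINT x:B. ?w x) = (LBINT x. indicator (box c d \<inter> box a b) x *\<^sub>R w x)"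
        by (auto simp: set_lebesgue_integral_def indicator_inter_arith intro!: Bochner_Integration.integral_cong)
      also have "\<dots> = 0"
        using zero by (simp add: box_Int_box set_lebesgue_integral_def)
      finally show ?case .
    next
      case empty
      then show ?case by (simp add: set_lebesgue_integral_def)
    next
      case (compl B)
      have B: "B \<in> sets borel" unfolding borel_eq_box using compl(1) by simp
      then have [measurable]: "B \<in> sets lborel" by simp
      have "(LBINT x:UNIV - B. ?w x) = (LBINT x. ?w x - indicator B x *\<^sub>R ?w x)"
        unfolding set_lebesgue_integral_def
        by (intro Bochner_Integration.integral_cong) (auto simp: indicator_def)
      also have "\<dots> = (LBINT x. ?w x) - (LBINT x:B. ?w x)"
        unfolding set_lebesgue_integral_def
        by (intro Bochner_Integration.integral_diff int_w integrable_mult_indicator) (use B in auto)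
      also have "\<dots> = 0"
        using zero[of a b] compl by (simp add: set_lebesgue_integral_def)
      finally show ?case .
    next
      case (union F)
      then have F: "\<And>i. F i \<in> sets lborel" by (auto simp: borel_eq_box)
      have "(LBINT x:(\<Union>i. F i). ?w x) = (\<Sum>i. (LBINT x:F i. ?w x))"
      proof (rule lebesgue_integral_countable_add)
        show "set_integrable lborel (\<Union>i. F i) ?w"
          unfolding set_integrable_def
          by (intro integrable_mult_indicator int_w) (use F in auto)
      qed (use F union(1) in \<open>auto simp: disjoint_family_on_def\<close>)
      then show ?case using union by simp
    qed
  qed
  then have "AE x in lborel. \<forall>k::nat. indicator (box (- real k *\<^sub>R One) (real k *\<^sub>R One)) x *\<^sub>R w x = 0"
    unfolding AE_all_countable by blast
  then show ?thesis
  proof eventually_elim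
    case (elim x)
    have "x \<in> (\<Union>k::nat. box (- real k *\<^sub>R One) (real k *\<^sub>R One))"
      using UN_box_eq_UNIV by auto
    then obtain k :: nat where "x \<in> box (- real k *\<^sub>R One) (real k *\<^sub>R One)" by blast
    with elim[rule_format, of k] show ?case by (auto simp: indicator_def)
  qed
qed

text \<open>
Products of interval bumps are bounded by 1 and converge to the indicator of a box; dominated convergence reduces the claim
to integrals over boxes.
\<close>

theorem fundamental_lemma:
  fixes w :: "real^'n::finite \<Rightarrow> complex"
  assumes int: "\<And>R. set_integrable lborel (cball 0 R) w"
    and zero: "\<And>f R. bump_family f R \<Longrightarrow> (\<And>x. \<bar>tensor f x\<bar> \<le> 1) \<Longrightarrow> (LBINT x. w x * of_real (tensor f x)) = 0"
  shows "AE x in lborel. w x = 0"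
proof (rule AE_zero_of_integral_box_zero)
  fix a b :: "real^'n"
  \<comment> \<open>The supports are controlled coordinatewise; the factor passes from the maximum norm to the Euclidean norm.\<close>
  define R where "R = real CARD('n) * max (norm a) (norm b)"
  have box: "box a b \<subseteq> cball 0 R"
  proof
    fix x assume x: "x \<in> box a b"
    have "\<bar>x $ i\<bar> \<le> max (norm a) (norm b)" for i
    proof -
      have "a $ i < x $ i" "x $ i < b $ i" using x by (auto simp: mem_box_cart)
      then show ?thesis
        using component_le_norm_cart[of a i] component_le_norm_cart[of b i] by linarith
    qed
    then show "x \<in> cball 0 R" using norm_le_card_mult[of x] by (simp add: R_def)
  qed
  show "set_integrable lborel (box a b) w"
    by (rule set_integrable_subset[OF int _ box]) auto
  have ind: "tensor (box_bump m a b) x = 0" if "x \<notin> cball 0 R" for m x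
    using norm_le_card_mult[of x "max (norm a) (norm b)"] tensor_support[OF bump_family_box_bump, of m a b x] that
    by (auto simp: R_def)
  define W where "W x = indicator (cball 0 R) x *\<^sub>R w x" for x
  have W: "integrable lborel W"
    using int[of R] by (simp add: W_def[abs_def] set_integrable_def)
  then have [measurable]: "W \<in> borel_measurable borel" by auto
  have [measurable]: "tensor (box_bump m a b) \<in> borel_measurable borel" for m
    by (intro borel_measurable_continuous_onI tensor_continuous) (simp add: box_bump_def smooth_interval_bump)
  have "(\<lambda>m. \<integral>x. W x * of_real (tensor (box_bump m a b) x) \<partial>lborel) \<longlonglongrightarrow> (LBINT x. W x * of_real (indicator (box a b) x))"
  proof (rule integral_dominated_convergence[where w="\<lambda>x. norm (W x)"])
    show "integrable lborel (\<lambda>x. norm (W x))" using W by simp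
    show "AE x in lborel. (\<lambda>m. W x * of_real (tensor (box_bump m a b) x)) \<longlonglongrightarrow> W x * of_real (indicator (box a b) x)"
      by (intro AE_I2 tendsto_mult tendsto_const tendsto_of_real tensor_box_bump_tendsto)
    show "AE x in lborel. norm (W x * of_real (tensor (box_bump m a b) x)) \<le> norm (W x)" for m
      by (intro AE_I2) (auto simp: norm_mult tensor_box_bump_bounds abs_of_nonneg intro!: mult_left_le)
  qed (measurable)
  moreover have "(LBINT x. W x * of_real (tensor (box_bump m a b) x)) = 0" for m
  proof -
    have "(LBINT x. W x * of_real (tensor (box_bump m a b) x)) = (LBINT x. w x * of_real (tensor (box_bump m a b) x))"
      using ind by (intro Bochner_Integration.integral_cong) (auto simp: W_def indicator_def)
    then show ?thesis
      using zero[OF bump_family_box_bump] by (simp add: abs_of_nonneg tensor_box_bump_bounds)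
  qed
  ultimately have "(LBINT x. W x * of_real (indicator (box a b) x)) = 0"
    using LIMSEQ_unique[OF _ tendsto_const] by auto
  moreover have "(LBINT x. W x * of_real (indicator (box a b) x)) = (LBINT x:box a b. w x)"
    unfolding set_lebesgue_integral_def
    by (intro Bochner_Integration.integral_cong) (use box in \<open>auto simp: W_def indicator_def\<close>)
  ultimately show "(LBINT x:box a b. w x) = 0" by simp
qed


section \<open>Weak gradients and dilations\<close>

lemma integrable_mult_compact_support:
  fixes u :: "'a::euclidean_space \<Rightarrow> complex"
  assumes u: "set_integrable lborel (cball 0 R) u"
    and cont: "continuous_on UNIV \<phi>" and supp: "\<And>x. R < norm x \<Longrightarrow> \<phi> x = 0"
  shows "integrable lborel (\<lambda>x. u x * of_real (\<phi> x))"
proof -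
  have "bounded (\<phi> ` cball 0 R)"
    by (intro compact_imp_bounded compact_continuous_image continuous_on_subset[OF cont]) auto
  then obtain C where C: "0 < C" "\<And>x. x \<in> cball 0 R \<Longrightarrow> \<bar>\<phi> x\<bar> \<le> C"
    unfolding bounded_pos by (metis imageI real_norm_def)
  have [measurable]: "\<phi> \<in> borel_measurable borel"
    by (rule borel_measurable_continuous_onI[OF cont])
  have i: "integrable lborel (\<lambda>x. indicator (cball 0 R) x *\<^sub>R u x)"
    using u by (simp add: set_integrable_def)
  have "integrable lborel (\<lambda>x. (indicator (cball 0 R) x *\<^sub>R u x) * of_real (\<phi> x))"
  proof (rule Bochner_Integration.integrable_bound)
    show "integrable lborel (\<lambda>x. C *\<^sub>R (indicator (cball 0 R) x *\<^sub>R u x))"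
      using i by (rule Bochner_Integration.integrable_scaleR_right)
    show "(\<lambda>x. (indicator (cball 0 R) x *\<^sub>R u x) * of_real (\<phi> x)) \<in> borel_measurable lborel"
      by (intro borel_measurable_times borel_measurable_integrable[OF i]) simp
    show "AE x in lborel. norm ((indicator (cball 0 R) x *\<^sub>R u x) * of_real (\<phi> x)) \<le> norm (C *\<^sub>R (indicator (cball 0 R) x *\<^sub>R u x))"
    proof (rule AE_I2)
      fix x
      show "norm ((indicator (cball 0 R) x *\<^sub>R u x) * of_real (\<phi> x)) \<le> norm (C *\<^sub>R (indicator (cball 0 R) x *\<^sub>R u x))"
        using C(1) C(2)[of x] mult_left_mono[of "\<bar>\<phi> x\<bar>" C "norm (u x)"]
        by (auto simp: indicator_def norm_mult mult.commute)
    qed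
  qed
  moreover have "(indicator (cball 0 R) x *\<^sub>R u x) * of_real (\<phi> x) = u x * of_real (\<phi> x)" for x
    using supp[of x] by (auto simp: indicator_def not_le)
  ultimately show ?thesis by simp
qed

text \<open>
For \<open>\<phi> = tensor f\<close> this is the divergence of \<open>z \<phi> z\<close>, that is \<open>n \<phi> z + z \<bullet> \<nabla>\<phi> z\<close>. It governs the
derivative of the dilated function \<open>s^(-n) \<phi> (y / s)\<close> in \<open>s\<close>.
\<close>

definition dilation_generator :: "('n::finite \<Rightarrow> real \<Rightarrow> real) \<Rightarrow> real^'n \<Rightarrow> real" where
  "dilation_generator f z = (\<Sum>i\<in>UNIV. tensor f z + z $ i * tensor (f(i := deriv (f i))) z)"

lemma bump_familyD:
  assumes "bump_family f R"
  shows "smooth (f i)" "smooth ((f(j := deriv (f j))) i)"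
  using assms smooth_deriv(2) by (auto simp: bump_family_def)

lemma bump_family_deriv:
  assumes "bump_family f R"
  shows "bump_family (f(i := deriv (f i))) R"
proof -
  have "deriv (f i) t = 0" if "R < \<bar>t\<bar>" for t
  proof -
    have "open {t. R < \<bar>t\<bar>}" by (intro open_Collect_less continuous_intros)
    then have ev: "eventually (\<lambda>t. f i t = 0) (nhds t)"
      using eventually_nhds_in_open[of "{t. R < \<bar>t\<bar>}" t] that assms
      by (auto elim!: eventually_mono simp: bump_family_def)
    then have "(f i has_real_derivative 0) (at t)"
      using DERIV_cong_ev[OF refl ev refl] by simp
    then show ?thesis by (rule DERIV_imp_deriv)
  qed
  then show ?thesis
    using assms bump_familyD(2)[OF assms] by (auto simp: bump_family_def)
qed

lemma tensor_zero_outside: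
  assumes "bump_family (f :: 'n::finite \<Rightarrow> _) R" "real CARD('n) * R < norm x"
  shows "tensor f x = 0"
  using tensor_support[OF assms(1), of x] norm_le_card_mult[of x R] assms(2) by fastforce

lemma dilation_generator_continuous:
  assumes "bump_family f R"
  shows "continuous_on S (dilation_generator f)"
  unfolding dilation_generator_def[abs_def]
  by (intro continuous_intros tensor_continuous bump_familyD[OF assms])

lemma dilation_generator_zero_outside:
  assumes "bump_family (f :: 'n::finite \<Rightarrow> _) R" "real CARD('n) * R < norm x"
  shows "dilation_generator f x = 0"
  using tensor_zero_outside[OF assms] tensor_zero_outside[OF bump_family_deriv[OF assms(1)] assms(2)]
  by (simp add: dilation_generator_def)

lemma tensor_dilation_FTC:
  fixes f :: "'n::finite \<Rightarrow> real \<Rightarrow> real"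
  assumes f: "bump_family f R" and l: "1 \<le> l"
  shows "tensor f (y /\<^sub>R l) / l ^ CARD('n) - tensor f y =
    - (LBINT s. indicator {1..l} s * (dilation_generator f (y /\<^sub>R s) / s ^ (CARD('n) + 1)))"
proof -
  let ?n = "CARD('n)"
  have deriv: "((\<lambda>s. tensor f (y /\<^sub>R s) / s ^ ?n) has_real_derivative
      - (dilation_generator f (y /\<^sub>R s) / s ^ (?n + 1))) (at s)" if s: "0 < s" for s
  proof -
    \<comment> \<open>\<open>T\<close> is the Euler derivative of the bump at \<open>y / s\<close>.\<close>
    define T where "T = (\<Sum>i\<in>UNIV. (y /\<^sub>R s) $ i * tensor (f(i := deriv (f i))) (y /\<^sub>R s))"
    have path: "((\<lambda>s. y /\<^sub>R s) has_derivative (\<lambda>t. (- (t / s\<^sup>2)) *\<^sub>R y)) (at s)"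
      using s by (auto intro!: derivative_eq_intros simp: power2_eq_square divide_inverse)
    have part: "(deriv (f i) ((y /\<^sub>R s) $ i) * ((- (t / s\<^sup>2)) *\<^sub>R y) $ i * (\<Prod>j\<in>UNIV - {i}. f j ((y /\<^sub>R s) $ j)))
      = (- t / s) * ((y /\<^sub>R s) $ i * tensor (f(i := deriv (f i))) (y /\<^sub>R s))" for i t
    proof -
      have "tensor (f(i := deriv (f i))) (y /\<^sub>R s) = deriv (f i) ((y /\<^sub>R s) $ i) * (\<Prod>j\<in>UNIV - {i}. f j ((y /\<^sub>R s) $ j))"
        unfolding tensor_def by (subst prod.remove[of UNIV i]) auto
      then show ?thesis using s by (simp add: power2_eq_square divide_inverse)
    qed
    have "((\<lambda>s. tensor f (y /\<^sub>R s)) has_derivative (\<lambda>t. \<Sum>i\<in>UNIV. deriv (f i) ((y /\<^sub>R s) $ i) * ((- (t / s\<^sup>2)) *\<^sub>R y) $ i * (\<Prod>j\<in>UNIV - {i}. f j ((y /\<^sub>R s) $ j)))) (at s)"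
      by (rule has_derivative_compose[OF path tensor_has_derivative]) (rule bump_familyD[OF f])
    then have "((\<lambda>s. tensor f (y /\<^sub>R s)) has_derivative (\<lambda>t. (- t / s) * T)) (at s)"
      unfolding part T_def by (simp only: sum_distrib_left)
    then have d1: "((\<lambda>s. tensor f (y /\<^sub>R s)) has_real_derivative - T / s) (at s)"
      unfolding has_field_derivative_def by (rule has_derivative_eq_rhs) (auto simp: fun_eq_iff)
    have d2: "((\<lambda>s. s ^ ?n) has_real_derivative real ?n * s ^ (?n - 1)) (at s)"
      using DERIV_pow[of ?n s UNIV] by simp
    have T: "dilation_generator f (y /\<^sub>R s) = real ?n * tensor f (y /\<^sub>R s) + T"
      by (simp add: dilation_generator_def T_def sum.distrib)
    obtain m where m: "?n = Suc m" using gr0_implies_Suc[of ?n] by auto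
    show ?thesis
    proof (rule DERIV_cong)
      show "((\<lambda>s. tensor f (y /\<^sub>R s) / s ^ ?n) has_real_derivative
          ((- T / s) * s ^ ?n - tensor f (y /\<^sub>R s) * (real ?n * s ^ (?n - 1))) / (s ^ ?n * s ^ ?n)) (at s)"
        by (rule DERIV_divide[OF d1 d2]) (use s in simp)
      show "((- T / s) * s ^ ?n - tensor f (y /\<^sub>R s) * (real ?n * s ^ (?n - 1))) / (s ^ ?n * s ^ ?n)
        = - (dilation_generator f (y /\<^sub>R s) / s ^ (?n + 1))"
        unfolding T m using s by (simp add: field_simps)
    qed
  qed
  have cont: "continuous_on {1..l} (\<lambda>s. - (dilation_generator f (y /\<^sub>R s) / s ^ (?n + 1)))"
    by (intro continuous_intros continuous_on_compose2[OF dilation_generator_continuous[OF f, of UNIV]]) auto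
  have "(LBINT s. indicator {1..l} s *\<^sub>R (- (dilation_generator f (y /\<^sub>R s) / s ^ (?n + 1))))
    = tensor f (y /\<^sub>R l) / l ^ ?n - tensor f (y /\<^sub>R 1) / 1 ^ ?n"
  proof (rule integral_FTC_atLeastAtMost[OF l _ cont])
    fix s :: real assume "1 \<le> s" "s \<le> l"
    then have "0 < s" by simp
    from deriv[OF this] show "((\<lambda>s. tensor f (y /\<^sub>R s) / s ^ ?n) has_vector_derivative
        - (dilation_generator f (y /\<^sub>R s) / s ^ (?n + 1))) (at s within {1..l})"
      by (simp only: has_real_derivative_iff_has_vector_derivative has_vector_derivative_at_within)
  qed
  then show ?thesis by simp
qed

text \<open>
Borel functions whose weak gradient identity is known for products of one-variable bumps. Both the test functions and their
derivatives stay in this class, which keeps all measurability obligations elementary.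
\<close>

locale tensor_weak_gradient =
  fixes h :: "real^'n::finite \<Rightarrow> complex" and g :: "real^'n \<Rightarrow> complex^'n"
  assumes h_borel [measurable]: "h \<in> borel_measurable borel"
    and g_borel [measurable]: "g \<in> borel_measurable borel"
    and h_loc: "\<And>R. set_integrable lborel (cball 0 R) h"
    and g_loc: "\<And>R. set_integrable lborel (cball 0 R) g"
    and weak: "\<And>f R i. bump_family f R \<Longrightarrow>
      (LBINT x. h x * of_real (tensor (f(i := deriv (f i))) x)) = - (LBINT x. g x $ i * of_real (tensor f x))"
begin

text \<open>
The derivative of \<open>h\<close> along the dilation field \<open>x\<close>, that is \<open>|x|\<close> times the radial derivative.
\<close>

definition euler :: "real^'n \<Rightarrow> complex" where
  "euler x = (\<Sum>i\<in>UNIV. of_real (x $ i) * g x $ i)"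

lemma g_component_borel [measurable]: "(\<lambda>x. g x $ i) \<in> borel_measurable borel"
  by (rule measurable_compose[OF g_borel borel_measurable_continuous_onI]) (intro continuous_intros)

lemma euler_borel [measurable]: "euler \<in> borel_measurable borel"
  unfolding euler_def[abs_def] by measurable

lemma norm_euler_le: "norm (euler x) \<le> norm x * norm (g x)"
proof -
  have "norm (euler x) \<le> (\<Sum>i\<in>UNIV. \<bar>x $ i\<bar> * \<bar>norm (g x $ i)\<bar>)"
    unfolding euler_def by (rule order_trans[OF norm_sum]) (simp add: norm_mult)
  also have "\<dots> \<le> L2_set (\<lambda>i. x $ i) UNIV * L2_set (\<lambda>i. norm (g x $ i)) UNIV"
    by (rule L2_set_mult_ineq)
  finally show ?thesis by (simp add: norm_vec_def L2_set_def)
qed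

lemma g_component_loc: "set_integrable lborel (cball 0 R) (\<lambda>x. g x $ i)"
  using integrable_bounded_linear[OF bounded_linear_vec_nth[of i] g_loc[of R, unfolded set_integrable_def]]
  by (simp add: set_integrable_def)

lemma euler_loc: "set_integrable lborel (cball 0 R) euler"
  unfolding set_integrable_def
proof (rule Bochner_Integration.integrable_bound)
  show "integrable lborel (\<lambda>x. R *\<^sub>R (indicator (cball 0 R) x *\<^sub>R g x))"
    using g_loc[of R] unfolding set_integrable_def by (rule Bochner_Integration.integrable_scaleR_right)
  show "AE x in lborel. norm (indicat_real (cball 0 R) x *\<^sub>R euler x) \<le> norm (R *\<^sub>R (indicat_real (cball 0 R) x *\<^sub>R g x))"
  proof (rule AE_I2)
    fix x
    show "norm (indicat_real (cball 0 R) x *\<^sub>R euler x) \<le> norm (R *\<^sub>R (indicat_real (cball 0 R) x *\<^sub>R g x))"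
    proof (cases "x \<in> cball 0 R")
      case True
      then have "norm x * norm (g x) \<le> R * norm (g x)" by (intro mult_right_mono) auto
      moreover have "0 \<le> R" using True by (auto intro: order_trans[OF norm_ge_zero])
      ultimately show ?thesis using True norm_euler_le[of x] by simp
    qed simp
  qed
  have [measurable]: "cball (0::real^'n) R \<in> sets borel" by simp
  show "(\<lambda>x. indicat_real (cball 0 R) x *\<^sub>R euler x) \<in> borel_measurable lborel" by measurable
qed

text \<open>
The \<open>i\<close>-th test function is \<open>y\<^sub>i \<phi> (y / s)\<close>, written as the product \<open>F i\<close>; the sum of the partial derivatives is
the dilation generator at \<open>y / s\<close>.
\<close>

lemma integral_h_dilation_generator:
  assumes f: "bump_family f R" and s: "0 < s"
  shows "(LBINT y. h y * of_real (dilation_generator f (y /\<^sub>R s))) =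
    - (LBINT y. euler y * of_real (tensor f (y /\<^sub>R s)))"
proof -
  define F where "F i j t = (if j = i then t * f i (t / s) else f j (t / s))" for i j :: 'n and t
  have sm: "smooth (\<lambda>t. f j (t / s))" for j
    using smooth_affine[OF bump_familyD(1)[OF f], of j "1 / s" 0] by simp
  have smF: "smooth (F i j)" for i j
    using sm smooth_mult[OF smooth_ident sm[of j]] by (cases "j = i") (simp_all add: F_def[abs_def])
  have F: "bump_family (F i) (s * R)" for i
    unfolding bump_family_def
  proof (intro conjI allI impI smF)
    fix j t assume "s * R < \<bar>t\<bar>"
    then have "R < \<bar>t / s\<bar>" using s by (simp add: field_simps)
    then show "F i j t = 0" using f by (auto simp: F_def bump_family_def)
  qed
  \<comment> \<open>Differentiating the factor \<open>t * f i (t / s)\<close> gives the two summands of the dilation generator.\<close>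
  have dF: "deriv (F i i) t = f i (t / s) + t / s * deriv (f i) (t / s)" for i t
  proof (rule DERIV_imp_deriv)
    have "((\<lambda>t. f i (t / s)) has_real_derivative deriv (f i) (t / s) * (1 / s)) (at t)"
      by (rule DERIV_chain2[OF smooth_deriv(1)[OF bump_familyD(1)[OF f]]]) (use s in \<open>auto intro!: derivative_eq_intros\<close>)
    from DERIV_mult[OF DERIV_ident this]
    show "(F i i has_real_derivative f i (t / s) + t / s * deriv (f i) (t / s)) (at t)"
      by (simp add: F_def[abs_def] mult_ac add.commute)
  qed
  have tF: "tensor (F i) y = y $ i * tensor f (y /\<^sub>R s)" for i y
    unfolding tensor_def by (subst (1 2) prod.remove[of UNIV i]) (auto simp: F_def divide_inverse mult_ac)
  have tdF: "tensor ((F i)(i := deriv (F i i))) y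
      = tensor f (y /\<^sub>R s) + (y /\<^sub>R s) $ i * tensor (f(i := deriv (f i))) (y /\<^sub>R s)" for i y
  proof -
    have "tensor ((F i)(i := deriv (F i i))) y = deriv (F i i) (y $ i) * (\<Prod>j\<in>UNIV - {i}. f j ((y /\<^sub>R s) $ j))"
      unfolding tensor_def by (subst prod.remove[of UNIV i]) (auto simp: F_def divide_inverse mult_ac)
    moreover have "tensor f (y /\<^sub>R s) = f i ((y /\<^sub>R s) $ i) * (\<Prod>j\<in>UNIV - {i}. f j ((y /\<^sub>R s) $ j))"
      unfolding tensor_def by (subst prod.remove[of UNIV i]) auto
    moreover have "tensor (f(i := deriv (f i))) (y /\<^sub>R s) = deriv (f i) ((y /\<^sub>R s) $ i) * (\<Prod>j\<in>UNIV - {i}. f j ((y /\<^sub>R s) $ j))"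
      unfolding tensor_def by (subst prod.remove[of UNIV i]) auto
    ultimately show ?thesis by (simp add: dF divide_inverse algebra_simps)
  qed
  have int_h: "integrable lborel (\<lambda>y. h y * of_real (tensor ((F i)(i := deriv (F i i))) y))" for i
    by (rule integrable_mult_compact_support[OF h_loc tensor_continuous tensor_zero_outside])
      (rule bump_familyD[OF F] bump_family_deriv[OF F] | assumption)+
  have int_g: "integrable lborel (\<lambda>y. g y $ i * of_real (tensor (F i) y))" for i
    by (rule integrable_mult_compact_support[OF g_component_loc tensor_continuous tensor_zero_outside])
      (rule bump_familyD[OF F] F | assumption)+
  have "(LBINT y. h y * of_real (dilation_generator f (y /\<^sub>R s)))
    = (LBINT y. (\<Sum>i\<in>UNIV. h y * of_real (tensor ((F i)(i := deriv (F i i))) y)))"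
    by (simp only: dilation_generator_def tdF of_real_sum sum_distrib_left)
  also have "\<dots> = (\<Sum>i\<in>UNIV. - (LBINT y. g y $ i * of_real (tensor (F i) y)))"
    by (simp only: Bochner_Integration.integral_sum[OF int_h] weak[OF F])
  also have "\<dots> = - (LBINT y. (\<Sum>i\<in>UNIV. g y $ i * of_real (tensor (F i) y)))"
    by (simp only: Bochner_Integration.integral_sum[OF int_g] sum_negf)
  also have "(\<lambda>y. \<Sum>i\<in>UNIV. g y $ i * of_real (tensor (F i) y)) = (\<lambda>y. euler y * of_real (tensor f (y /\<^sub>R s)))"
    by (simp add: fun_eq_iff tF euler_def sum_distrib_left mult_ac)
  finally show ?thesis .
qed

lemma integrable_euler_dilation:
  assumes l: "1 \<le> l"
  shows "integrable (lborel \<Otimes>\<^sub>M lborel) (\<lambda>(s, x). indicator {1..l} s *\<^sub>R indicator (cball (0::real^'n) R) x *\<^sub>R (1 / s) *\<^sub>R euler (s *\<^sub>R x))"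
proof (rule integrableI_bounded)
  let ?E = "\<lambda>s x. indicat_real {1..l} s *\<^sub>R indicat_real (cball (0::real^'n) R) x *\<^sub>R (1 / s) *\<^sub>R euler (s *\<^sub>R x)"
  have [measurable]: "cball (0::real^'n) r \<in> sets borel" for r by simp
  show "(\<lambda>(s, x). ?E s x) \<in> borel_measurable (lborel \<Otimes>\<^sub>M lborel)"
    by measurable
  let ?K = "\<integral>\<^sup>+y. ennreal (norm (indicat_real (cball 0 (l * R)) y *\<^sub>R euler y)) \<partial>lborel"
  have K: "?K < \<infinity>"
    using euler_loc[of "l * R"] by (simp add: set_integrable_def integrable_iff_bounded)
  have "(\<integral>\<^sup>+z. ennreal (norm (case z of (s, x :: real^'n) \<Rightarrow> ?E s x)) \<partial>(lborel \<Otimes>\<^sub>M (lborel :: (real^'n) measure)))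
    = (\<integral>\<^sup>+s. (\<integral>\<^sup>+x. ennreal (norm (?E s x)) \<partial>lborel) \<partial>lborel)"
    by (subst lborel.nn_integral_fst[symmetric]) auto
  also have "\<dots> \<le> (\<integral>\<^sup>+s. ?K * indicator {1..l} s \<partial>lborel)"
  proof (rule nn_integral_mono)
    fix s
    show "(\<integral>\<^sup>+x. ennreal (norm (?E s x)) \<partial>lborel) \<le> ?K * indicator {1..l} s"
    proof (cases "s \<in> {1..l}")
      case True
      then have s: "1 \<le> s" "s \<le> l" by auto
      have "(\<integral>\<^sup>+x. ennreal (norm (?E s x)) \<partial>lborel)
        \<le> (\<integral>\<^sup>+x. ennreal (norm (indicat_real (cball 0 (l * R)) (s *\<^sub>R x) *\<^sub>R euler (s *\<^sub>R x))) \<partial>lborel)"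
      proof (rule nn_integral_mono, rule ennreal_leI)
        fix x :: "real^'n"
        have "norm (s *\<^sub>R x) \<le> l * R" if "norm x \<le> R"
          using s that mult_mono[of s l "norm x" R] by simp
        moreover have "norm (euler (s *\<^sub>R x)) / s \<le> norm (euler (s *\<^sub>R x))"
          using s mult_left_mono[of 1 s "norm (euler (s *\<^sub>R x))"] by (simp add: divide_le_eq)
        ultimately show "norm (?E s x)
          \<le> norm (indicat_real (cball 0 (l * R)) (s *\<^sub>R x) *\<^sub>R euler (s *\<^sub>R x))"
          using s by (auto simp: indicator_def)
      qed
      also have "\<dots> \<le> ennreal (s ^ CARD('n)) * (\<integral>\<^sup>+x. ennreal (norm (indicat_real (cball 0 (l * R)) (s *\<^sub>R x) *\<^sub>R euler (s *\<^sub>R x))) \<partial>lborel)"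
        using s mult_right_mono[of 1 "ennreal (s ^ CARD('n))"] by (simp add: one_le_power)
      also have "\<dots> = ?K"
        by (rule nn_integral_lborel_scaleR[symmetric], measurable) (use s in simp)
      finally show ?thesis using True by simp
    qed simp
  qed
  also have "\<dots> = ?K * emeasure lborel {1..l}"
    by (subst nn_integral_cmult) auto
  also have "\<dots> < \<infinity>"
    using K by (auto simp: ennreal_mult_less_top emeasure_lborel_Icc_eq)
  finally show "(\<integral>\<^sup>+z. ennreal (norm (case z of (s, x :: real^'n) \<Rightarrow> ?E s x)) \<partial>(lborel \<Otimes>\<^sub>M (lborel :: (real^'n) measure))) < \<infinity>" .
qed

text \<open>
The integral of \<open>x \<bullet> g (s x)\<close> over \<open>s\<close> in \<open>[1, l]\<close>; the factor \<open>1 / s\<close> occurs because \<^const>\<open>euler\<close> at \<open>s x\<close> carries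
the vector \<open>s x\<close>.
\<close>

definition radial_increment :: "real \<Rightarrow> real^'n \<Rightarrow> complex" where
  "radial_increment l x = (LBINT s. indicator {1..l} s *\<^sub>R (1 / s) *\<^sub>R euler (s *\<^sub>R x))"

lemma radial_increment_loc:
  assumes "1 \<le> l"
  shows "set_integrable lborel (cball 0 R) (radial_increment l)"
  unfolding set_integrable_def
proof (rule Bochner_Integration.integrable_cong[THEN iffD1, rotated -1])
  show "integrable lborel (\<lambda>x. \<integral>s. indicator {1..l} s *\<^sub>R indicator (cball 0 R) x *\<^sub>R (1 / s) *\<^sub>R euler (s *\<^sub>R x) \<partial>lborel)"
    by (rule lborel_pair.integrable_snd[OF integrable_euler_dilation[OF assms]])
  show "(LBINT s. indicator {1..l} s *\<^sub>R indicator (cball 0 R) x *\<^sub>R (1 / s) *\<^sub>R euler (s *\<^sub>R x)) = indicator (cball 0 R) x *\<^sub>R radial_increment l x" for x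
    by (simp add: radial_increment_def indicator_def)
qed simp

text \<open>
Fubini is used twice: once to pull the test function out of the dilation integral, and once to recombine the
integrals of \<open>h\<close> against dilation generators into the difference of two dilated test functions. The change of variables
\<open>y = s x\<close> connects the two sides.
\<close>

lemma integral_radial_increment:
  assumes f: "bump_family f R" and le1: "\<And>x. \<bar>tensor f x\<bar> \<le> 1" and l: "1 \<le> l"
  shows "(LBINT x. radial_increment l x * of_real (tensor f x)) =
    (LBINT x. (h (l *\<^sub>R x) - h x) * of_real (tensor f x))"
proof -
  let ?n = "CARD('n)"
  define R' where "R' = real ?n * R"
  let ?V = "dilation_generator f"
  have [measurable]: "tensor f \<in> borel_measurable borel" "?V \<in> borel_measurable borel"
    by (intro borel_measurable_continuous_onI tensor_continuous dilation_generator_continuous[OF f] bump_familyD[OF f])+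
  have [measurable]: "cball (0::real^'n) r \<in> sets borel" for r by simp
  let ?P = "\<lambda>s x. (indicat_real {1..l} s *\<^sub>R (1 / s) *\<^sub>R euler (s *\<^sub>R x)) * of_real (tensor f x)"
  \<comment> \<open>Integrability over \<open>[1, l]\<close> times the support, for the two applications of Fubini.\<close>
  have int_P: "integrable (lborel \<Otimes>\<^sub>M lborel) (\<lambda>(s, x). ?P s x)"
  proof (rule Bochner_Integration.integrable_bound[OF integrable_euler_dilation[OF l, of R']])
    show "(\<lambda>(s, x). ?P s x) \<in> borel_measurable (lborel \<Otimes>\<^sub>M lborel)" by measurable
    show "AE z in lborel \<Otimes>\<^sub>M lborel. norm (case z of (s, x) \<Rightarrow> ?P s x)
      \<le> norm (case z of (s, x) \<Rightarrow> indicat_real {1..l} s *\<^sub>R indicat_real (cball 0 R') x *\<^sub>R (1 / s) *\<^sub>R euler (s *\<^sub>R x))"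
    proof (rule AE_I2)
      fix z :: "real \<times> (real^'n)"
      obtain s x where z: "z = (s, x)" by fastforce
      have "norm (?P s x) \<le> norm (indicat_real {1..l} s *\<^sub>R indicat_real (cball 0 R') x *\<^sub>R (1 / s) *\<^sub>R euler (s *\<^sub>R x))"
      proof (cases "norm x \<le> R'")
        case True
        have "norm (?P s x) = norm (indicat_real {1..l} s *\<^sub>R (1 / s) *\<^sub>R euler (s *\<^sub>R x)) * \<bar>tensor f x\<bar>"
          by (simp only: norm_mult norm_of_real)
        also have "\<dots> \<le> norm (indicat_real {1..l} s *\<^sub>R (1 / s) *\<^sub>R euler (s *\<^sub>R x))"
          by (rule mult_left_le[OF le1 norm_ge_zero])
        finally show ?thesis using True by simp
      next
        case False
        then show ?thesis using tensor_zero_outside[OF f, of x] by (simp add: R'_def)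
      qed
      then show "norm (case z of (s, x) \<Rightarrow> ?P s x)
          \<le> norm (case z of (s, x) \<Rightarrow> indicat_real {1..l} s *\<^sub>R indicat_real (cball 0 R') x *\<^sub>R (1 / s) *\<^sub>R euler (s *\<^sub>R x))"
        by (simp only: z prod.case)
    qed
  qed
  let ?Q = "\<lambda>s y. h y * of_real (indicat_real {1..l} s * (?V (y /\<^sub>R s) / s ^ (?n + 1)))"
  have int_Q: "integrable (lborel \<Otimes>\<^sub>M lborel) (\<lambda>(s, y). ?Q s y)"
  proof -
    have "bounded (?V ` cball 0 R')"
      by (intro compact_imp_bounded compact_continuous_image dilation_generator_continuous[OF f]) auto
    then obtain C where C: "0 < C" "\<And>z. z \<in> cball 0 R' \<Longrightarrow> \<bar>?V z\<bar> \<le> C"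
      unfolding bounded_pos by (metis imageI real_norm_def)
    have C': "\<bar>?V z\<bar> \<le> C" for z
      using C(1) C(2)[of z] dilation_generator_zero_outside[OF f, of z] by (cases "z \<in> cball 0 R'") (auto simp: R'_def)
    have "integrable lborel (\<lambda>s. of_real (C * indicat_real {1..l} s) :: complex)"
      by (intro integrable_of_real integrable_mult_right) (auto simp: emeasure_lborel_Icc_eq)
    from integrable_pair_mult[OF this, of "\<lambda>y. indicat_real (cball 0 (l * R')) y *\<^sub>R h y"] h_loc[of "l * R'"]
    have "integrable (lborel \<Otimes>\<^sub>M lborel) (\<lambda>(s, y). of_real (C * indicat_real {1..l} s) * (indicat_real (cball 0 (l * R')) y *\<^sub>R h y))"
      by (simp add: set_integrable_def)
    then show ?thesis
    proof (rule Bochner_Integration.integrable_bound)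
      show "(\<lambda>(s, y). ?Q s y) \<in> borel_measurable (lborel \<Otimes>\<^sub>M lborel)" by measurable
      show "AE z in lborel \<Otimes>\<^sub>M lborel. norm (case z of (s, y) \<Rightarrow> ?Q s y)
        \<le> norm (case z of (s, y) \<Rightarrow> of_real (C * indicat_real {1..l} s) * (indicat_real (cball 0 (l * R')) y *\<^sub>R h y))"
      proof (rule AE_I2)
        fix z :: "real \<times> (real^'n)"
        obtain s y where z: "z = (s, y)" by fastforce
        have "norm (?Q s y) \<le> norm (of_real (C * indicat_real {1..l} s) * (indicat_real (cball 0 (l * R')) y *\<^sub>R h y))"
        proof (cases "s \<in> {1..l} \<and> norm y \<le> l * R'")
          case True
          then have s: "1 \<le> s" by auto
          have "\<bar>?V (y /\<^sub>R s)\<bar> / s ^ (?n + 1) \<le> C / 1"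
            using s C(1) one_le_power[of s "?n + 1"] by (intro frac_le C') auto
          then have "norm (h y) * (\<bar>?V (y /\<^sub>R s)\<bar> / s ^ (?n + 1)) \<le> norm (h y) * C"
            by (intro mult_left_mono) auto
          then show ?thesis using True s C(1) by (simp add: norm_mult mult.commute norm_divide norm_power)
        next
          case False
          have "?V (y /\<^sub>R s) = 0" if "s \<in> {1..l}" "l * R' < norm y"
          proof (rule dilation_generator_zero_outside[OF f])
            have "R' < norm y / s"
            proof (cases "0 \<le> R'")
              case True
              then have "s * R' \<le> l * R'" using that by (intro mult_right_mono) auto
              then show ?thesis using that by (simp add: field_simps)
            next
              case False
              moreover have "0 \<le> norm y / s" using that by simp
              ultimately show ?thesis by linarith
            qed
            then show "real ?n * R < norm (y /\<^sub>R s)" using that by (simp add: R'_def divide_inverse mult.commute)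
          qed
          with False have Q0: "?Q s y = 0" by (cases "s \<in> {1..l}") auto
          show ?thesis by (simp only: Q0 norm_zero norm_ge_zero)
        qed
        then show "norm (case z of (s, y) \<Rightarrow> ?Q s y)
          \<le> norm (case z of (s, y) \<Rightarrow> of_real (C * indicat_real {1..l} s) * (indicat_real (cball 0 (l * R')) y *\<^sub>R h y))"
          by (simp only: z prod.case)
      qed
    qed
  qed
  have supp: "tensor f x = 0" if "R' < norm x" for x
    using tensor_zero_outside[OF f] that by (simp add: R'_def)
  have cont: "continuous_on UNIV (tensor f)"
    by (rule tensor_continuous) (rule bump_familyD[OF f])
  have int_h: "integrable lborel (\<lambda>x. h x * of_real (tensor f x))"
    by (rule integrable_mult_compact_support[OF h_loc cont supp])
  have int_hl: "integrable lborel (\<lambda>y. h y * of_real (tensor f (y /\<^sub>R l)))"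
  proof (rule integrable_mult_compact_support[OF h_loc])
    show "continuous_on UNIV (\<lambda>y. tensor f (y /\<^sub>R l))"
      by (intro continuous_on_compose2[OF cont] continuous_intros) auto
    show "tensor f (y /\<^sub>R l) = 0" if "l * R' < norm y" for y
      using that l by (intro supp) (simp add: field_simps)
  qed
  have scale_hl: "(LBINT y. h y * of_real (tensor f (y /\<^sub>R l))) = (l ^ ?n) *\<^sub>R (LBINT x. h (l *\<^sub>R x) * of_real (tensor f x))"
    using l by (subst integral_lborel_scaleR[of _ l]) auto
  have int_hl': "integrable lborel (\<lambda>x. h (l *\<^sub>R x) * of_real (tensor f x))"
    using integrable_lborel_scaleR[OF int_hl, of l] l by simp
  have "(LBINT x. radial_increment l x * of_real (tensor f x)) = (LBINT x. (LBINT s. ?P s x))"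
    by (simp only: radial_increment_def integral_mult_left_zero)
  also have "\<dots> = (LBINT s. (LBINT x. ?P s x))"
    by (rule lborel_pair.Fubini_integral[OF int_P])
  also have "\<dots> = (LBINT s. - (LBINT y. ?Q s y))"
  proof (rule Bochner_Integration.integral_cong[OF refl])
    fix s :: real
    show "(LBINT x. ?P s x) = - (LBINT y. ?Q s y)"
    proof (cases "s \<in> {1..l}")
      case True
      then have s: "0 < s" by auto
      have "- (LBINT y. ?Q s y) = - (LBINT y. (1 / s ^ (?n + 1)) *\<^sub>R (h y * of_real (?V (y /\<^sub>R s))))"
        using True by (simp add: scaleR_conv_of_real mult_ac)
      also have "\<dots> = (1 / s ^ (?n + 1)) *\<^sub>R (LBINT y. euler y * of_real (tensor f (y /\<^sub>R s)))"
        by (simp add: integral_h_dilation_generator[OF f s])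
      also have "(LBINT y. euler y * of_real (tensor f (y /\<^sub>R s))) = (s ^ ?n) *\<^sub>R (LBINT x. euler (s *\<^sub>R x) * of_real (tensor f x))"
        using s by (subst integral_lborel_scaleR[of _ s]) auto
      also have "(1 / s ^ (?n + 1)) *\<^sub>R (s ^ ?n) *\<^sub>R (LBINT x. euler (s *\<^sub>R x) * of_real (tensor f x))
        = (LBINT x. (1 / s) *\<^sub>R (euler (s *\<^sub>R x) * of_real (tensor f x)))"
        using s by simp
      also have "\<dots> = (LBINT x. ?P s x)"
        using True by simp
      finally show ?thesis by simp
    qed simp
  qed
  also have "\<dots> = - (LBINT y. (LBINT s. ?Q s y))"
    by (simp only: Bochner_Integration.integral_minus lborel_pair.Fubini_integral[OF int_Q])
  also have "\<dots> = (LBINT y. (1 / l ^ ?n) *\<^sub>R (h y * of_real (tensor f (y /\<^sub>R l))) - h y * of_real (tensor f y))"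
  proof (subst Bochner_Integration.integral_minus[symmetric], rule Bochner_Integration.integral_cong[OF refl])
    fix y
    have "- (LBINT s. ?Q s y) = h y * of_real (- (LBINT s. indicat_real {1..l} s * (?V (y /\<^sub>R s) / s ^ (?n + 1))))"
      by (simp only: integral_mult_right_zero integral_complex_of_real of_real_minus mult_minus_right)
    also have "\<dots> = h y * of_real (tensor f (y /\<^sub>R l) / l ^ ?n - tensor f y)"
      by (simp only: tensor_dilation_FTC[OF f l])
    also have "\<dots> = (1 / l ^ ?n) *\<^sub>R (h y * of_real (tensor f (y /\<^sub>R l))) - h y * of_real (tensor f y)"
      by (simp add: scaleR_conv_of_real algebra_simps)
    finally show "- (LBINT s. ?Q s y) = (1 / l ^ ?n) *\<^sub>R (h y * of_real (tensor f (y /\<^sub>R l))) - h y * of_real (tensor f y)" .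
  qed
  also have "\<dots> = (1 / l ^ ?n) *\<^sub>R (LBINT y. h y * of_real (tensor f (y /\<^sub>R l))) - (LBINT y. h y * of_real (tensor f y))"
    using int_hl int_h by (subst Bochner_Integration.integral_diff) auto
  also have "\<dots> = (LBINT x. h (l *\<^sub>R x) * of_real (tensor f x)) - (LBINT y. h y * of_real (tensor f y))"
    using l by (simp add: scale_hl)
  also have "\<dots> = (LBINT x. (h (l *\<^sub>R x) - h x) * of_real (tensor f x))"
    using int_hl' int_h by (simp add: left_diff_distrib)
  finally show ?thesis .
qed

text \<open>
Both sides have the same integral against every product of bumps that is bounded by 1, so the fundamental lemma applies.
\<close>

theorem dilation_increment:
  assumes l: "1 \<le> l"
  shows "AE x in lborel. h (l *\<^sub>R x) - h x = radial_increment l x"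
proof -
  have "AE x in lborel. h (l *\<^sub>R x) - h x - radial_increment l x = 0"
  proof (rule fundamental_lemma)
    have hl: "set_integrable lborel (cball 0 R) (\<lambda>x. h (l *\<^sub>R x))" for R
      using integrable_lborel_scaleR[OF h_loc[of "l * R", unfolded set_integrable_def], of l] l
      by (simp add: set_integrable_def indicator_def)
    show loc: "set_integrable lborel (cball 0 R) (\<lambda>x. h (l *\<^sub>R x) - h x - radial_increment l x)" for R
      by (intro set_integral_diff hl h_loc radial_increment_loc l)
    fix f :: "'n \<Rightarrow> real \<Rightarrow> real" and R :: real assume f: "bump_family f R" and le1: "\<And>x. \<bar>tensor f x\<bar> \<le> 1"
    have sup: "tensor f x = 0" if "real CARD('n) * R < norm x" for x
      using tensor_zero_outside[OF f that] .
    have cont: "continuous_on UNIV (tensor f)"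
      by (rule tensor_continuous) (rule bump_familyD[OF f])
    have i1: "integrable lborel (\<lambda>x. (h (l *\<^sub>R x) - h x) * of_real (tensor f x))"
      by (rule integrable_mult_compact_support[OF _ cont sup]) (intro set_integral_diff hl h_loc)
    have i2: "integrable lborel (\<lambda>x. radial_increment l x * of_real (tensor f x))"
      by (rule integrable_mult_compact_support[OF radial_increment_loc[OF l] cont sup])
    show "(LBINT x. (h (l *\<^sub>R x) - h x - radial_increment l x) * of_real (tensor f x)) = 0"
      unfolding left_diff_distrib[of "h (l *\<^sub>R _) - h _"]
      using i1 i2 by (simp add: integral_radial_increment[OF f le1 l])
  qed
  then show ?thesis by eventually_elim (simp add: algebra_simps)
qed

end


section \<open>Hardy inequality with remainder and the estimate for the mean\<close>

lemma measurable_interval_integral: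
  fixes k :: "real \<Rightarrow> 'b::{banach, second_countable_topology}"
  assumes [measurable]: "k \<in> borel_measurable borel"
  shows "(\<lambda>z. LBINT t:{fst z..snd z}. k t) \<in> borel_measurable (borel \<Otimes>\<^sub>M borel)"
proof -
  have "(\<lambda>z. LBINT t:{fst z..snd z}. k t) = (\<lambda>z. \<integral>t. (if fst z \<le> t \<and> t \<le> snd z then k t else 0) \<partial>lborel)"
    by (auto simp: fun_eq_iff set_lebesgue_integral_def intro!: Bochner_Integration.integral_cong)
  also have "\<dots> \<in> borel_measurable (borel \<Otimes>\<^sub>M borel)"
    by measurable
  finally show ?thesis .
qed

text \<open>
Rescaling the half line replaces the factor \<open>l\<close> by the end point \<open>s = l r\<close>.
\<close>

lemma AE_dilation_imp_increment:
  fixes f k :: "real \<Rightarrow> 'b::{banach, second_countable_topology}"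
  assumes [measurable]: "f \<in> borel_measurable borel" "k \<in> borel_measurable borel"
    and r: "0 < r"
    and ae: "AE l in lborel. 1 \<le> l \<longrightarrow> f (l * r) - f r = (LBINT t:{r..l * r}. k t)"
  shows "AE s in lborel. r < s \<longrightarrow> f s - f r = (LBINT t:{r..s}. k t)"
proof -
  have [measurable]: "(\<lambda>s. LBINT t:{r..s}. k t) \<in> borel_measurable borel"
    using measurable_compose[OF _ measurable_interval_integral[OF assms(2)], of "\<lambda>s. (r, s)" borel] by simp
  have "AE s in lborel. 1 \<le> 0 + (1 / r) * s \<longrightarrow> f ((0 + (1 / r) * s) * r) - f r = (LBINT t:{r..(0 + (1 / r) * s) * r}. k t)"
  proof (rule AE_borel_affine[OF _ _ ae])
    show "Measurable.pred borel (\<lambda>l. 1 \<le> l \<longrightarrow> f (l * r) - f r = (LBINT t:{r..l * r}. k t))"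
      by measurable
  qed (use r in simp)
  then show ?thesis
    by eventually_elim (use r in auto)
qed

text \<open>
The dimension is written as \<open>m + 3\<close> so that the weights \<open>r^(n-1)\<close> and \<open>r^(n-3)\<close> become \<open>r^(m+2)\<close> and \<open>r^m\<close>
without subtraction.
\<close>

locale H1_function = tensor_weak_gradient h g
  for h :: "real^'n::finite \<Rightarrow> complex" and g :: "real^'n \<Rightarrow> complex^'n" +
  fixes m :: nat
  assumes card: "CARD('n) = m + 3"
    and h_L2: "square_integral lborel h < \<infinity>"
    and g_L2: "square_integral lborel g < \<infinity>"
begin

definition radial :: "real^'n \<Rightarrow> complex" where
  "radial x = (1 / norm x) *\<^sub>R euler x"

lemma radial_borel [measurable]: "radial \<in> borel_measurable borel"
  unfolding radial_def[abs_def] by measurable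

lemma norm_radial_le: "norm (radial x) \<le> norm (g x)"
  using norm_euler_le[of x] by (cases "x = 0") (auto simp: radial_def divide_simps mult.commute)

lemma radial_L2: "square_integral lborel radial \<le> square_integral lborel g"
  by (intro nn_integral_mono ennreal_leI power_mono norm_radial_le) auto

lemma radial_increment_ray:
  assumes r: "0 < r" and l: "1 \<le> l" and w: "norm \<omega> = 1"
  shows "radial_increment l (r *\<^sub>R \<omega>) = (LBINT t:{r..l * r}. radial (t *\<^sub>R \<omega>))"
proof -
  have "(LBINT t:{r..l * r}. radial (t *\<^sub>R \<omega>))
    = \<bar>r\<bar> *\<^sub>R (LBINT s. indicator {r..l * r} (0 + r * s) *\<^sub>R radial ((0 + r * s) *\<^sub>R \<omega>))"
    unfolding set_lebesgue_integral_def by (rule lborel_integral_real_affine) (use r in simp)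
  also have "\<dots> = (LBINT s. r *\<^sub>R indicator {r..l * r} (r * s) *\<^sub>R radial ((r * s) *\<^sub>R \<omega>))"
    using r by (simp add: integral_scaleR_right[symmetric] del: integral_scaleR_right)
  also have "\<dots> = (LBINT s. indicator {1..l} s *\<^sub>R (1 / s) *\<^sub>R euler (s *\<^sub>R (r *\<^sub>R \<omega>)))"
  proof (rule Bochner_Integration.integral_cong[OF refl])
    fix s :: real
    have "r \<le> r * s \<longleftrightarrow> 1 \<le> s" "r * s \<le> l * r \<longleftrightarrow> s \<le> l" using r by (auto simp: mult.commute)
    then show "r *\<^sub>R indicator {r..l * r} (r * s) *\<^sub>R radial ((r * s) *\<^sub>R \<omega>)
        = indicator {1..l} s *\<^sub>R (1 / s) *\<^sub>R euler (s *\<^sub>R (r *\<^sub>R \<omega>))"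
      using r w by (auto simp: indicator_def radial_def abs_mult mult.commute)
  qed
  finally show ?thesis by (simp add: radial_increment_def)
qed

lemma radial_increment_measurable [measurable]:
  "(\<lambda>z. radial_increment (fst z) (snd z)) \<in> borel_measurable (borel \<Otimes>\<^sub>M borel)"
proof -
  have "(\<lambda>z. radial_increment (fst z) (snd z)) = (\<lambda>z. \<integral>s. (if 1 \<le> s \<and> s \<le> fst z then (1 / s) *\<^sub>R euler (s *\<^sub>R snd z) else 0) \<partial>lborel)"
    unfolding radial_increment_def by (intro ext Bochner_Integration.integral_cong) auto
  also have "\<dots> \<in> borel_measurable (borel \<Otimes>\<^sub>M borel)"
    by measurable
  finally show ?thesis .
qed

lemma AE_ray_increments:
  "AE \<omega> in sphere_measure. AE r in lborel. 0 < r \<longrightarrow>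
    (AE s in lborel. r < s \<longrightarrow> h (s *\<^sub>R \<omega>) - h (r *\<^sub>R \<omega>) = (LBINT t:{r..s}. radial (t *\<^sub>R \<omega>)))"
proof -
  have "AE l in lborel. AE x in lborel. 1 \<le> l \<longrightarrow> h (l *\<^sub>R x) - h x = radial_increment l x"
  proof (rule AE_I2)
    show "AE x in lborel. 1 \<le> l \<longrightarrow> h (l *\<^sub>R x) - h x = radial_increment l x" for l
      using dilation_increment[of l] by (cases "1 \<le> l") auto
  qed
  then have "AE x in lborel. AE l in lborel. 1 \<le> l \<longrightarrow> h (l *\<^sub>R x) - h x = radial_increment l x"
    by (subst (asm) lborel_pair.AE_commute) measurable
  from AE_polar(2)[OF this] AE_space show ?thesis
  proof eventually_elim
    case (elim \<omega>)
    then have w: "norm \<omega> = 1" by simp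
    from elim(1) show "AE r in lborel. 0 < r \<longrightarrow>
      (AE s in lborel. r < s \<longrightarrow> h (s *\<^sub>R \<omega>) - h (r *\<^sub>R \<omega>) = (LBINT t:{r..s}. radial (t *\<^sub>R \<omega>)))"
    proof eventually_elim
      case (elim r)
      show ?case
      proof
        assume r: "0 < r"
        have "AE l in lborel. 1 \<le> l \<longrightarrow> h ((l * r) *\<^sub>R \<omega>) - h (r *\<^sub>R \<omega>) = (LBINT t:{r..l * r}. radial (t *\<^sub>R \<omega>))"
          using elim[rule_format, OF r] by eventually_elim (simp add: radial_increment_ray[OF r _ w])
        then show "AE s in lborel. r < s \<longrightarrow> h (s *\<^sub>R \<omega>) - h (r *\<^sub>R \<omega>) = (LBINT t:{r..s}. radial (t *\<^sub>R \<omega>))"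
          by (intro AE_dilation_imp_increment[where f="\<lambda>s. h (s *\<^sub>R \<omega>)" and k="\<lambda>t. radial (t *\<^sub>R \<omega>)"] r) auto
      qed
    qed
  qed
qed

lemma AE_ray_square_integrable:
  fixes u :: "real^'n \<Rightarrow> complex"
  assumes [measurable]: "u \<in> borel_measurable borel"
    and u: "square_integral lborel u < \<infinity>"
  shows "AE \<omega> in sphere_measure. (\<integral>\<^sub>0r. ennreal (r ^ (m + 2) * (norm (u (r *\<^sub>R \<omega>)))\<^sup>2)) < \<infinity>"
proof -
  have eq: "indicator {0<..} r * (ennreal (r ^ (CARD('n) - 1)) * ennreal ((norm (u (r *\<^sub>R \<omega>)))\<^sup>2))
      = indicator {0<..} r * ennreal (r ^ (m + 2) * (norm (u (r *\<^sub>R \<omega>)))\<^sup>2)" for r \<omega>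
    by (cases "0 < r") (auto simp: card ennreal_mult)
  have [measurable]: "(\<lambda>z. u (snd z *\<^sub>R fst z)) \<in> borel_measurable (sphere_measure \<Otimes>\<^sub>M lborel)"
    using scaleR_sphere_measurable'[of u borel] by (simp add: split_beta' cong: measurable_cong_sets)
  have "(\<integral>\<^sup>+\<omega>. (\<integral>\<^sub>0r. ennreal (r ^ (m + 2) * (norm (u (r *\<^sub>R \<omega>)))\<^sup>2)) \<partial>sphere_measure) < \<infinity>"
  proof -
    have "(square_integral lborel u)
      = (\<integral>\<^sup>+\<omega>. (\<integral>\<^sub>0r. (ennreal (r ^ (CARD('n) - 1)) * ennreal ((norm (u (r *\<^sub>R \<omega>)))\<^sup>2))) \<partial>sphere_measure)"
      by (rule nn_integral_polar') measurable
    with u show ?thesis by (simp only: eq)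
  qed
  then have "AE \<omega> in sphere_measure. (\<integral>\<^sub>0r. ennreal (r ^ (m + 2) * (norm (u (r *\<^sub>R \<omega>)))\<^sup>2)) \<noteq> \<infinity>"
    by (intro nn_integral_PInf_AE) (auto intro!: lborel.borel_measurable_nn_integral)
  then show ?thesis by eventually_elim (simp add: less_top)
qed

text \<open>
This is \<open>(n - 2) / 2\<close>, the exponent of the power of \<open>1 / |x|\<close> for which the Hardy inequality is critical.
\<close>

definition hardy_exponent :: real where "hardy_exponent = (real m + 1) / 2"

text \<open>
On a ray this is \<open>r^(-(n-2)/2)\<close> times the derivative of \<open>r^((n-2)/2) h\<close>; it vanishes exactly where that product is
stationary, and its square is the remainder in the Hardy inequality.
\<close>

definition defect :: "real^'n \<Rightarrow> complex" where
  "defect x = radial x + of_real (hardy_exponent / norm x) * h x"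

lemma defect_borel [measurable]: "defect \<in> borel_measurable borel"
  unfolding defect_def[abs_def] by measurable

text \<open>
On almost every ray \<open>h\<close> agrees almost everywhere with an absolutely continuous function, to which the half line inequality
applies; polar coordinates sum up the rays.
\<close>

theorem Hardy_with_defect:
  "(\<integral>\<^sup>+x. ennreal ((norm (defect x))\<^sup>2 + hardy_exponent\<^sup>2 * (norm (h x) / norm x)\<^sup>2) \<partial>lborel)
    \<le> square_integral lborel g"
proof -
  let ?L = "\<lambda>r \<omega>. indicator {0<..} r * (ennreal (r ^ (CARD('n) - 1)) * ennreal ((norm (defect (r *\<^sub>R \<omega>)))\<^sup>2 + hardy_exponent\<^sup>2 * (norm (h (r *\<^sub>R \<omega>)) / norm (r *\<^sub>R \<omega>))\<^sup>2))"
  let ?R = "\<lambda>r \<omega>. indicator {0<..} r * (ennreal (r ^ (CARD('n) - 1)) * ennreal ((norm (radial (r *\<^sub>R \<omega>)))\<^sup>2))"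
  have "(\<integral>\<^sup>+x. ennreal ((norm (defect x))\<^sup>2 + hardy_exponent\<^sup>2 * (norm (h x) / norm x)\<^sup>2) \<partial>lborel)
    = (\<integral>\<^sup>+\<omega>. (\<integral>\<^sup>+r. ?L r \<omega> \<partial>lborel) \<partial>sphere_measure)"
    by (rule nn_integral_polar') measurable
  also have "\<dots> \<le> (\<integral>\<^sup>+\<omega>. (\<integral>\<^sup>+r. ?R r \<omega> \<partial>lborel) \<partial>sphere_measure)"
  proof (rule nn_integral_mono_AE)
    have "AE \<omega> in sphere_measure. \<omega> \<in> space sphere_measure" by (rule AE_space)
    with AE_ray_increments AE_ray_square_integrable[OF h_borel h_L2] AE_ray_square_integrable[OF radial_borel le_less_trans[OF radial_L2 g_L2]]
    show "AE \<omega> in sphere_measure.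
      (\<integral>\<^sup>+r. ?L r \<omega> \<partial>lborel)
      \<le> (\<integral>\<^sup>+r. ?R r \<omega> \<partial>lborel)"
    proof eventually_elim
      case (elim \<omega>)
      then have w: "norm \<omega> = 1" by simp
      let ?k = "\<lambda>t. radial (t *\<^sub>R \<omega>)"
      have "set_integrable lborel {c..d} ?k" if "0 < c" for c d
        by (rule set_integrable_of_weighted_square[OF _ that elim(3)]) measurable
      from AE_increments_imp_primitive[OF this elim(1)] obtain u where [measurable]: "u \<in> borel_measurable borel"
        and u: "primitive_on_pos u ?k" and hu: "AE r in lborel. 0 < r \<longrightarrow> h (r *\<^sub>R \<omega>) = u r"
        by blast
      have "(\<integral>\<^sub>0r. ennreal (r ^ (m + 2) * (norm (u r))\<^sup>2))
        = (\<integral>\<^sub>0r. ennreal (r ^ (m + 2) * (norm (h (r *\<^sub>R \<omega>)))\<^sup>2))"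
        by (rule nn_integral_cong_AE) (use hu in \<open>eventually_elim, auto simp: indicator_def\<close>)
      with elim(2) have u2: "(\<integral>\<^sub>0r. ennreal (r ^ (m + 2) * (norm (u r))\<^sup>2)) < \<infinity>" by simp
      have "(\<integral>\<^sup>+r. ?L r \<omega> \<partial>lborel)
        = (\<integral>\<^sub>0r. ennreal (r ^ (m + 2) * (norm (?k r + of_real (hardy_exponent / r) * u r))\<^sup>2 + hardy_exponent\<^sup>2 * (r ^ m * (norm (u r))\<^sup>2)))"
      proof (rule nn_integral_cong_AE)
        show "AE r in lborel. ?L r \<omega>
          = indicator {0<..} r * ennreal (r ^ (m + 2) * (norm (?k r + of_real (hardy_exponent / r) * u r))\<^sup>2 + hardy_exponent\<^sup>2 * (r ^ m * (norm (u r))\<^sup>2))"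
          using hu
        proof eventually_elim
          case (elim r)
          show ?case
          proof (cases "0 < r")
            case True
            have nr: "norm (r *\<^sub>R \<omega>) = r" using True w by simp
            have weight: "CARD('n) - 1 = m + 2" by (simp add: card)
            have eq: "r ^ (m + 2) * ((norm (?k r + of_real (hardy_exponent / r) * u r))\<^sup>2 + hardy_exponent\<^sup>2 * (norm (u r) / r)\<^sup>2)
              = r ^ (m + 2) * (norm (?k r + of_real (hardy_exponent / r) * u r))\<^sup>2 + hardy_exponent\<^sup>2 * (r ^ m * (norm (u r))\<^sup>2)"
              using True by (simp only: distrib_left power_divide) (simp add: power_add power2_eq_square)
            have "ennreal (r ^ (CARD('n) - 1)) * ennreal ((norm (defect (r *\<^sub>R \<omega>)))\<^sup>2 + hardy_exponent\<^sup>2 * (norm (h (r *\<^sub>R \<omega>)) / norm (r *\<^sub>R \<omega>))\<^sup>2)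
              = ennreal (r ^ (m + 2) * ((norm (?k r + of_real (hardy_exponent / r) * u r))\<^sup>2 + hardy_exponent\<^sup>2 * (norm (u r) / r)\<^sup>2))"
              unfolding defect_def nr elim[rule_format, OF True] weight
              by (rule ennreal_mult'[symmetric]) (use True in simp)
            then show ?thesis
              using True by (simp only: eq)
          qed simp
        qed
      qed
      also have "\<dots> \<le> (\<integral>\<^sub>0r. ennreal (r ^ (m + 2) * (norm (?k r))\<^sup>2))"
        unfolding hardy_exponent_def by (rule Hardy_half_line[OF u _ _ u2]) measurable
      also have "\<dots> = (\<integral>\<^sup>+r. ?R r \<omega> \<partial>lborel)"
        by (intro nn_integral_cong) (auto simp: card ennreal_mult indicator_def)
      finally show ?case .
    qed
  qed
  also have "\<dots> = square_integral lborel radial"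
    by (rule nn_integral_polar'[symmetric]) measurable
  also have "\<dots> \<le> square_integral lborel g"
    by (rule radial_L2)
  finally show ?thesis .
qed

end

context H1_function
begin

text \<open>
Needed for exchanging the mean with the integral along rays. The radial variable stays away from 0, where the polar weight is
bounded below, and the sphere has finite measure, so square integrability is enough.
\<close>

lemma integrable_radial_shell:
  assumes r: "0 < r"
  shows "integrable (lborel \<Otimes>\<^sub>M sphere_measure) (\<lambda>(t, \<omega>). indicator {r..R} t *\<^sub>R radial (t *\<^sub>R \<omega>))"
proof (rule integrableI_bounded)
  have [measurable]: "(\<lambda>z. radial (fst z *\<^sub>R snd z)) \<in> borel_measurable (lborel \<Otimes>\<^sub>M sphere_measure)"
    using scaleR_sphere_measurable[OF radial_borel] by (simp add: split_beta' cong: measurable_cong_sets)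
  have [measurable]: "(\<lambda>\<omega>. radial (t *\<^sub>R \<omega>)) \<in> borel_measurable sphere_measure" for t
    by (rule measurable_sphere_measure) measurable
  have [measurable]: "(\<lambda>r. square_integral sphere_measure (\<lambda>\<omega>. radial (r *\<^sub>R \<omega>))) \<in> borel_measurable borel"
    by (rule borel_measurable_sphere_nn_integral) measurable
  show "(\<lambda>(t, \<omega>). indicat_real {r..R} t *\<^sub>R radial (t *\<^sub>R \<omega>)) \<in> borel_measurable (lborel \<Otimes>\<^sub>M sphere_measure)"
    by (simp add: split_beta')
  let ?S = "emeasure (sphere_measure :: (real^'n) measure) (sphere 0 1)"
  let ?I = "\<lambda>t. square_integral sphere_measure (\<lambda>\<omega>. radial (t *\<^sub>R \<omega>))"
  have x_le: "x \<le> 1 + x\<^sup>2" if "0 \<le> x" for x :: real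
    using sum_squares_bound[of x 1] that by (simp add: power2_eq_square)
  have "(\<integral>\<^sup>+z. ennreal (norm (case z of (t, \<omega>) \<Rightarrow> indicat_real {r..R} t *\<^sub>R radial (t *\<^sub>R \<omega>))) \<partial>(lborel \<Otimes>\<^sub>M sphere_measure))
    = (\<integral>\<^sup>+t. (\<integral>\<^sup>+\<omega>. ennreal (norm (indicat_real {r..R} t *\<^sub>R radial (t *\<^sub>R \<omega>))) \<partial>sphere_measure) \<partial>lborel)"
    by (subst sphere_measure.nn_integral_fst[symmetric]) (auto simp: split_beta')
  also have "\<dots> \<le> (\<integral>\<^sup>+t. indicator {r..R} t * ?S + ennreal (1 / r ^ (m + 2)) * (indicator {0<..} t * (ennreal (t ^ (CARD('n) - 1)) * ?I t)) \<partial>lborel)"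
  proof (rule nn_integral_mono)
    fix t
    show "(\<integral>\<^sup>+\<omega>. ennreal (norm (indicat_real {r..R} t *\<^sub>R radial (t *\<^sub>R \<omega>))) \<partial>sphere_measure)
      \<le> indicator {r..R} t * ?S + ennreal (1 / r ^ (m + 2)) * (indicator {0<..} t * (ennreal (t ^ (CARD('n) - 1)) * ?I t))"
    proof (cases "t \<in> {r..R}")
      case True
      have "(\<integral>\<^sup>+\<omega>. ennreal (norm (radial (t *\<^sub>R \<omega>))) \<partial>sphere_measure) \<le> (\<integral>\<^sup>+\<omega>. 1 + ennreal ((norm (radial (t *\<^sub>R \<omega>)))\<^sup>2) \<partial>sphere_measure)"
      proof (rule nn_integral_mono)
        fix \<omega>
        have "ennreal (norm (radial (t *\<^sub>R \<omega>))) \<le> ennreal (1 + (norm (radial (t *\<^sub>R \<omega>)))\<^sup>2)"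
          by (intro ennreal_leI x_le) simp
        then show "ennreal (norm (radial (t *\<^sub>R \<omega>))) \<le> 1 + ennreal ((norm (radial (t *\<^sub>R \<omega>)))\<^sup>2)"
          by (subst (asm) ennreal_plus) auto
      qed
      also have "\<dots> = ?S + ?I t"
        by (subst nn_integral_add) auto
      also have "\<dots> \<le> ?S + ennreal (1 / r ^ (m + 2)) * (ennreal (t ^ (m + 2)) * ?I t)"
      proof (rule add_left_mono)
        have "r ^ (m + 2) \<le> t ^ (m + 2)" using True r by (intro power_mono) auto
        then have "1 \<le> 1 / r ^ (m + 2) * t ^ (m + 2)" using r by (simp add: divide_simps)
        then have "1 \<le> ennreal (1 / r ^ (m + 2) * t ^ (m + 2))" by (metis ennreal_1 ennreal_leI)
        also have "\<dots> = ennreal (1 / r ^ (m + 2)) * ennreal (t ^ (m + 2))"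
          by (rule ennreal_mult') (use r in simp)
        finally have one: "1 \<le> ennreal (1 / r ^ (m + 2)) * ennreal (t ^ (m + 2))" .
        show "?I t \<le> ennreal (1 / r ^ (m + 2)) * (ennreal (t ^ (m + 2)) * ?I t)"
          using mult_right_mono[OF one zero_le, of "?I t"] by (simp only: mult.assoc mult_1_left)
      qed
      finally show ?thesis using True r by (simp add: card)
    qed simp
  qed
  also have "\<dots> = emeasure lborel {r..R} * ?S + ennreal (1 / r ^ (m + 2)) * (\<integral>\<^sub>0t. (ennreal (t ^ (CARD('n) - 1)) * ?I t))"
    by (subst nn_integral_add) (auto simp: nn_integral_cmult nn_integral_multc)
  also have "(\<integral>\<^sub>0t. (ennreal (t ^ (CARD('n) - 1)) * ?I t)) = square_integral lborel radial"
    by (rule nn_integral_polar[symmetric]) measurable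
  also have "emeasure lborel {r..R} * ?S + ennreal (1 / r ^ (m + 2)) * square_integral lborel radial < \<infinity>"
    using le_less_trans[OF radial_L2 g_L2] by (auto simp: ennreal_mult_less_top emeasure_lborel_Icc_eq sphere_measure.emeasure_eq_measure)
  finally show "(\<integral>\<^sup>+z. ennreal (norm (case z of (t, \<omega>) \<Rightarrow> indicat_real {r..R} t *\<^sub>R radial (t *\<^sub>R \<omega>))) \<partial>(lborel \<Otimes>\<^sub>M sphere_measure)) < \<infinity>" .
qed

text \<open>
The increment identity is integrated over the sphere of radius \<open>r\<close>. Both \<open>r\<close> and \<open>l r\<close> have to be radii at
which \<open>h\<close> is integrable on the sphere, since otherwise the integral of the difference would not split.
\<close>

lemma AE_sphere_mean_dilation:
  assumes l: "1 \<le> l"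
  shows "AE r in lborel. 0 < r \<longrightarrow> sphere_mean h (l * r) - sphere_mean h r = (LBINT t:{r..l * r}. sphere_mean radial t)"
proof -
  interpret P: pair_sigma_finite "lborel :: real measure" "sphere_measure :: (real^'n) measure" ..
  have [measurable]: "(\<lambda>r. square_integral sphere_measure (\<lambda>\<omega>. h (r *\<^sub>R \<omega>))) \<in> borel_measurable borel"
    by (rule borel_measurable_sphere_nn_integral) measurable
  have good: "AE r in lborel. 0 < r \<longrightarrow> square_integral sphere_measure (\<lambda>\<omega>. h (r *\<^sub>R \<omega>)) < \<infinity>"
    by (rule AE_sphere_square_integrable[OF h_borel h_L2])
  \<comment> \<open>The summand 0 is the translation part of the affine substitution rule.\<close>
  have good_l: "AE r in lborel. 0 < 0 + l * r \<longrightarrow> (square_integral sphere_measure (\<lambda>\<omega>. h ((0 + l * r) *\<^sub>R \<omega>))) < \<infinity>"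
    by (rule AE_borel_affine[OF _ _ good]) (use l in simp, measurable)
  from good good_l AE_polar(1)[OF dilation_increment[OF l]] show ?thesis
  proof eventually_elim
    case (elim r)
    show ?case
    proof
      assume r: "0 < r"
      let ?M = "sphere_measure :: (real^'n) measure"
      have i1: "integrable ?M (\<lambda>\<omega>. h (r *\<^sub>R \<omega>))"
        by (rule integrable_sphere_of_square) (use elim(1) r in auto)
      have i2: "integrable ?M (\<lambda>\<omega>. h ((l * r) *\<^sub>R \<omega>))"
        by (rule integrable_sphere_of_square) (use elim(2) r l in auto)
      note shell = integrable_radial_shell[OF r, of "l * r"]
      have "(\<integral>\<omega>. h ((l * r) *\<^sub>R \<omega>) \<partial>?M) - (\<integral>\<omega>. h (r *\<^sub>R \<omega>) \<partial>?M) = (\<integral>\<omega>. h ((l * r) *\<^sub>R \<omega>) - h (r *\<^sub>R \<omega>) \<partial>?M)"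
        using i1 i2 by simp
      also have "\<dots> = (\<integral>\<omega>. (LBINT t. indicator {r..l * r} t *\<^sub>R radial (t *\<^sub>R \<omega>)) \<partial>?M)"
      proof (rule integral_cong_AE)
        show "(\<lambda>\<omega>. h ((l * r) *\<^sub>R \<omega>) - h (r *\<^sub>R \<omega>)) \<in> borel_measurable ?M"
          using i1 i2 by auto
        show "(\<lambda>\<omega>. \<integral>t. indicator {r..l * r} t *\<^sub>R radial (t *\<^sub>R \<omega>) \<partial>lborel) \<in> borel_measurable ?M"
          using P.integrable_snd[OF shell] by auto
        show "AE \<omega> in ?M. h ((l * r) *\<^sub>R \<omega>) - h (r *\<^sub>R \<omega>) = (LBINT t. indicator {r..l * r} t *\<^sub>R radial (t *\<^sub>R \<omega>))"
          using elim(3)[rule_format, OF r] AE_space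
        proof eventually_elim
          case (elim \<omega>)
          then have "norm \<omega> = 1" by simp
          from radial_increment_ray[OF r l this] elim(1) show ?case
            by (simp add: set_lebesgue_integral_def)
        qed
      qed
      also have "\<dots> = (LBINT t. (\<integral>\<omega>. indicator {r..l * r} t *\<^sub>R radial (t *\<^sub>R \<omega>) \<partial>?M))"
        by (rule P.Fubini_integral[OF shell])
      finally show "sphere_mean h (l * r) - sphere_mean h r = (LBINT t:{r..l * r}. sphere_mean radial t)"
        by (simp add: sphere_mean_def set_lebesgue_integral_def scaleR_diff_right[symmetric] scaleR_left_commute)
    qed
  qed
qed

lemma sphere_mean_primitive:
  "\<exists>u. u \<in> borel_measurable borel \<and> primitive_on_pos u (sphere_mean radial) \<and> (AE r in lborel. 0 < r \<longrightarrow> sphere_mean h r = u r)"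
proof (rule AE_increments_imp_primitive)
  have [measurable]: "sphere_mean h \<in> borel_measurable borel" "sphere_mean radial \<in> borel_measurable borel"
    by (rule sphere_mean_measurable, measurable)+
  have "(\<integral>\<^sub>0r. ennreal (r ^ (m + 2) * (norm (sphere_mean radial r))\<^sup>2)) < \<infinity>"
    using sphere_mean_L2[OF radial_borel] le_less_trans[OF radial_L2 g_L2]
    by (auto simp: card ennreal_mult_less_top elim!: le_less_trans)
  then show "set_integrable lborel {c..d} (sphere_mean radial)" if "0 < c" for c d
    by (rule set_integrable_of_weighted_square[rotated 2]) (use that in auto)
  have [measurable]: "(\<lambda>z. LBINT t:{snd z..fst z * snd z}. sphere_mean radial t) \<in> borel_measurable (borel \<Otimes>\<^sub>M borel)"
    using measurable_compose[OF _ measurable_interval_integral[of "sphere_mean radial"], of "\<lambda>z. (snd z, fst z * snd z)" "borel \<Otimes>\<^sub>M borel"]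
    by simp
  have "AE l in lborel. AE r in lborel. 1 \<le> l \<longrightarrow> 0 < r \<longrightarrow> sphere_mean h (l * r) - sphere_mean h r = (LBINT t:{r..l * r}. sphere_mean radial t)"
  proof (rule AE_I2)
    show "AE r in lborel. 1 \<le> l \<longrightarrow> 0 < r \<longrightarrow> sphere_mean h (l * r) - sphere_mean h r = (LBINT t:{r..l * r}. sphere_mean radial t)" for l
      using AE_sphere_mean_dilation[of l] by (cases "1 \<le> l") auto
  qed
  then have "AE r in lborel. AE l in lborel. 1 \<le> l \<longrightarrow> 0 < r \<longrightarrow> sphere_mean h (l * r) - sphere_mean h r = (LBINT t:{r..l * r}. sphere_mean radial t)"
    by (subst (asm) lborel_pair.AE_commute) measurable
  then show "AE r in lborel. 0 < r \<longrightarrow> (AE s in lborel. r < s \<longrightarrow> sphere_mean h s - sphere_mean h r = (LBINT t:{r..s}. sphere_mean radial t))"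
  proof eventually_elim
    case (elim r)
    show ?case
    proof
      assume r: "0 < r"
      have "AE l in lborel. 1 \<le> l \<longrightarrow> sphere_mean h (l * r) - sphere_mean h r = (LBINT t:{r..l * r}. sphere_mean radial t)"
        using elim by eventually_elim (use r in auto)
      then show "AE s in lborel. r < s \<longrightarrow> sphere_mean h s - sphere_mean h r = (LBINT t:{r..s}. sphere_mean radial t)"
        by (intro AE_dilation_imp_increment r) auto
    qed
  qed
qed

text \<open>
The mean of the defect is \<open>F' + a F / r\<close> for the mean \<open>F\<close> of \<open>h\<close>, so the two hypotheses bound, via Jensen, the two
integrals in the half line inequality; the division by the area \<open>S\<close> comes from there.
\<close>

theorem sphere_mean_Lp:
  fixes N D :: real
  defines "S \<equiv> measure (sphere_measure :: (real^'n) measure) (sphere 0 1)" and "p \<equiv> 2 * (real m + 3) / (real m + 1)"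
  assumes N: "(\<integral>\<^sup>+x. ennreal ((norm (h x) / norm x)\<^sup>2) \<partial>lborel) \<le> ennreal N" "0 \<le> N"
    and D: "square_integral lborel defect \<le> ennreal D" "0 \<le> D"
  shows "(\<integral>\<^sub>0r. ennreal (r ^ (m + 2) * norm (sphere_mean h r) powr p))
    \<le> ennreal ((4 * (N / S) * (D / S)) powr (1 / (real m + 1)) * (N / S))"
proof -
  have S: "0 < S" using measure_sphere_measure_pos by (simp add: S_def)
  obtain u where [measurable]: "u \<in> borel_measurable borel" and u: "primitive_on_pos u (sphere_mean radial)"
    and hu: "AE r in lborel. 0 < r \<longrightarrow> sphere_mean h r = u r"
    using sphere_mean_primitive by blast
  have [measurable]: "sphere_mean radial \<in> borel_measurable borel"
    by (rule sphere_mean_measurable) measurable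
  have "(\<integral>\<^sub>0r. ennreal (r ^ (m + 2) * norm (sphere_mean h r) powr p))
    = (\<integral>\<^sub>0r. ennreal (r ^ (m + 2) * norm (u r) powr p))"
    by (rule nn_integral_cong_AE) (use hu in \<open>eventually_elim, auto simp: indicator_def\<close>)
  also have "\<dots> \<le> ennreal ((4 * (N / S) * (D / S)) powr (1 / (real m + 1)) * (N / S))"
    unfolding p_def
  proof (rule Gagliardo_Nirenberg_half_line[OF u])
    \<comment> \<open>The mean of \<open>h / norm\<close> is the mean of \<open>h\<close> divided by the radius.\<close>
    define v where "v x = (1 / norm x) *\<^sub>R h x" for x
    have [measurable]: "v \<in> borel_measurable borel" unfolding v_def[abs_def] by measurable
    have v: "sphere_mean v r = (1 / r) *\<^sub>R sphere_mean h r" if r: "0 < r" for r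
    proof -
      have "(\<integral>\<omega>. v (r *\<^sub>R \<omega>) \<partial>sphere_measure) = (\<integral>\<omega>. (1 / r) *\<^sub>R h (r *\<^sub>R \<omega>) \<partial>sphere_measure)"
        using r by (intro Bochner_Integration.integral_cong) (auto simp: v_def)
      then show ?thesis by (simp add: sphere_mean_def)
    qed
    have "(\<integral>\<^sub>0r. ennreal (r ^ m * (norm (u r))\<^sup>2))
      = (\<integral>\<^sub>0r. ennreal (r ^ (CARD('n) - 1) * (norm (sphere_mean v r))\<^sup>2))"
    proof (rule nn_integral_cong_AE)
      show "AE r in lborel. indicator {0<..} r * ennreal (r ^ m * (norm (u r))\<^sup>2)
        = indicator {0<..} r * ennreal (r ^ (CARD('n) - 1) * (norm (sphere_mean v r))\<^sup>2)"
        using hu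
      proof eventually_elim
        case (elim r)
        show ?case
        proof (cases "0 < r")
          case True
          have "r ^ (CARD('n) - 1) * (norm (sphere_mean v r))\<^sup>2 = r ^ m * (norm (u r))\<^sup>2"
            using True elim by (simp add: v card power_add power_mult_distrib power_divide power2_eq_square)
          then show ?thesis by simp
        qed simp
      qed
    qed
    also have "\<dots> \<le> ennreal (1 / S) * square_integral lborel v"
      unfolding S_def by (rule sphere_mean_L2) measurable
    also have "\<dots> \<le> ennreal (1 / S) * ennreal N"
      using N(1) by (intro mult_left_mono) (auto simp: v_def)
    also have "\<dots> = ennreal (N / S)"
      using S N by (simp add: ennreal_mult'[symmetric])
    finally show "(\<integral>\<^sub>0r. ennreal (r ^ m * (norm (u r))\<^sup>2)) \<le> ennreal (N / S)" .
    have "(\<integral>\<^sub>0r. ennreal (r ^ (m + 2) * (norm (sphere_mean radial r + of_real ((real m + 1) / 2 / r) * u r))\<^sup>2))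
      = (\<integral>\<^sub>0r. ennreal (r ^ (CARD('n) - 1) * (norm (sphere_mean defect r))\<^sup>2))"
    proof (rule nn_integral_cong_AE)
      show "AE r in lborel. indicator {0<..} r * ennreal (r ^ (m + 2) * (norm (sphere_mean radial r + of_real ((real m + 1) / 2 / r) * u r))\<^sup>2)
        = indicator {0<..} r * ennreal (r ^ (CARD('n) - 1) * (norm (sphere_mean defect r))\<^sup>2)"
        using hu AE_sphere_square_integrable[OF h_borel h_L2] AE_sphere_square_integrable[OF radial_borel le_less_trans[OF radial_L2 g_L2]]
      proof eventually_elim
        case (elim r)
        show ?case
        proof (cases "0 < r")
          case True
          let ?M = "sphere_measure :: (real^'n) measure"
          have i1: "integrable ?M (\<lambda>\<omega>. h (r *\<^sub>R \<omega>))"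
            by (rule integrable_sphere_of_square) (use elim(2) True in auto)
          have i2: "integrable ?M (\<lambda>\<omega>. radial (r *\<^sub>R \<omega>))"
            by (rule integrable_sphere_of_square) (use elim(3) True in auto)
          have "(\<integral>\<omega>. defect (r *\<^sub>R \<omega>) \<partial>?M) = (\<integral>\<omega>. radial (r *\<^sub>R \<omega>) + of_real (hardy_exponent / r) * h (r *\<^sub>R \<omega>) \<partial>?M)"
            using True by (intro Bochner_Integration.integral_cong) (auto simp: defect_def)
          also have "\<dots> = (\<integral>\<omega>. radial (r *\<^sub>R \<omega>) \<partial>?M) + of_real (hardy_exponent / r) * (\<integral>\<omega>. h (r *\<^sub>R \<omega>) \<partial>?M)"
            using i1 i2 by (subst Bochner_Integration.integral_add) auto
          finally have "sphere_mean defect r = sphere_mean radial r + of_real (hardy_exponent / r) * sphere_mean h r"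
            by (simp add: sphere_mean_def scaleR_add_right)
          then show ?thesis using True elim(1) by (simp add: card hardy_exponent_def)
        qed simp
      qed
    qed
    also have "\<dots> \<le> ennreal (1 / S) * square_integral lborel defect"
      unfolding S_def by (rule sphere_mean_L2) measurable
    also have "\<dots> \<le> ennreal (1 / S) * ennreal D"
      by (intro mult_left_mono D(1)) auto
    also have "\<dots> = ennreal (D / S)"
      using S D by (simp add: ennreal_mult'[symmetric])
    finally show "(\<integral>\<^sub>0r. ennreal (r ^ (m + 2) * (norm (sphere_mean radial r + of_real ((real m + 1) / 2 / r) * u r))\<^sup>2)) \<le> ennreal (D / S)" .
  qed (use S N D in auto)
  finally show ?thesis .
qed

end


section \<open>From Lebesgue to Borel measurable functions\<close>

text \<open>
Null sets of the completed measure absorb the exceptional set of any preimage.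
\<close>

lemma borel_measurable_completion_AE:
  assumes f': "f' \<in> measurable M N" and ae: "AE x in M. f x = f' x" and sp: "space N = UNIV"
  shows "f \<in> measurable (completion M) N"
proof (rule measurableI)
  fix A assume A: "A \<in> sets N"
  show "f -` A \<inter> space (completion M) \<in> sets (completion M)"
  proof (rule completion.in_sets_AE)
    show "f' -` A \<inter> space M \<in> sets (completion M)"
      using measurable_sets[OF f' A] by (rule sets_completionI_sets)
    have "AE x in completion M. f x = f' x" by (rule AE_completion[OF ae])
    with AE_space show "AE x in completion M. x \<in> f' -` A \<inter> space M \<longleftrightarrow> x \<in> f -` A \<inter> space (completion M)"
      by eventually_elim auto
  qed simp
qed (simp add: sp)

lemma lebesgue_ex_borel:
  fixes f :: "'a::euclidean_space \<Rightarrow> 'b::euclidean_space"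
  assumes "f \<in> borel_measurable lebesgue"
  shows "\<exists>f'. f' \<in> borel_measurable borel \<and> (AE x in lborel. f x = f' x)"
proof -
  have "\<exists>f'. f' \<in> borel_measurable lborel \<and> (AE x in lborel. f x \<bullet> b = f' x)" for b
  proof -
    have "(\<lambda>x. f x \<bullet> b) \<in> borel_measurable lebesgue"
      using assms by (intro borel_measurable_inner) auto
    from completion_ex_borel_measurable_real[OF this] show ?thesis by blast
  qed
  then obtain F where F: "\<And>b. F b \<in> borel_measurable lborel" "\<And>b. AE x in lborel. f x \<bullet> b = F b x"
    by metis
  have "(\<lambda>x. \<Sum>b\<in>Basis. F b x *\<^sub>R b) \<in> borel_measurable borel"
    using F(1) by (intro borel_measurable_sum borel_measurable_scaleR) auto
  moreover have "AE x in lborel. \<forall>b\<in>Basis. f x \<bullet> b = F b x"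
    by (rule AE_finite_allI) (use F(2) in auto)
  then have "AE x in lborel. f x = (\<Sum>b\<in>Basis. F b x *\<^sub>R b)"
  proof eventually_elim
    case (elim x)
    then have "(\<Sum>b\<in>Basis. F b x *\<^sub>R b) = (\<Sum>b\<in>Basis. (f x \<bullet> b) *\<^sub>R b)"
      by (intro sum.cong) auto
    then show ?case by (simp add: euclidean_representation)
  qed
  ultimately show ?thesis by blast
qed

lemma powr_two_norm: "norm x powr 2 = (norm x)\<^sup>2"
  by (cases "norm x = 0") auto

lemma set_integrable_lborel_AE:
  fixes f f' :: "'a::euclidean_space \<Rightarrow> 'b::{banach, second_countable_topology}"
  assumes f: "set_integrable lebesgue K f" and [measurable]: "f' \<in> borel_measurable borel" "K \<in> sets borel"
    and ae: "AE x in lborel. f x = f' x"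
  shows "set_integrable lborel K f'"
proof -
  have "(\<integral>\<^sup>+x. ennreal (norm (indicator K x *\<^sub>R f' x)) \<partial>lborel) = (\<integral>\<^sup>+x. ennreal (norm (indicator K x *\<^sub>R f x)) \<partial>lebesgue)"
    unfolding nn_integral_completion
    by (rule nn_integral_cong_AE) (use ae in \<open>eventually_elim, auto\<close>)
  also have "\<dots> < \<infinity>"
    using f by (simp add: set_integrable_def integrable_iff_bounded)
  finally show ?thesis
    unfolding set_integrable_def by (intro integrableI_bounded) auto
qed

lemma integral_lebesgue_eq_lborel:
  fixes f f' :: "'a::euclidean_space \<Rightarrow> 'b::{banach, second_countable_topology}"
  assumes f': "f' \<in> borel_measurable borel" and ae: "AE x in lborel. f x = f' x"
  shows "(\<integral>x. f x \<partial>lebesgue) = (LBINT x. f' x)"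
proof -
  have "(\<integral>x. f x \<partial>lebesgue) = (\<integral>x. f' x \<partial>lebesgue)"
    by (rule integral_cong_AE)
      (use f' ae in \<open>auto intro: borel_measurable_completion_AE[where f'=f'] AE_completion measurable_completion\<close>)
  also have "\<dots> = (LBINT x. f' x)"
    by (rule integral_completion) (use f' in simp)
  finally show ?thesis .
qed

lemma in_Lp_2_nn_integral:
  assumes "in_Lp 2 M f"
  shows "square_integral M f = ennreal ((Lp_norm 2 M f)\<^sup>2)"
proof -
  have i: "integrable M (\<lambda>x. (norm (f x))\<^sup>2)"
    using assms by (simp add: in_Lp_def powr_two_norm)
  have "(Lp_norm 2 M f)\<^sup>2 = (\<integral>x. (norm (f x))\<^sup>2 \<partial>M)"
    by (simp add: Lp_norm_def powr_two_norm powr_half_sqrt)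
  then show ?thesis using i by (simp add: nn_integral_eq_integral)
qed

text \<open>
All hypotheses are integrals or almost everywhere statements, hence invariant under changes on null sets.
\<close>

lemma H1_function_borel_version:
  fixes h :: "real^'n::finite \<Rightarrow> complex" and g :: "real^'n \<Rightarrow> complex^'n"
  assumes card: "CARD('n) = m + 3"
    and h: "in_Lp 2 lebesgue h" and weak: "weak_gradient h g" and g: "in_Lp 2 lebesgue g"
    and h' [measurable]: "h' \<in> borel_measurable borel" and hh': "AE x in lborel. h x = h' x"
    and g' [measurable]: "g' \<in> borel_measurable borel" and gg': "AE x in lborel. g x = g' x"
  shows "H1_function h' g' m"
proof
  show "set_integrable lborel (cball 0 R) h'" for R
    using weak hh' by (intro set_integrable_lborel_AE[where f=h]) (auto simp: weak_gradient_def locally_integrable_def)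
  show "set_integrable lborel (cball 0 R) g'" for R
    using weak gg' by (intro set_integrable_lborel_AE[where f=g]) (auto simp: weak_gradient_def locally_integrable_def)
  have "square_integral lborel h' = square_integral lebesgue h"
    unfolding nn_integral_completion
    by (rule nn_integral_cong_AE) (use hh' in \<open>eventually_elim, auto\<close>)
  then show "square_integral lborel h' < \<infinity>"
    using in_Lp_2_nn_integral[OF h] by simp
  have "square_integral lborel g' = square_integral lebesgue g"
    unfolding nn_integral_completion
    by (rule nn_integral_cong_AE) (use gg' in \<open>eventually_elim, auto\<close>)
  then show "square_integral lborel g' < \<infinity>"
    using in_Lp_2_nn_integral[OF g] by simp
  fix f :: "'n \<Rightarrow> real \<Rightarrow> real" and R :: real and i :: 'n
  assume f: "bump_family f R"
  have sm: "\<And>j. smooth (f j)" and sm': "\<And>j. smooth ((f(i := deriv (f i))) j)"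
    using bump_familyD[OF f] by auto
  have [measurable]: "tensor f \<in> borel_measurable borel" "tensor (f(i := deriv (f i))) \<in> borel_measurable borel"
    by (intro borel_measurable_continuous_onI tensor_continuous sm sm')+
  have [measurable]: "(\<lambda>x. g' x $ i) \<in> borel_measurable borel"
    by (rule measurable_compose[OF g' borel_measurable_continuous_onI]) (intro continuous_intros)
  have "(LBINT x. h' x * of_real (tensor (f(i := deriv (f i))) x)) = (\<integral>x. h x * of_real (partial_deriv i (tensor f) x) \<partial>lebesgue)"
    unfolding partial_deriv_tensor[of f, OF sm]
    by (rule integral_lebesgue_eq_lborel[symmetric]) (measurable, use hh' in \<open>eventually_elim, auto\<close>)
  also have "\<dots> = - (\<integral>x. g x $ i * of_real (tensor f x) \<partial>lebesgue)"
    using weak test_function_tensor[OF f] by (simp add: weak_gradient_def)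
  also have "(\<integral>x. g x $ i * of_real (tensor f x) \<partial>lebesgue) = (LBINT x. g' x $ i * of_real (tensor f x))"
    by (rule integral_lebesgue_eq_lborel) (measurable, use gg' in \<open>eventually_elim, auto\<close>)
  finally show "(LBINT x. h' x * of_real (tensor (f(i := deriv (f i))) x)) = - (LBINT x. g' x $ i * of_real (tensor f x))" .
qed (rule h' g' card)+

lemma AE_radial_measure:
  assumes "AE r in lborel. 0 < r \<longrightarrow> P r"
  shows "AE r in radial_measure n. P r"
proof -
  have "AE r in lebesgue_on {0<..}. P r"
    using AE_completion[OF assms] by (subst AE_restrict_space_iff) auto
  then show ?thesis
    unfolding radial_measure_def by (subst AE_density) (auto intro!: measurable_restrict_space1 measurable_completion)
qed

lemma nn_integral_radial_measure:
  fixes f :: "real \<Rightarrow> ennreal"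
  assumes [measurable]: "f \<in> borel_measurable borel"
  shows "(\<integral>\<^sup>+r. f r \<partial>radial_measure n) = (\<integral>\<^sub>0r. (ennreal (r ^ (n - 1)) * f r))"
proof -
  have "(\<integral>\<^sup>+r. f r \<partial>radial_measure n) = (\<integral>\<^sup>+r. ennreal (r ^ (n - 1)) * f r \<partial>lebesgue_on {0<..})"
    unfolding radial_measure_def
    by (rule nn_integral_density) (auto intro!: measurable_restrict_space1 measurable_completion)
  also have "\<dots> = (\<integral>\<^sup>+r. (ennreal (r ^ (n - 1)) * f r) * indicator {0<..} r \<partial>lebesgue)"
    by (rule nn_integral_restrict_space) simp
  finally show ?thesis by (simp add: nn_integral_completion mult.commute)
qed

lemma borel_measurable_radial_measure:
  fixes f f' :: "real \<Rightarrow> 'b::euclidean_space"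
  assumes f': "f' \<in> borel_measurable borel" and ae: "AE r in lborel. 0 < r \<longrightarrow> f r = f' r"
  shows "f \<in> borel_measurable (radial_measure n)"
proof -
  have "(\<lambda>r. indicator {0<..} r *\<^sub>R f r) \<in> borel_measurable lebesgue"
  proof (rule borel_measurable_completion_AE)
    show "(\<lambda>r. indicator {0<..} r *\<^sub>R f' r) \<in> borel_measurable lborel" using f' by simp
    show "AE r in lborel. indicator {0<..} r *\<^sub>R f r = indicator {0<..} r *\<^sub>R f' r"
      using ae by eventually_elim (auto simp: indicator_def)
  qed simp
  then have "(\<lambda>r. indicator {0<..} r *\<^sub>R f r) \<in> borel_measurable (lebesgue_on {0<..})"
    by (rule measurable_restrict_space1)
  then have "f \<in> borel_measurable (lebesgue_on {0<..})"
    by (rule measurable_cong[THEN iffD1, rotated]) (auto simp: space_restrict_space)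
  then show ?thesis
    unfolding radial_measure_def by simp
qed

text \<open>
By polar coordinates a null set in space meets almost every sphere in a null set of that sphere. The restriction of \<open>h\<close> to
such a sphere is in general measurable only for the completed surface measure.
\<close>

lemma spherical_mean_borel_version:
  fixes h h' :: "real^'n::finite \<Rightarrow> complex"
  assumes h' [measurable]: "h' \<in> borel_measurable borel" and hh': "AE x in lborel. h x = h' x"
    and L2: "square_integral lborel h' < \<infinity>"
  shows "AE r in lborel. 0 < r \<longrightarrow> integrable surface_measure (\<lambda>\<omega>. h (r *\<^sub>R \<omega>)) \<and> spherical_mean h r = sphere_mean h' r"
  using AE_polar(1)[OF hh'] AE_sphere_square_integrable[OF h' L2]
proof eventually_elim
  case (elim r)
  show ?case
  proof
    assume r: "0 < r"
    let ?M = "sphere_measure :: (real^'n) measure"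
    have m': "(\<lambda>\<omega>. h' (r *\<^sub>R \<omega>)) \<in> borel_measurable ?M"
      by (rule measurable_sphere_measure) measurable
    have i': "integrable ?M (\<lambda>\<omega>. h' (r *\<^sub>R \<omega>))"
      by (rule integrable_sphere_of_square[OF h']) (use elim(2) r in blast)
    have ae: "AE \<omega> in ?M. h (r *\<^sub>R \<omega>) = h' (r *\<^sub>R \<omega>)" using elim(1) r by blast
    have m: "(\<lambda>\<omega>. h (r *\<^sub>R \<omega>)) \<in> borel_measurable (completion ?M)"
      by (rule borel_measurable_completion_AE[OF m' ae]) simp
    have "integrable (completion ?M) (\<lambda>\<omega>. h' (r *\<^sub>R \<omega>))"
      using i' m' by (simp add: integrable_completion)
    then have i: "integrable (completion ?M) (\<lambda>\<omega>. h (r *\<^sub>R \<omega>))"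
      by (rule integrable_cong_AE_imp[OF _ m]) (use AE_completion[OF ae] in \<open>eventually_elim, auto\<close>)
    have "(\<integral>\<omega>. h (r *\<^sub>R \<omega>) \<partial>completion ?M) = (\<integral>\<omega>. h' (r *\<^sub>R \<omega>) \<partial>completion ?M)"
      by (rule integral_cong_AE[OF m measurable_completion[OF m'] AE_completion[OF ae]])
    also have "\<dots> = (\<integral>\<omega>. h' (r *\<^sub>R \<omega>) \<partial>?M)"
      by (rule integral_completion[OF m'])
    finally show "integrable surface_measure (\<lambda>\<omega>. h (r *\<^sub>R \<omega>)) \<and> spherical_mean h r = sphere_mean h' r"
      using i sets.top[of ?M] by (simp add: surface_measure_eq_completion spherical_mean_def sphere_mean_def del: sets.top)
  qed
qed


section \<open>The estimates for spherical means\<close>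

text \<open>
With \<open>t = 1 / n\<close> the exponent \<open>2 / p\<close> equals \<open>1 - 2 t\<close>. The powers of \<open>1 / S\<close> then add up to 1, those of \<open>N\<close> to \<open>1 - t\<close>,
and \<open>4 powr t\<close> is estimated by 4.
\<close>

lemma powr_sphere_mean_exponents:
  fixes N D S :: real and m :: nat
  assumes "0 \<le> N" "0 \<le> D" "0 < S" "0 \<le> I"
    and I: "I \<le> (4 * (N / S) * (D / S)) powr (1 / (real m + 1)) * (N / S)"
  shows "I powr ((real m + 1) / (real m + 3)) \<le> 4 / S * D powr (1 / (real m + 3)) * N powr (1 - 1 / (real m + 3))"
proof -
  define t where "t = 1 / (real m + 3)"
  have t: "0 < t" "t \<le> 1" "(real m + 1) / (real m + 3) = 1 - 2 * t"
    "1 / (real m + 1) * ((real m + 1) / (real m + 3)) = t"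
    by (auto simp: t_def field_simps)
  have e: "0 \<le> (real m + 1) / (real m + 3)" by simp
  have "I powr ((real m + 1) / (real m + 3)) \<le> ((4 * (N / S) * (D / S)) powr (1 / (real m + 1)) * (N / S)) powr ((real m + 1) / (real m + 3))"
    by (rule powr_mono2[OF e]) (use assms in auto)
  also have "\<dots> = (4 * (N / S) * (D / S)) powr t * (N / S) powr (1 - 2 * t)"
  proof -
    have pw: "(P powr c * Q) powr d = P powr (c * d) * Q powr d" if "0 \<le> Q" for P Q c d :: real
      using that by (simp add: powr_mult powr_powr)
    show ?thesis
      unfolding pw[OF divide_nonneg_pos[OF \<open>0 \<le> N\<close> \<open>0 < S\<close>]] t(4) unfolding t(3) ..
  qed
  also have "(4 * (N / S) * (D / S)) powr t = 4 powr t * ((N / S) powr t * (D powr t * (1 / S) powr t))"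
    using assms by (simp add: powr_mult[symmetric] mult.assoc)
  also have "4 powr t * ((N / S) powr t * (D powr t * (1 / S) powr t)) * (N / S) powr (1 - 2 * t)
    = 4 powr t * D powr t * (1 / S) powr t * ((N / S) powr t * (N / S) powr (1 - 2 * t))"
    by (simp only: mult_ac)
  also have "(N / S) powr t * (N / S) powr (1 - 2 * t) = (N / S) powr (1 - t)"
    by (simp add: powr_add[symmetric])
  also have "(N / S) powr (1 - t) = N powr (1 - t) * (1 / S) powr (1 - t)"
    using assms by (subst powr_mult[symmetric]) auto
  also have "4 powr t * D powr t * (1 / S) powr t * (N powr (1 - t) * (1 / S) powr (1 - t))
    = 4 powr t * ((1 / S) powr t * (1 / S) powr (1 - t)) * (D powr t * N powr (1 - t))"
    by (simp only: mult_ac)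
  also have "(1 / S) powr t * (1 / S) powr (1 - t) = 1 / S"
    using assms by (simp add: powr_add[symmetric])
  also have "4 powr t * (1 / S) * (D powr t * N powr (1 - t)) \<le> 4 powr 1 * (1 / S) * (D powr t * N powr (1 - t))"
    using assms t by (intro mult_right_mono powr_mono) auto
  finally show ?thesis by (simp add: t_def)
qed

text \<open>
The Hardy inequality with remainder first gives finiteness of \<open>N\<close>; only then can \<open>a\<^sup>2 N\<close> be subtracted, which bounds the
square of the defect by the deficit \<open>D\<close> and allows the estimate for the mean of the Borel version to be applied.
\<close>

theorem spherical_mean_estimate:
  fixes h :: "real^'n::finite \<Rightarrow> complex" and g :: "real^'n \<Rightarrow> complex^'n"
  defines "n \<equiv> CARD('n)"
  defines "p \<equiv> 2 * real n / (real n - 2)"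
  defines "N \<equiv> (Lp_norm 2 lebesgue (\<lambda>x. h x /\<^sub>R norm x))\<^sup>2"
  defines "D \<equiv> (Lp_norm 2 lebesgue g)\<^sup>2 - ((real n - 2) / 2)\<^sup>2 * N"
  assumes n: "3 \<le> n"
    and h: "in_Lp 2 lebesgue h" and weak: "weak_gradient h g" and g: "in_Lp 2 lebesgue g"
  shows "in_Lp 2 lebesgue (\<lambda>x. h x /\<^sub>R norm x)" and "0 \<le> D"
    and "AE r in radial_measure n. integrable surface_measure (\<lambda>\<omega>. h (r *\<^sub>R \<omega>))"
    and "in_Lp p (radial_measure n) (spherical_mean h)"
    and "(Lp_norm p (radial_measure n) (spherical_mean h))\<^sup>2
      \<le> 4 / measure (sphere_measure :: (real^'n) measure) (sphere 0 1) * D powr (1 / real n) * N powr (1 - 1 / real n)"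
proof -
  define m where "m = n - 3"
  have m: "CARD('n) = m + 3" "n = m + 3" using n by (auto simp: m_def n_def)
  have p: "p = 2 * (real m + 3) / (real m + 1)" "0 < p" by (auto simp: p_def m(2))
  obtain h' where h' [measurable]: "h' \<in> borel_measurable borel" and hh': "AE x in lborel. h x = h' x"
    using lebesgue_ex_borel[of h] h by (auto simp: in_Lp_def)
  obtain g' where g' [measurable]: "g' \<in> borel_measurable borel" and gg': "AE x in lborel. g x = g' x"
    using lebesgue_ex_borel[of g] g by (auto simp: in_Lp_def)
  interpret H1_function h' g' m
    by (rule H1_function_borel_version[OF m(1) h weak g h' hh' g' gg'])
  have G: "square_integral lborel g' = ennreal ((Lp_norm 2 lebesgue g)\<^sup>2)"
    unfolding in_Lp_2_nn_integral[OF g, symmetric] nn_integral_completion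
    by (rule nn_integral_cong_AE) (use gg' in \<open>eventually_elim, auto\<close>)
  have "hardy_exponent = (real n - 2) / 2" "0 < hardy_exponent" by (auto simp: hardy_exponent_def m(2))
  note hardy_exponent = this
  have split: "(\<integral>\<^sup>+x. ennreal ((norm (defect x))\<^sup>2 + hardy_exponent\<^sup>2 * (norm (h' x) / norm x)\<^sup>2) \<partial>lborel)
    = square_integral lborel defect + ennreal (hardy_exponent\<^sup>2) * (\<integral>\<^sup>+x. ennreal ((norm (h' x) / norm x)\<^sup>2) \<partial>lborel)"
  proof -
    have "(\<integral>\<^sup>+x. ennreal ((norm (defect x))\<^sup>2 + hardy_exponent\<^sup>2 * (norm (h' x) / norm x)\<^sup>2) \<partial>lborel)
      = (\<integral>\<^sup>+x. ennreal ((norm (defect x))\<^sup>2) + ennreal (hardy_exponent\<^sup>2) * ennreal ((norm (h' x) / norm x)\<^sup>2) \<partial>lborel)"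
      by (intro nn_integral_cong) (simp add: ennreal_mult)
    also have "\<dots> = square_integral lborel defect + (\<integral>\<^sup>+x. ennreal (hardy_exponent\<^sup>2) * ennreal ((norm (h' x) / norm x)\<^sup>2) \<partial>lborel)"
      by (rule nn_integral_add) measurable
    also have "(\<integral>\<^sup>+x. ennreal (hardy_exponent\<^sup>2) * ennreal ((norm (h' x) / norm x)\<^sup>2) \<partial>lborel) = ennreal (hardy_exponent\<^sup>2) * (\<integral>\<^sup>+x. ennreal ((norm (h' x) / norm x)\<^sup>2) \<partial>lborel)"
      by (rule nn_integral_cmult) measurable
    finally show ?thesis .
  qed
  have Hardy: "square_integral lborel defect + ennreal (hardy_exponent\<^sup>2) * (\<integral>\<^sup>+x. ennreal ((norm (h' x) / norm x)\<^sup>2) \<partial>lborel)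
      \<le> ennreal ((Lp_norm 2 lebesgue g)\<^sup>2)"
    using Hardy_with_defect unfolding split G .
  have hx: "(\<integral>\<^sup>+x. ennreal ((norm (h x /\<^sub>R norm x))\<^sup>2) \<partial>lebesgue) = (\<integral>\<^sup>+x. ennreal ((norm (h' x) / norm x)\<^sup>2) \<partial>lborel)"
    unfolding nn_integral_completion
    by (rule nn_integral_cong_AE) (use hh' in \<open>eventually_elim, auto simp: divide_inverse mult.commute\<close>)
  have "ennreal (hardy_exponent\<^sup>2) * (\<integral>\<^sup>+x. ennreal ((norm (h' x) / norm x)\<^sup>2) \<partial>lborel) \<le> ennreal ((Lp_norm 2 lebesgue g)\<^sup>2)"
    using Hardy by (rule order_trans[rotated]) simp
  then have "ennreal (hardy_exponent\<^sup>2) * (\<integral>\<^sup>+x. ennreal ((norm (h' x) / norm x)\<^sup>2) \<partial>lborel) < \<infinity>"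
    by (rule le_less_trans) simp
  then have fin: "(\<integral>\<^sup>+x. ennreal ((norm (h' x) / norm x)\<^sup>2) \<partial>lborel) < \<infinity>"
    using hardy_exponent by (auto simp: ennreal_mult_less_top)
  have meas_hx: "(\<lambda>x. h x /\<^sub>R norm x) \<in> borel_measurable lebesgue"
  proof (rule borel_measurable_completion_AE)
    show "(\<lambda>x. h' x /\<^sub>R norm x) \<in> borel_measurable lborel" by measurable
    show "AE x in lborel. h x /\<^sub>R norm x = h' x /\<^sub>R norm x"
      using hh' by eventually_elim auto
  qed simp
  show hx_Lp: "in_Lp 2 lebesgue (\<lambda>x. h x /\<^sub>R norm x)"
    unfolding in_Lp_def powr_two_norm
  proof (intro conjI meas_hx integrableI_bounded)
    show "(\<lambda>x. (norm (h x /\<^sub>R norm x))\<^sup>2) \<in> borel_measurable lebesgue"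
      by (rule borel_measurable_power[OF measurable_compose[OF meas_hx borel_measurable_norm]])
    show "(\<integral>\<^sup>+x. ennreal (norm ((norm (h x /\<^sub>R norm x))\<^sup>2)) \<partial>lebesgue) < \<infinity>"
      using fin unfolding hx[symmetric] by simp
  qed
  have N: "(\<integral>\<^sup>+x. ennreal ((norm (h' x) / norm x)\<^sup>2) \<partial>lborel) = ennreal N"
    using in_Lp_2_nn_integral[OF hx_Lp] hx by (simp add: N_def)
  have N0: "0 \<le> N" by (simp add: N_def)
  have aN: "ennreal (hardy_exponent\<^sup>2) * ennreal N = ennreal (hardy_exponent\<^sup>2 * N)" by (rule ennreal_mult'[symmetric]) simp
  have D: "D = (Lp_norm 2 lebesgue g)\<^sup>2 - hardy_exponent\<^sup>2 * N" by (simp add: D_def hardy_exponent)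
  have Hardy': "square_integral lborel defect + ennreal (hardy_exponent\<^sup>2 * N) \<le> ennreal ((Lp_norm 2 lebesgue g)\<^sup>2)"
    using Hardy unfolding N aN .
  then have "ennreal (hardy_exponent\<^sup>2 * N) \<le> ennreal ((Lp_norm 2 lebesgue g)\<^sup>2)"
    by (rule order_trans[rotated]) simp
  then show D0: "0 \<le> D" by (simp add: D)
  have "ennreal ((Lp_norm 2 lebesgue g)\<^sup>2) = ennreal D + ennreal (hardy_exponent\<^sup>2 * N)"
    using D0 N0 by (subst ennreal_plus[symmetric]) (auto simp: D)
  with Hardy' have defect_le: "square_integral lborel defect \<le> ennreal D"
    by (simp add: ennreal_add_left_cancel_le add.commute)
  have sm: "AE r in lborel. 0 < r \<longrightarrow> integrable surface_measure (\<lambda>\<omega>. h (r *\<^sub>R \<omega>)) \<and> spherical_mean h r = sphere_mean h' r"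
    by (rule spherical_mean_borel_version[OF h' hh' h_L2])
  have smi: "AE r in lborel. 0 < r \<longrightarrow> integrable surface_measure (\<lambda>\<omega>. h (r *\<^sub>R \<omega>))"
    using sm by eventually_elim auto
  show "AE r in radial_measure n. integrable surface_measure (\<lambda>\<omega>. h (r *\<^sub>R \<omega>))"
    by (rule AE_radial_measure[OF smi])
  have sme: "AE r in lborel. 0 < r \<longrightarrow> spherical_mean h r = sphere_mean h' r"
    using sm by eventually_elim auto
  have [measurable]: "sphere_mean h' \<in> borel_measurable borel" by (rule sphere_mean_measurable[OF h'])
  have meas_sm: "spherical_mean h \<in> borel_measurable (radial_measure n)"
    by (rule borel_measurable_radial_measure[OF _ sme]) measurable
  define S where "S = measure (sphere_measure :: (real^'n) measure) (sphere 0 1)"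
  have S: "0 < S" using measure_sphere_measure_pos by (simp add: S_def)
  define B where "B = (4 * (N / S) * (D / S)) powr (1 / (real m + 1)) * (N / S)"
  have B0: "0 \<le> B" using N0 S by (simp add: B_def)
  have "(\<integral>\<^sup>+r. ennreal (norm (spherical_mean h r) powr p) \<partial>radial_measure n) = (\<integral>\<^sup>+r. ennreal (norm (sphere_mean h' r) powr p) \<partial>radial_measure n)"
    by (rule nn_integral_cong_AE) (use AE_radial_measure[OF sme] in \<open>eventually_elim, auto\<close>)
  also have "\<dots> = (\<integral>\<^sub>0r. (ennreal (r ^ (n - 1)) * ennreal (norm (sphere_mean h' r) powr p)))"
    by (rule nn_integral_radial_measure) measurable
  also have "\<dots> = (\<integral>\<^sub>0r. ennreal (r ^ (m + 2) * norm (sphere_mean h' r) powr p))"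
    by (intro nn_integral_cong) (auto simp: m(2) ennreal_mult indicator_def)
  also have "\<dots> \<le> ennreal B"
    unfolding B_def S_def p(1) by (rule sphere_mean_Lp) (use N N0 defect_le D0 in auto)
  finally have Lp_le: "(\<integral>\<^sup>+r. ennreal (norm (spherical_mean h r) powr p) \<partial>radial_measure n) \<le> ennreal B" .
  have int_p: "integrable (radial_measure n) (\<lambda>r. norm (spherical_mean h r) powr p)"
    using meas_sm Lp_le by (intro integrableI_bounded) (auto intro: le_less_trans)
  then show "in_Lp p (radial_measure n) (spherical_mean h)"
    using meas_sm by (simp add: in_Lp_def)
  define I where "I = (\<integral>r. norm (spherical_mean h r) powr p \<partial>radial_measure n)"
  have I0: "0 \<le> I" by (simp add: I_def)
  have "ennreal I \<le> ennreal B"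
    using Lp_le int_p by (simp add: nn_integral_eq_integral I_def)
  then have IB: "I \<le> B" using B0 by simp
  have "(Lp_norm p (radial_measure n) (spherical_mean h))\<^sup>2 = I powr ((real m + 1) / (real m + 3))"
  proof -
    have "1 / p + 1 / p = (real m + 1) / (real m + 3)"
      using p by (simp add: field_simps)
    then show ?thesis
      by (simp add: Lp_norm_def I_def[symmetric] power2_eq_square powr_add[symmetric])
  qed
  also have "\<dots> \<le> 4 / S * D powr (1 / (real m + 3)) * N powr (1 - 1 / (real m + 3))"
    by (rule powr_sphere_mean_exponents[OF N0 D0 S I0 IB[unfolded B_def]])
  finally show "(Lp_norm p (radial_measure n) (spherical_mean h))\<^sup>2
      \<le> 4 / measure (sphere_measure :: (real^'n) measure) (sphere 0 1) * D powr (1 / real n) * N powr (1 - 1 / real n)"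
    by (simp add: S_def m(2) add.commute)
qed

lemma weighted_product_le_sum:
  fixes x y t :: real
  assumes "0 \<le> x" "0 \<le> y" "0 \<le> t" "t \<le> 1"
  shows "x powr t * y powr (1 - t) \<le> x + y"
proof -
  have "x powr t * y powr (1 - t) \<le> (x + y) powr t * (x + y) powr (1 - t)"
    using assms by (intro mult_mono powr_mono2) auto
  also have "\<dots> = x + y"
    using assms by (simp add: powr_add[symmetric])
  finally show ?thesis .
qed

theorem corollary5:
  fixes n :: nat and p :: real
  assumes n_def: "n = CARD('n::finite)"
    and n: "3 \<le> n"
    and p_def: "p = 2 * real n / (real n - 2)"
  shows
    "(\<forall>(h :: real^'n \<Rightarrow> complex) g.
        in_Lp 2 lebesgue h \<and> weak_gradient h g \<and> in_Lp 2 lebesgue g \<longrightarrow>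
          in_Lp 2 lebesgue (\<lambda>x. h x /\<^sub>R norm x) \<and>
          0 \<le> (Lp_norm 2 lebesgue g)\<^sup>2
            - ((real n - 2) / 2)\<^sup>2 * (Lp_norm 2 lebesgue (\<lambda>x. h x /\<^sub>R norm x))\<^sup>2 \<and>
          (AE r in radial_measure n. integrable surface_measure (\<lambda>\<omega>. h (r *\<^sub>R \<omega>))) \<and>
          in_Lp p (radial_measure n) (spherical_mean h)) \<and>
     (\<exists>C>0. \<forall>(h :: real^'n \<Rightarrow> complex) g.
        in_Lp 2 lebesgue h \<and> weak_gradient h g \<and> in_Lp 2 lebesgue g \<longrightarrow>
          (Lp_norm p (radial_measure n) (spherical_mean h))\<^sup>2
          \<le> C * ((Lp_norm 2 lebesgue g)\<^sup>2
                  - ((real n - 2) / 2)\<^sup>2 * (Lp_norm 2 lebesgue (\<lambda>x. h x /\<^sub>R norm x))\<^sup>2)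
                powr (1 / real n)
              * ((Lp_norm 2 lebesgue (\<lambda>x. h x /\<^sub>R norm x))\<^sup>2) powr (1 - 1 / real n)) \<and>
     (\<exists>C>0. \<forall>\<epsilon>>0. \<forall>(h :: real^'n \<Rightarrow> complex) g.
        in_Lp 2 lebesgue h \<and> weak_gradient h g \<and> in_Lp 2 lebesgue g \<longrightarrow>
          \<epsilon> powr (1 - 1 / real n) * (Lp_norm p (radial_measure n) (spherical_mean h))\<^sup>2
          \<le> C * ((Lp_norm 2 lebesgue g)\<^sup>2
                  - (((real n - 2) / 2)\<^sup>2 - \<epsilon>)
                    * (Lp_norm 2 lebesgue (\<lambda>x. h x /\<^sub>R norm x))\<^sup>2))"
proof (intro conjI)
  define C where "C = 4 / measure (sphere_measure :: (real^'n) measure) (sphere 0 1)"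
  have C: "0 < C" using measure_sphere_measure_pos by (simp add: C_def)
  note est = spherical_mean_estimate[where 'n='n, folded n_def, OF n, folded p_def C_def]
  show "\<forall>(h :: real^'n \<Rightarrow> complex) g.
        in_Lp 2 lebesgue h \<and> weak_gradient h g \<and> in_Lp 2 lebesgue g \<longrightarrow>
          in_Lp 2 lebesgue (\<lambda>x. h x /\<^sub>R norm x) \<and>
          0 \<le> (Lp_norm 2 lebesgue g)\<^sup>2
            - ((real n - 2) / 2)\<^sup>2 * (Lp_norm 2 lebesgue (\<lambda>x. h x /\<^sub>R norm x))\<^sup>2 \<and>
          (AE r in radial_measure n. integrable surface_measure (\<lambda>\<omega>. h (r *\<^sub>R \<omega>))) \<and>
          in_Lp p (radial_measure n) (spherical_mean h)"
    using est(1-4) by blast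
  show "\<exists>C>0. \<forall>(h :: real^'n \<Rightarrow> complex) g.
        in_Lp 2 lebesgue h \<and> weak_gradient h g \<and> in_Lp 2 lebesgue g \<longrightarrow>
          (Lp_norm p (radial_measure n) (spherical_mean h))\<^sup>2
          \<le> C * ((Lp_norm 2 lebesgue g)\<^sup>2
                  - ((real n - 2) / 2)\<^sup>2 * (Lp_norm 2 lebesgue (\<lambda>x. h x /\<^sub>R norm x))\<^sup>2)
                powr (1 / real n)
              * ((Lp_norm 2 lebesgue (\<lambda>x. h x /\<^sub>R norm x))\<^sup>2) powr (1 - 1 / real n)"
    using C est(5) by blast
  show "\<exists>C>0. \<forall>\<epsilon>>0. \<forall>(h :: real^'n \<Rightarrow> complex) g.
        in_Lp 2 lebesgue h \<and> weak_gradient h g \<and> in_Lp 2 lebesgue g \<longrightarrow>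
          \<epsilon> powr (1 - 1 / real n) * (Lp_norm p (radial_measure n) (spherical_mean h))\<^sup>2
          \<le> C * ((Lp_norm 2 lebesgue g)\<^sup>2
                  - (((real n - 2) / 2)\<^sup>2 - \<epsilon>)
                    * (Lp_norm 2 lebesgue (\<lambda>x. h x /\<^sub>R norm x))\<^sup>2)"
  proof (rule exI[of _ C], intro conjI C allI impI)
    fix \<epsilon> :: real and h :: "real^'n \<Rightarrow> complex" and g
    assume \<epsilon>: "0 < \<epsilon>" and "in_Lp 2 lebesgue h \<and> weak_gradient h g \<and> in_Lp 2 lebesgue g"
    then have hg: "in_Lp 2 lebesgue h" "weak_gradient h g" "in_Lp 2 lebesgue g" by auto
    define N where "N = (Lp_norm 2 lebesgue (\<lambda>x. h x /\<^sub>R norm x))\<^sup>2"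
    define D where "D = (Lp_norm 2 lebesgue g)\<^sup>2 - ((real n - 2) / 2)\<^sup>2 * N"
    define L where "L = (Lp_norm p (radial_measure n) (spherical_mean h))\<^sup>2"
    have D0: "0 \<le> D" and N0: "0 \<le> N" and LC: "L \<le> C * D powr (1 / real n) * N powr (1 - 1 / real n)"
      using est(2,5)[OF hg] by (simp_all add: D_def N_def L_def)
    have "\<epsilon> powr (1 - 1 / real n) * L \<le> \<epsilon> powr (1 - 1 / real n) * (C * D powr (1 / real n) * N powr (1 - 1 / real n))"
      by (rule mult_left_mono[OF LC]) simp
    also have "\<dots> = C * (D powr (1 / real n) * (\<epsilon> * N) powr (1 - 1 / real n))"
      using \<epsilon> N0 by (simp add: powr_mult)
    also have "\<dots> \<le> C * (D + \<epsilon> * N)"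
      using C D0 N0 \<epsilon> n by (intro mult_left_mono weighted_product_le_sum) auto
    also have "D + \<epsilon> * N = (Lp_norm 2 lebesgue g)\<^sup>2 - (((real n - 2) / 2)\<^sup>2 - \<epsilon>) * N"
      by (simp add: D_def algebra_simps)
    finally show "\<epsilon> powr (1 - 1 / real n) * (Lp_norm p (radial_measure n) (spherical_mean h))\<^sup>2
          \<le> C * ((Lp_norm 2 lebesgue g)\<^sup>2
                  - (((real n - 2) / 2)\<^sup>2 - \<epsilon>)
                    * (Lp_norm 2 lebesgue (\<lambda>x. h x /\<^sub>R norm x))\<^sup>2)"
      by (simp add: L_def N_def)
  qed
qed

end
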